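(* A matrix $A\in S_5$ with eigenvalues $\{f_j\}_{j=1}^5$ (counted with multiplicity) satisfies all of the following conditions: (i) $W(A)$ is an elliptical disk; (ii) the foci of $\partial W(A)$ are $\{f_1,f_2\}$; (iii) the foci of the pentagram curve are $\{f_3,f_4\}$; (iv) the Brianchon curve is the single point $f_5$; if and only if the complex numbers $\{f_j\}_{j=1}^5$ satisfy $$\{f_3,f_4\}=\left\{\frac{f_5-f_2}{1-f_2\bar f_5},\ \frac{f_5-f_1}{1-f_1\bar f_5}\right\}$$ as sets and $$f_3+f_4+f_1f_2f_5\,\bar f_4\bar f_3=f_1+f_2+f_5,$$ $$f_3f_4+f_1f_2f_5(\bar f_4+\bar f_3)=f_1f_2+f_2f_5+f_1f_5.$$
   Context: $\mathbb{D}$ is the open unit disk and $\mathbb{T}$ the unit circle in $\mathbb{C}$. $S_n$ is the set of complex $n\times n$ matrices $A$ with $\|A\|=1$, all eigenvalues in $\mathbb{D}$, and $\operatorname{rank}(I-AA^* )=\operatorname{rank}(I-A^*A)=1$. The numerical range is $W(A)=\{\langle x,Ax\rangle:\ x\in\mathbb{C}^n,\ \|x\|=1\}$; it is an elliptical disk if it is bounded by an ellipse. For $A\in S_5$ with $\Phi_5(z)=\det(zI-A)=\sum_{i=0}^5 c_iz^i$ put $\Phi_5^*(z)=\sum_{i=0}^5\overline{c_i}z^{5-i}$. For $\lambda\in\mathbb{T}$, the polynomial $z\Phi_5(z)-\bar\lambda\Phi_5^*(z)$ has $6$ distinct zeros, all on $\mathbb{T}$; label them in cyclic order $P_1,\ldots,P_6$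 (indices mod $6$). (As $\lambda$ varies, the convex hexagons $P_1\cdots P_6$ are exactly the hexagons inscribed in $\mathbb{T}$ and circumscribed about $W(A)$.) The pentagram curve of $A$ is the envelope of all lines $P_jP_{j+2}$, and the Brianchon curve of $A$ is the envelope of all lines $P_jP_{j+3}$, over all $\lambda\in\mathbb{T}$ and all $j$. The pentagram curve is an ellipse $E$ when the corresponding lines are exactly the tangent lines of $E$; condition (iii) means that the pentagram curve is an ellipse with foci $f_3,f_4$. The Brianchon curve is a single point $p$ when all the corresponding lines pass through $p$. The two foci of a circle both equal its center. *)

theory Defs
  imports "HOL-Analysis.Analysis" "HOL-Computational_Algebra.Polynomial"
begin

definition conj_transpose :: "complex^'n^'m \<Rightarrow> complex^'m^'n" where
  "conj_transpose A = (\<chi> i j. cnj (A $ j $ i))"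

(* Conjugate-linear in the first argument, so that the value of <x, A x> at a unit
   eigenvector x of A is the eigenvalue itself and not its conjugate. *)
definition cinner :: "complex^'n \<Rightarrow> complex^'n \<Rightarrow> complex" where
  "cinner x y = (\<Sum>i\<in>UNIV. cnj (x $ i) * y $ i)"

definition eigenvalue :: "complex^'n^'n \<Rightarrow> complex \<Rightarrow> bool" where
  "eigenvalue A c \<longleftrightarrow> (\<exists>v. v \<noteq> 0 \<and> A *v v = c *s v)"

definition charpoly :: "complex^'n^'n \<Rightarrow> complex poly" where
  "charpoly A = det (mat [:0, 1:] - map_matrix (\<lambda>c. [:c:]) A)"

(* The norm on complex^'n is the Euclidean one, so onorm is the spectral norm. *)
definition S_class :: "(complex^'n^'n) set" where
  "S_class = {A. onorm (\<lambda>x. A *v x) = 1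
     \<and> (\<forall>c. eigenvalue A c \<longrightarrow> norm c < 1)
     \<and> rank (mat 1 - A ** conj_transpose A) = 1
     \<and> rank (mat 1 - conj_transpose A ** A) = 1}"

definition numerical_range :: "complex^'n^'n \<Rightarrow> complex set" where
  "numerical_range A = {cinner x (A *v x) | x. norm x = 1}"


definition ellipse :: "complex \<Rightarrow> complex \<Rightarrow> real \<Rightarrow> complex set" where
  "ellipse a b r = {z. dist z a + dist z b = r}"

definition is_ellipse_with_foci :: "complex set \<Rightarrow> complex \<Rightarrow> complex \<Rightarrow> bool" where
  "is_ellipse_with_foci E a b \<longleftrightarrow> (\<exists>r. dist a b < r \<and> E = ellipse a b r)"

definition elliptical_disk :: "complex set \<Rightarrow> bool" where
  "elliptical_disk W \<longleftrightarrow>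
     (\<exists>a b r. dist a b < r \<and> W = {z. dist z a + dist z b \<le> r})"

(* A line is tangent to a nondegenerate ellipse iff it meets it in exactly one point;
   this is used for such ellipses only. *)
definition tangent_lines :: "complex set \<Rightarrow> complex set set" where
  "tangent_lines E = {L. (\<exists>p q. p \<noteq> q \<and> L = affine hull {p, q}) \<and> (\<exists>!z. z \<in> L \<inter> E)}"

definition envelope_is_ellipse_with_foci ::
    "complex set set \<Rightarrow> complex \<Rightarrow> complex \<Rightarrow> bool" where
  "envelope_is_ellipse_with_foci \<L> a b \<longleftrightarrow>
     (\<exists>E. is_ellipse_with_foci E a b \<and> \<L> = tangent_lines E)"

definition envelope_is_point :: "complex set set \<Rightarrow> complex \<Rightarrow> bool" where
  "envelope_is_point \<L> p \<longleftrightarrow> (\<forall>L\<in>\<L>. p \<in> L)"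


(* The reversal is taken with respect to n, not to the degree of p. *)
definition conj_reversal :: "nat \<Rightarrow> complex poly \<Rightarrow> complex poly" where
  "conj_reversal n p = (\<Sum>i\<le>n. monom (cnj (coeff p i)) (n - i))"

definition vertex_poly :: "complex^'n^'n \<Rightarrow> complex \<Rightarrow> complex poly" where
  "vertex_poly A lam =
     [:0, 1:] * charpoly A - smult (cnj lam) (conj_reversal CARD('n) (charpoly A))"

(* P 0, ..., P (m - 1) are m distinct points of the unit circle in counterclockwise order. *)
definition cyclically_ordered :: "nat \<Rightarrow> (nat \<Rightarrow> complex) \<Rightarrow> bool" where
  "cyclically_ordered m P \<longleftrightarrow>
     (\<exists>t :: nat \<Rightarrow> real. strict_mono_on {..<m} t \<and>
        (\<forall>j<m. t j < t 0 + 2 * pi \<and> P j = cis (t j)))"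

definition vertex_labelling :: "complex^'n^'n \<Rightarrow> complex \<Rightarrow> (nat \<Rightarrow> complex) \<Rightarrow> bool" where
  "vertex_labelling A lam P \<longleftrightarrow>
     cyclically_ordered (CARD('n) + 1) P \<and>
     P ` {..<CARD('n) + 1} = {z. poly (vertex_poly A lam) z = 0}"

definition diagonal_lines :: "nat \<Rightarrow> complex^'n^'n \<Rightarrow> complex set set" where
  "diagonal_lines k A =
     {affine hull {P j, P ((j + k) mod (CARD('n) + 1))} | lam P j.
        norm lam = 1 \<and> vertex_labelling A lam P \<and> j < CARD('n) + 1}"

definition pentagram_is_ellipse_with_foci ::
    "complex^5^5 \<Rightarrow> complex \<Rightarrow> complex \<Rightarrow> bool" where
  "pentagram_is_ellipse_with_foci A a b \<longleftrightarrow>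
     envelope_is_ellipse_with_foci (diagonal_lines 2 A) a b"

definition brianchon_is_point :: "complex^5^5 \<Rightarrow> complex \<Rightarrow> bool" where
  "brianchon_is_point A p \<longleftrightarrow> envelope_is_point (diagonal_lines 3 A) p"

end

theory Submission
  imports Defs "HOL-Computational_Algebra.Fundamental_Theorem_Algebra"
begin

text \<open>Write \<open>b = z \<Phi> / \<Phi>\<^sup>*\<close> for the Blaschke product of degree six whose fibres over the circle are the vertex
sets \<open>P\<^sub>1, \<dots>, P\<^sub>6\<close>. Two properties of \<open>b\<close> decide everything: a decomposition and an involution.
Let \<open>C = X / Y\<close> with \<open>X = z (z - f3) (z - f4)\<close> and \<open>Y\<close> the reversal of \<open>(z - f3) (z - f4)\<close>, and put
\<open>m = f1 f2 f5\<close>. The last two equations of the theorem say exactly that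
\<open>(z - f1) (z - f2) (z - f5) = X - m Y\<close>, hence \<open>b = M \<circ> C\<close> with \<open>M\<close> of degree two. The set equation
says that the involution \<open>\<tau>\<close> of the disk that exchanges \<open>0\<close> and \<open>f5\<close> maps \<open>{f1, f2}\<close> to \<open>{f3, f4}\<close>;
a chord \<open>z w\<close> of the circle passes through \<open>f5\<close> iff \<open>w = \<tau> z\<close>.

From geometry to algebra, consider the pentagram curve and the Brianchon point. The chords from \<open>P\<^sub>j\<close>
to \<open>P\<^sub>j\<^sub>+\<^sub>2\<close> and \<open>P\<^sub>j\<^sub>+\<^sub>4\<close> touch an ellipse with foci \<open>f3, f4\<close>; for fixed \<open>P\<^sub>j\<close> tangency is a quadratic
equation in the other endpoint, and the product of its two roots shows that
\<open>C (P\<^sub>j) = P\<^sub>j P\<^sub>j\<^sub>+\<^sub>2 P\<^sub>j\<^sub>+\<^sub>4\<close> (\<open>circumscribed_triangle_fibre\<close>). So both triangles are fibres of \<open>C\<close>, the vertex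
polynomial factors as \<open>(X - c Y) (X - c' Y)\<close>, and comparing two values of the parameter gives the equations
(\<open>pentagram_imp_equations\<close>). Since \<open>\<tau>\<close> exchanges the two triangles, it carries the zeros of \<open>C\<close> to
those of \<open>X - m Y\<close>, which is the set equation (\<open>forward_foci\<close>).

From algebra to geometry, \<open>b \<circ> \<tau> = b\<close>, so \<open>\<tau>\<close> pairs the vertices by chords through \<open>f5\<close>; each of
these chords separates the remaining vertices into halves that \<open>\<tau>\<close> exchanges, so \<open>\<tau>\<close> pairs \<open>P\<^sub>j\<close> with
\<open>P\<^sub>j\<^sub>+\<^sub>3\<close> (\<open>concurrent_chords_opposite\<close>). The two fibres of \<open>C\<close> that make up a vertex set are exchanged by
\<open>\<tau>\<close>, and each of them surrounds \<open>f3\<close>; hence they interlace (\<open>fibres_interlace\<close>) and the chords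
\<open>P\<^sub>j P\<^sub>j\<^sub>+\<^sub>2\<close> are the chords inside the fibres of \<open>C\<close>, which are the tangents of an ellipse (\<open>pentagram\<close>).

For the numerical range, a chord \<open>z w\<close> joins two points of a common vertex set iff
\<open>z + w - A - z w A\<^sup>*\<close> is singular (\<open>S_class_pencil_iff\<close>), and a kernel vector produces a point of \<open>W(A)\<close>
on the chord. A supporting line of \<open>W(A)\<close> is such a chord and can have no further vertex of the same fibre
beyond it, since a chord to that vertex would have to meet \<open>W(A)\<close> as well. So it joins neighbours. Removing
from \<open>b(z) = b(w)\<close> the factors for \<open>C(z) = C(w)\<close> and \<open>w = \<tau> z\<close> leaves a quadratic condition
(\<open>K_factor\<close>), the tangency condition of a conic with foci \<open>f1, f2\<close>. It is a proper ellipse because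
\<open>W(A)\<close> reaches beyond the segment of the foci, and a compact convex set, as \<open>W(A)\<close> is by the
Toeplitz-Hausdorff theorem, is determined by its supporting lines.\<close>

section \<open>Rank-one matrices\<close>

definition outer :: "complex^'n \<Rightarrow> complex^'n \<Rightarrow> complex^'n^'n" where
  "outer a b = (\<chi> i j. a $ i * b $ j)"

text \<open>The pairing is bilinear: \<open>outer a b\<close> then acts by \<open>x \<mapsto> bdot b x *s a\<close> without conjugations, so that the determinant identities below are purely algebraic.\<close>

definition bdot :: "complex^'n \<Rightarrow> complex^'n \<Rightarrow> complex" where
  "bdot b x = (\<Sum>i\<in>UNIV. b $ i * x $ i)"

lemma bdot_simps [simp]:
  "bdot b (x + y) = bdot b x + bdot b y"
  "bdot b (x - y) = bdot b x - bdot b y"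
  "bdot b (- x) = - bdot b x"
  "bdot b (k *s x) = k * bdot b x"
  by (simp_all add: bdot_def algebra_simps sum.distrib sum_subtractf sum_negf sum_distrib_left)

lemma outer_mult_vec [simp]: "outer a b *v x = bdot b x *s a"
  by (simp add: vec_eq_iff matrix_vector_mult_def outer_def bdot_def sum_distrib_left sum_distrib_right algebra_simps)

lemma matrix_add_rdistrib: "(A + B) ** C = A ** C + B ** (C :: complex^'n^'n)"
  by (simp add: vec_eq_iff matrix_matrix_mult_def sum.distrib algebra_simps)

lemma mult_outer: "M ** outer a b = outer (M *v a) b"
  by (simp add: vec_eq_iff matrix_vector_mult_def matrix_matrix_mult_def outer_def
      sum_distrib_left sum_distrib_right algebra_simps)

lemma mat_mult_vec [simp]: "mat k *v (x :: complex^'n) = k *s x"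
  by (simp add: vec_eq_iff matrix_vector_mult_def mat_def if_distrib if_distribR sum.delta cong: if_cong)

text \<open>The row space is spanned by a single vector \<open>b\<close>; the coefficients of the rows form \<open>a\<close>.\<close>

lemma rank_one_imp_outer:
  fixes M :: "complex^'n^'n"
  assumes "rank M = 1"
  obtains a b where "a \<noteq> 0" "b \<noteq> 0" "M = outer a b"
proof -
  have d: "vec.dim (rows M) = 1"
    using assms by (simp add: row_rank_def_gen row_rank_def)
  obtain B where B: "B \<subseteq> rows M" "vec.independent B" "rows M \<subseteq> vec.span B" "card B = 1"
    using vec.basis_exists[of "rows M"] d by metis
  then obtain b where b: "B = {b}" by (auto simp: card_1_singleton_iff)
  have "b \<noteq> 0" using B(2) b by (metis insertI1 vec.dependent_zero)
  have "\<exists>k. row i M = k *s b" for i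
    using B(3) b by (auto simp: rows_def vec.span_singleton)
  then obtain a where a: "\<And>i. row i M = a i *s b" by metis
  have M: "M = outer (vec_lambda a) b"
    using a by (auto simp: vec_eq_iff outer_def row_def)
  obtain i where "b = row i M" using B(1) b by (auto simp: rows_def)
  then have "a i \<noteq> 0" using a[of i] \<open>b \<noteq> 0\<close> by auto
  then have "vec_lambda a \<noteq> 0" by (auto simp: vec_eq_iff)
  then show thesis using that M \<open>b \<noteq> 0\<close> by blast
qed

text \<open>Expanding the changed row \<open>k\<close> by linearity, all summands but the one along the axis \<open>k\<close> repeat another row.\<close>

lemma det_one_plus_outer_axis:
  fixes c :: "complex^'n"
  shows "det (mat 1 + outer (axis k 1) c) = 1 + c $ k"
proof -
  have "mat 1 + outer (axis k 1) c = (\<chi> i. if i = k then axis k 1 + c else axis i 1)"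
    by (simp add: vec_eq_iff outer_def mat_def axis_def)
  then have "det (mat 1 + outer (axis k 1) c)
     = det (\<chi> i. if i = k then axis k 1 else axis i 1 )
     + det (\<chi> i. if i = k then c else axis i 1)"
    by (simp add: det_row_add)
  also have "(\<chi> i. if i = k then axis k 1 else axis i 1) = (mat 1 :: complex^'n^'n)"
    by (auto simp: vec_eq_iff mat_def axis_def)
  also have "det (\<chi> i. if i = k then c else axis i 1) = c $ k"
  proof -
    have c: "c = (\<Sum>j\<in>UNIV. c $ j *s axis j 1)"
      by (simp add: basis_expansion)
    have "det (\<chi> i. if i = k then c else axis i 1)
        = (\<Sum>j\<in>UNIV. det (\<chi> i. if i = k then c $ j *s axis j 1 else axis i 1))"
      by (subst c) (rule det_linear_row_sum, simp)
    also have "\<dots> = (\<Sum>j\<in>UNIV. if j = k then c $ k else 0)"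
    proof (rule sum.cong[OF refl])
      fix j
      have "det (\<chi> i. if i = k then axis j 1 else axis i 1 )
          = (if j = k then 1 else 0 :: complex)"
      proof (cases "j = k")
        case True
        have "(\<chi> i. if i = k then axis j 1 else axis i 1) = (mat 1 :: complex^'n^'n)"
          using True by (auto simp: vec_eq_iff mat_def axis_def)
        then show ?thesis using True by simp
      next
        case False
        show ?thesis
          by (simp add: False, rule det_identical_rows[of j k]) (use False in \<open>auto simp: row_def vec_eq_iff\<close>)
      qed
      then show "det (\<chi> i. if i = k then c $ j *s axis j 1 else axis i 1)
          = (if j = k then c $ k else 0)"
        by (simp add: det_row_mul)
    qed
    finally show ?thesis by simp
  qed
  finally show ?thesis by simp
qed

text \<open>A conjugation takes \<open>y\<close> to an axis vector, which reduces the general case to the previous lemma.\<close>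

lemma det_one_plus_outer:
  fixes y b :: "complex^'n"
  shows "det (mat 1 + outer y b) = 1 + bdot b y"
proof (cases "y = 0")
  case True
  then have "outer y b = 0" by (simp add: outer_def vec_eq_iff)
  then show ?thesis by (simp add: True bdot_def)
next
  case False
  then obtain k where k: "y $ k \<noteq> 0" by (auto simp: vec_eq_iff)
  define P where "P = mat 1 + outer (y - axis k 1) (axis k (1::complex))"
  define c where "c = b v* P"
  have P: "P *v axis k 1 = y"
    by (simp add: P_def matrix_vector_mult_add_rdistrib bdot_def axis_def if_distrib if_distribR
        cong: if_cong)
  have Pt: "transpose P = mat 1 + outer (axis k 1) (y - axis k 1)"
    by (auto simp: P_def transpose_def outer_def mat_def vec_eq_iff)
  have "det P = y $ k"
    using det_one_plus_outer_axis[of k "y - axis k 1"] Pt det_transpose[of P] by simp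
  have "(mat 1 + outer y b) ** P = P ** (mat 1 + outer (axis k 1) c)"
  proof -
    have "outer y b ** P = outer y c"
      by (simp add: c_def vec_eq_iff vector_matrix_mult_def matrix_matrix_mult_def outer_def
          sum_distrib_left sum_distrib_right algebra_simps)
    then show ?thesis
      by (simp add: matrix_add_ldistrib matrix_add_rdistrib mult_outer P)
  qed
  then have "det (mat 1 + outer y b) * det P = det P * (1 + c $ k)"
    by (metis det_mul det_one_plus_outer_axis)
  moreover have "c $ k = bdot b y"
  proof -
    have "c $ k = bdot b (P *v axis k 1)"
      by (simp add: c_def bdot_def vector_matrix_mult_def matrix_vector_mult_def axis_def
         if_distrib if_distribR cong: if_cong)
    then show ?thesis by (simp add: P)
  qed
  ultimately show ?thesis using k \<open>det P = y $ k\<close> by simp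
qed

lemma det_plus_outer:
  fixes M :: "complex^'n^'n"
  shows "det (M + outer (M *v y) b) = det M * (1 + bdot b y)"
  using det_mul[of M "mat 1 + outer y b"]
  by (simp add: matrix_add_ldistrib mult_outer det_one_plus_outer)

lemma det_eq_0_iff_kernel:
  fixes M :: "complex^'n^'n"
  shows "det M = 0 \<longleftrightarrow> (\<exists>x. x \<noteq> 0 \<and> M *v x = 0)"
  by (metis det_nz_iff_inj invertible_det_nz invertible_left_inverse matrix_left_invertible_ker)

section \<open>A pencil with rank-one defects\<close>

text \<open>For a matrix of the class S, with \<open>B\<close> its adjoint, both defects have rank one. The determinant of the pencil is computed from these relations alone, without inner products.\<close>

locale rank_one_defect =
  fixes A B :: "complex^'n^'n" and a b c d :: "complex^'n"
  assumes BA: "B ** A = mat 1 - outer a b"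
    and AB: "A ** B = mat 1 - outer c d"
    and nz: "a \<noteq> 0" "b \<noteq> 0" "c \<noteq> 0" "d \<noteq> 0"
begin

lemma BAv: "B *v (A *v x) = x - bdot b x *s a"
  by (simp add: matrix_vector_mul_assoc BA matrix_vector_mult_diff_rdistrib)

lemma ABv: "A *v (B *v x) = x - bdot d x *s c"
  by (simp add: matrix_vector_mul_assoc AB matrix_vector_mult_diff_rdistrib)

text \<open>Comparing \<open>A (B A)\<close> with \<open>(A B) A\<close> shows that \<open>A\<close> carries the range of the one defect into that of the other.\<close>

lemma defect_vectors: obtains \<alpha> \<beta> where "A *v a = \<alpha> *s c" "B *v c = \<beta> *s a"
proof -
  have 1: "bdot b x *s (A *v a) = bdot d (A *v x) *s c" for x
  proof -
    have "A *v (B *v (A *v x)) = A *v x - bdot b x *s (A *v a)"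
      by (simp add: BAv matrix_vector_mult_diff_distrib vec.scale)
    then show ?thesis by (simp add: ABv)
  qed
  have 2: "bdot d x *s (B *v c) = bdot b (B *v x) *s a" for x
  proof -
    have "B *v (A *v (B *v x)) = B *v x - bdot d x *s (B *v c)"
      by (simp add: ABv matrix_vector_mult_diff_distrib vec.scale)
    then show ?thesis by (simp add: BAv)
  qed
  have ex: "\<exists>x. bdot y x = 1" if "y \<noteq> 0" for y :: "complex^'n"
  proof -
    obtain k where "y $ k \<noteq> 0" using \<open>y \<noteq> 0\<close> by (auto simp: vec_eq_iff)
    then have "bdot y (axis k (1 / y $ k)) = 1"
      by (simp add: bdot_def axis_def if_distrib cong: if_cong)
    then show ?thesis by blast
  qed
  obtain x where "bdot b x = 1" using ex nz by blast
  then have "A *v a = bdot d (A *v x) *s c" using 1[of x] by simp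
  moreover obtain x' where "bdot d x' = 1" using ex nz by blast
  then have "B *v c = bdot b (B *v x') *s a" using 2[of x'] by simp
  ultimately show thesis using that by blast
qed

text \<open>Write \<open>\<Phi> v = det (v - A)\<close> and \<open>\<Psi> v = det (1 - v B)\<close>. The resolvent vector \<open>x\<^sub>v = (v - A)\<^sup>-\<^sup>1 c\<close> satisfies
\<open>(1 - v B) x\<^sub>v = \<sigma>(v) a\<close> for a scalar \<open>\<sigma>(v)\<close>. Since \<open>z + w - A - z w B = (1 - w B) (z - A) + w a b\<^sup>T\<close> is a
rank-one perturbation of an invertible matrix, it is singular iff \<open>z \<sigma>(w) = w \<sigma>(z)\<close>. Finally \<open>\<sigma>\<close> is a
constant multiple of \<open>\<Psi> / \<Phi>\<close>: the product \<open>(1 - v B) W\<close> with the rank-one change \<open>W = A + t c b\<^sup>T\<close> of \<open>A\<close> is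
in turn a rank-one change of \<open>A - v\<close>. The parameter \<open>t\<close> serves to treat a singular \<open>A\<close> in the same way.\<close>

lemma pencil_singular_iff:
  assumes zw: "z \<noteq> w"
    and reg: "det (mat z - A) \<noteq> 0" "det (mat w - A) \<noteq> 0"
      "det (mat 1 - mat z ** B) \<noteq> 0" "det (mat 1 - mat w ** B) \<noteq> 0"
  shows "det (mat (z + w) - A - mat (z * w) ** B) = 0 \<longleftrightarrow>
    z * det (mat z - A) * det (mat 1 - mat w ** B) = w * det (mat w - A) * det (mat 1 - mat z ** B)"
proof -
  obtain \<alpha> \<beta> where \<alpha>: "A *v a = \<alpha> *s c" and \<beta>: "B *v c = \<beta> *s a"
    using defect_vectors by blast
  have ab: "bdot b a = 1 - \<alpha> * \<beta>"
  proof -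
    obtain k where k: "a $ k \<noteq> 0" using nz(1) by (auto simp: vec_eq_iff)
    have "\<alpha> *s (\<beta> *s a) = a - bdot b a *s a"
      using BAv[of a] unfolding \<alpha> vec.scale \<beta> .
    from arg_cong[OF this, of "\<lambda>x. x $ k"]
    have "(\<alpha> * \<beta>) * a $ k = (1 - bdot b a) * a $ k" by (simp add: left_diff_distrib)
    with k have "\<alpha> * \<beta> = 1 - bdot b a" by (simp only: mult_cancel_right) simp
    then show ?thesis by simp
  qed
  have pen: "(mat 1 - mat v ** B) *v x = x - v *s (B *v x)" for v x
    by (simp add: matrix_vector_mult_diff_rdistrib matrix_vector_mul_assoc[symmetric])
  have res: "(mat v - A) *v x = v *s x - A *v x" for v x
    by (simp add: matrix_vector_mult_diff_rdistrib)
  have surj: "\<exists>x. M *v x = y" if "det M \<noteq> 0" for M :: "complex^'n^'n" and y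
    by (metis invertible_det_nz invertible_right_inverse matrix_vector_mul_assoc matrix_vector_mul_lid that)
  have inj: "x = 0" if "det M \<noteq> 0" "M *v x = 0" for M :: "complex^'n^'n" and x
    using that det_eq_0_iff_kernel by blast
  \<comment> \<open>the resolvent of \<open>A\<close> at \<open>c\<close> and that of \<open>B\<close> at \<open>a\<close> are proportional\<close>
  have key: "\<exists>x. (mat v - A) *v x = c \<and> (mat 1 - mat v ** B) *v x = (bdot b x - \<beta>) *s a
      \<and> bdot b x - \<beta> \<noteq> 0" if v: "det (mat v - A) \<noteq> 0" "det (mat 1 - mat v ** B) \<noteq> 0" for v
  proof -
    obtain x where x: "(mat v - A) *v x = c" using surj v(1) by blast
    then have Ax: "A *v x + c = v *s x" by (simp add: res algebra_simps)
    have "x - bdot b x *s a + \<beta> *s a = v *s (B *v x)"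
      using arg_cong[OF Ax, of "\<lambda>y. B *v y"]
      by (simp add: matrix_vector_right_distrib BAv \<beta> vec.scale)
    then have e: "(mat 1 - mat v ** B) *v x = (bdot b x - \<beta>) *s a"
      unfolding pen by (simp add: vector_sub_rdistrib algebra_simps)
    moreover have "x \<noteq> 0" using x nz by auto
    ultimately have "bdot b x - \<beta> \<noteq> 0" using inj[OF v(2)] by auto
    with x e show ?thesis by blast
  qed
  obtain xz where xz: "(mat z - A) *v xz = c" "(mat 1 - mat z ** B) *v xz = (bdot b xz - \<beta>) *s a"
      "bdot b xz - \<beta> \<noteq> 0" using key reg by blast
  obtain xw where xw: "(mat w - A) *v xw = c" "(mat 1 - mat w ** B) *v xw = (bdot b xw - \<beta>) *s a"
      "bdot b xw - \<beta> \<noteq> 0" using key reg by blast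
  define t :: complex where "t = (if \<alpha> = 0 then 1 else 0)"
  define \<gamma> where "\<gamma> = \<alpha> + t * (1 - \<alpha> * \<beta>)"
  have "\<gamma> \<noteq> 0" by (simp add: \<gamma>_def t_def)
  define W where "W = A + mat t ** outer c b"
  have d: "det (mat 1 - mat v ** B) * det W = - det (A - mat v) * \<gamma> * (bdot b x - \<beta>)"
    if x: "(mat v - A) *v x = c" for v x
  proof -
    define y where "y = - ((1 - t * \<beta>) *s (a + \<alpha> *s x) + t *s x)"
    have My: "(A - mat v) *v y = (1 - t * \<beta>) *s (v *s a) + t *s c"
    proof -
      have Ax: "A *v x = v *s x - c" using x by (simp add: res algebra_simps)
      have Ay: "A *v y = - ((1 - t * \<beta>) *s (\<alpha> *s c + \<alpha> *s (v *s x - c)) + t *s (v *s x - c))"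
        unfolding y_def vec.neg vec.add vec.scale \<alpha> Ax ..
      have "(A - mat v) *v y = A *v y - v *s y" by (simp add: matrix_vector_mult_diff_rdistrib)
      also have "\<dots> = (1 - t * \<beta>) *s (v *s a) + t *s c"
        unfolding Ay unfolding y_def by (simp add: vec_eq_iff algebra_simps)
      finally show ?thesis .
    qed
    have "(mat 1 - mat v ** B) ** W = (A - mat v) + outer ((A - mat v) *v y) b"
    proof (rule matrix_eq[THEN iffD2], rule allI)
      fix x
      have "((mat 1 - mat v ** B) ** W) *v x
          = (A *v x + (t * bdot b x) *s c) - v *s (B *v (A *v x + (t * bdot b x) *s c))"
        by (simp add: matrix_vector_mul_assoc[symmetric] pen W_def matrix_vector_mult_add_rdistrib)
      also have "\<dots> = (A *v x - v *s x) + bdot b x *s ((1 - t * \<beta>) *s (v *s a) + t *s c)"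
        unfolding vec.add vec.scale BAv \<beta> by (simp add: vec_eq_iff algebra_simps)
      also have "\<dots> = ((A - mat v) + outer ((A - mat v) *v y) b) *v x"
        unfolding My by (simp add: matrix_vector_mult_add_rdistrib matrix_vector_mult_diff_rdistrib)
      finally show "((mat 1 - mat v ** B) ** W) *v x
        = ((A - mat v) + outer ((A - mat v) *v y) b) *v x" .
    qed
    then have "det (mat 1 - mat v ** B) * det W = det (A - mat v) * (1 + bdot b y)"
      by (metis det_mul det_plus_outer)
    also have "1 + bdot b y = - \<gamma> * (bdot b x - \<beta>)"
      by (simp add: y_def ab \<gamma>_def algebra_simps)
    finally show ?thesis by (simp add: algebra_simps)
  qed
  define \<epsilon> where "\<epsilon> = det (mat (-1) :: complex^'n^'n)"
  have "\<epsilon> \<noteq> 0"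
    by (auto simp: \<epsilon>_def det_eq_0_iff_kernel vec_eq_iff)
  have neg: "det (A - mat v) = \<epsilon> * det (mat v - A)" for v
  proof -
    have "A - mat v = mat (-1) ** (mat v - A)"
      by (rule matrix_eq[THEN iffD2])
        (simp add: matrix_vector_mul_assoc[symmetric] matrix_vector_mult_diff_rdistrib vec_eq_iff)
    then show ?thesis by (simp add: det_mul \<epsilon>_def)
  qed
  let ?\<Phi> = "\<lambda>v. det (mat v - A)" and ?\<Psi> = "\<lambda>v. det (mat 1 - mat v ** B)"
  let ?sz = "bdot b xz - \<beta>" and ?sw = "bdot b xw - \<beta>"
  have ratio: "?\<Phi> w * ?sw * ?\<Psi> z = ?\<Phi> z * ?sz * ?\<Psi> w"
  proof -
    have "(- (\<epsilon> * \<gamma>)) * (?\<Phi> w * ?sw * ?\<Psi> z) = ?\<Psi> w * det W * ?\<Psi> z"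
      by (simp add: d[OF xw(1)] neg)
    moreover have "(- (\<epsilon> * \<gamma>)) * (?\<Phi> z * ?sz * ?\<Psi> w) = ?\<Psi> z * det W * ?\<Psi> w"
      by (simp add: d[OF xz(1)] neg)
    ultimately have "(- (\<epsilon> * \<gamma>)) * (?\<Phi> w * ?sw * ?\<Psi> z)
      = (- (\<epsilon> * \<gamma>)) * (?\<Phi> z * ?sz * ?\<Psi> w)" by simp
    then show ?thesis using \<open>\<gamma> \<noteq> 0\<close> \<open>\<epsilon> \<noteq> 0\<close> by simp
  qed
  define y where "y = (1 / ((z - w) * ?sw)) *s (xw - xz)"
  have bdy: "1 + w * bdot b y = (z * ?sw - w * ?sz) / ((z - w) * ?sw)"
  proof -
    have "1 + w * ((p - q) / ((z - w) * p)) = (z * p - w * q) / ((z - w) * p)" if "p \<noteq> 0" for p q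
    proof -
      have "(z - w) * p \<noteq> 0" using zw that by simp
      then show ?thesis by (subst eq_divide_eq) (simp add: distrib_right, simp add: algebra_simps)
    qed
    from this[OF xw(3), of ?sz] show ?thesis by (simp add: y_def diff_divide_distrib)
  qed
  have zy: "(mat z - A) *v y = (1 / ?sw) *s xw"
  proof -
    have "(mat z - A) *v (xw - xz) = (z - w) *s xw"
      using xz(1) xw(1) unfolding res by (simp add: matrix_vector_mult_diff_distrib vec_eq_iff algebra_simps)
    moreover have "1 / ((z - w) * ?sw) * (z - w) = 1 / ?sw" using zw by simp
    ultimately show ?thesis by (simp only: y_def vec.scale vector_smult_assoc)
  qed
  have wy: "(mat 1 - mat w ** B) *v ((mat z - A) *v y) = a"
    unfolding zy vec.scale xw(2) vector_smult_assoc using xw(3) by simp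
  have N: "(mat (z + w) - A - mat (z * w) ** B) *v x
     = (mat 1 - mat w ** B) *v ((mat z - A) *v x) + (w * bdot b x) *s a" for x
    by (simp add: pen res matrix_vector_mult_diff_rdistrib matrix_vector_mul_assoc[symmetric]
        matrix_vector_mult_diff_distrib BAv vec.scale vec_eq_iff algebra_simps)
  have Ny: "(mat (z + w) - A - mat (z * w) ** B) *v y = (1 + w * bdot b y) *s a"
    unfolding N wy by (simp add: vec_eq_iff algebra_simps)
  have "y \<noteq> 0" using wy nz by auto
  have "det (mat (z + w) - A - mat (z * w) ** B) = 0 \<longleftrightarrow> 1 + w * bdot b y = 0"
  proof
    assume "1 + w * bdot b y = 0"
    then show "det (mat (z + w) - A - mat (z * w) ** B) = 0"
      using Ny \<open>y \<noteq> 0\<close> det_eq_0_iff_kernel by (metis vector_smult_lzero)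
  next
    assume "det (mat (z + w) - A - mat (z * w) ** B) = 0"
    then obtain x where x: "x \<noteq> 0" "(mat (z + w) - A - mat (z * w) ** B) *v x = 0"
      using det_eq_0_iff_kernel by blast
    let ?u = "x + (w * bdot b x) *s y"
    have "(mat 1 - mat w ** B) *v ((mat z - A) *v ?u) = 0"
      using x(2) wy unfolding N by (simp add: matrix_vector_right_distrib vec.scale)
    then have u: "?u = 0" using inj reg by metis
    have "bdot b x * (1 + w * bdot b y) = bdot b x + (w * bdot b x) * bdot b y"
      by (simp add: algebra_simps)
    also have "\<dots> = 0" using arg_cong[OF u, of "bdot b"] by (simp add: bdot_def[of b 0])
    finally have "bdot b x = 0 \<or> 1 + w * bdot b y = 0" by simp
    moreover have "bdot b x \<noteq> 0" using u x(1) by auto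
    ultimately show "1 + w * bdot b y = 0" by blast
  qed
  also have "\<dots> \<longleftrightarrow> z * ?sw = w * ?sz" using zw xw(3) by (simp add: bdy)
  also have "\<dots> \<longleftrightarrow> z * ?\<Phi> z * ?\<Psi> w = w * ?\<Phi> w * ?\<Psi> z"
  proof -
    have "?\<Phi> w * ?\<Psi> z \<noteq> 0" using reg by simp
    then have "z * ?sw = w * ?sz \<longleftrightarrow> (z * ?sw) * (?\<Phi> w * ?\<Psi> z) = (w * ?sz) * (?\<Phi> w * ?\<Psi> z)"
      by simp
    also have "(z * ?sw) * (?\<Phi> w * ?\<Psi> z) = ?sz * (z * ?\<Phi> z * ?\<Psi> w)"
      using arg_cong[OF ratio, of "(*) z"] by (simp only: mult_ac)
    also have "(w * ?sz) * (?\<Phi> w * ?\<Psi> z) = ?sz * (w * ?\<Phi> w * ?\<Psi> z)"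
      by (simp only: mult_ac)
    finally show ?thesis using xz(3) by (simp only: mult_cancel_left) simp
  qed
  finally show ?thesis .
qed

end

section \<open>The numerical range\<close>

lemma cinner_simps [simp]:
  "cinner (x + y) z = cinner x z + cinner y z"
  "cinner x (y + z) = cinner x y + cinner x z"
  "cinner (x - y) z = cinner x z - cinner y z"
  "cinner x (y - z) = cinner x y - cinner x z"
  "cinner (k *s x) z = cnj k * cinner x z"
  "cinner x (k *s z) = k * cinner x z"
  by (simp_all add: cinner_def algebra_simps sum.distrib sum_subtractf sum_distrib_left)

lemma cinner_zero [simp]: "cinner 0 x = 0" "cinner x 0 = 0"
  by (simp_all add: cinner_def)

lemma cnj_cinner: "cnj (cinner x y) = cinner y x"
  by (simp add: cinner_def algebra_simps)

lemma mult_cnj_self: "z * cnj z = (complex_of_real (norm z))\<^sup>2"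
  using complex_norm_square[of z] by simp

lemma cinner_self: "cinner x x = complex_of_real ((norm x)\<^sup>2)"
proof -
  have "(norm x)\<^sup>2 = (\<Sum>i\<in>UNIV. (norm (x $ i))\<^sup>2)"
    by (simp add: norm_vec_def L2_set_def real_sqrt_pow2 sum_nonneg)
  then show ?thesis by (simp add: cinner_def mult_cnj_self mult.commute[of "cnj _"])
qed

lemma cinner_self_eq_0 [simp]: "cinner x x = 0 \<longleftrightarrow> x = 0"
  by (simp add: cinner_self)

lemma norm_smult [simp]: "norm (k *s x) = norm k * norm (x :: complex^'n)"
proof -
  have "(norm (k *s x))\<^sup>2 = (norm k * norm x)\<^sup>2"
  proof -
    have "complex_of_real ((norm (k *s x))\<^sup>2) = (k * cnj k) * cinner x x"
      unfolding cinner_self[symmetric] by simp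
    also have "\<dots> = complex_of_real ((norm k * norm x)\<^sup>2)"
      by (simp add: mult_cnj_self cinner_self power_mult_distrib)
    finally show ?thesis by (simp only: of_real_eq_iff)
  qed
  then show ?thesis by (simp add: power2_eq_iff_nonneg)
qed

lemma cinner_Cauchy_Schwarz: "norm (cinner x y) \<le> norm x * norm y"
proof (cases "x = 0")
  case False
  define k where "k = cinner x y / cinner x x"
  have "0 \<le> Re (cinner (y - k *s x) (y - k *s x))" by (simp add: cinner_self)
  also have "cinner (y - k *s x) (y - k *s x) = cinner y y - cnj k * cinner x y"
    using False by (simp add: k_def field_simps cnj_cinner)
  also have "cnj k * cinner x y = (norm (cinner x y))\<^sup>2 / (norm x)\<^sup>2"
    by (simp add: k_def cinner_self mult_cnj_self mult.commute[of "cnj _"])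
  finally have "(norm (cinner x y))\<^sup>2 / (norm x)\<^sup>2 \<le> (norm y)\<^sup>2"
    by (simp add: cinner_self flip: of_real_power of_real_divide)
  then have "(norm (cinner x y))\<^sup>2 \<le> (norm x * norm y)\<^sup>2"
    using False by (simp add: divide_simps power_mult_distrib mult.commute)
  then show ?thesis by (simp add: power2_le_iff_abs_le)
qed simp

lemma cinner_conj_transpose: "cinner (conj_transpose A *v x) y = cinner x (A *v y)"
  by (simp add: cinner_def conj_transpose_def matrix_vector_mult_def sum_distrib_left sum_distrib_right)
    (subst sum.swap, simp add: algebra_simps)

lemma continuous_on_cinner [continuous_intros]:
  "continuous_on S f \<Longrightarrow> continuous_on S g \<Longrightarrow> continuous_on S (\<lambda>t. cinner (f t) (g t))"
  unfolding cinner_def by (intro continuous_intros)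

lemma continuous_on_matrix_vector_mult [continuous_intros]:
  fixes A :: "complex^'n^'m"
  shows "continuous_on S f \<Longrightarrow> continuous_on S (\<lambda>t. A *v f t)"
  unfolding matrix_vector_mult_def by (intro continuous_intros)

lemma compact_numerical_range: "compact (numerical_range A)"
proof -
  have "numerical_range A = (\<lambda>x. cinner x (A *v x)) ` sphere 0 1"
    by (auto simp: numerical_range_def)
  moreover have "continuous_on (sphere 0 1) (\<lambda>x. cinner x (A *v x))"
    by (intro continuous_intros)
  ultimately show ?thesis by (metis compact_continuous_image compact_sphere)
qed

text \<open>The Toeplitz-Hausdorff theorem. After an affine change of \<open>A\<close> the two given values are \<open>0\<close> and \<open>1\<close>,
taken at \<open>x\<close> and \<open>y\<close>. Multiplying \<open>y\<close> by a unimodular number makes the form real on the segment from \<open>x\<close>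
to \<open>y\<close>, and the intermediate value theorem applies to its normalized values.\<close>

lemma convex_numerical_range: "convex (numerical_range A)"
proof (rule convexI)
  fix p q :: complex and r s :: real
  assume p: "p \<in> numerical_range A" and q: "q \<in> numerical_range A"
    and rs: "0 \<le> r" "0 \<le> s" "r + s = 1"
  obtain x where x: "norm x = 1" "cinner x (A *v x) = p" using p by (auto simp: numerical_range_def)
  obtain y where y: "norm y = 1" "cinner y (A *v y) = q" using q by (auto simp: numerical_range_def)
  show "r *\<^sub>R p + s *\<^sub>R q \<in> numerical_range A"
  proof (cases "p = q")
    case True
    then show ?thesis using p rs by (simp flip: scaleR_add_left)
  next
    case False
    define F where "F u v = (cinner u (A *v v) - p * cinner u v) / (q - p)" for u v
    have F_simps: "F (u + u') v = F u v + F u' v" "F u (v + v') = F u v + F u v'"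
      "F (k *s u) v = cnj k * F u v" "F u (k *s v) = k * F u v" for u u' v v' k
      by (simp_all add: F_def matrix_vector_right_distrib vec.scale field_simps add_divide_distrib diff_divide_distrib)
    have Fx: "F x x = 0" by (simp add: F_def x cinner_self)
    have Fy: "F y y = 1" using False by (simp add: F_def y cinner_self)
    obtain k where k: "norm k = 1" "k * F x y + cnj k * F y x \<in> \<real>"
    proof -
      \<comment> \<open>the imaginary part of \<open>k * F x y + cnj k * F y x\<close> is that of \<open>k * \<mu>\<close>\<close>
      define \<mu> where "\<mu> = F x y - cnj (F y x)"
      define k where "k = (if \<mu> = 0 then 1 else cnj \<mu> / norm \<mu>)"
      have 1: "norm k = 1" by (simp add: k_def norm_divide)
      have "k * \<mu> = norm \<mu>"
        using complex_norm_square[of \<mu>] by (auto simp: k_def field_simps power2_eq_square)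
      then have "Im (k * \<mu>) = 0" by simp
      then have "Im (k * F x y + cnj k * F y x) = 0" by (simp add: \<mu>_def algebra_simps)
      then show thesis using that 1 by (metis complex_is_Real_iff)
    qed
    define v where "v t = (1 - t) *\<^sub>R x + t *\<^sub>R (k *s y)" for t :: real
    have v': "v t = complex_of_real (1 - t) *s x + complex_of_real t *s (k *s y)" for t
      unfolding v_def vec_eq_iff vector_add_component vector_scaleR_component vector_smult_component
      by (simp add: scaleR_conv_of_real)
    have Fv: "F (v t) (v t) = complex_of_real (t\<^sup>2 + t * (1 - t) * Re (k * F x y + cnj k * F y x))" for t
    proof -
      have "F (v t) (v t) = t\<^sup>2 * (cnj k * k) + t * (1 - t) * (k * F x y + cnj k * F y x)"
        unfolding v' F_simps Fx Fy by (simp add: power2_eq_square algebra_simps)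
      also have "k * F x y + cnj k * F y x = complex_of_real (Re (k * F x y + cnj k * F y x))"
        using k(2) by (simp add: complex_is_Real_iff complex_eq_iff)
      also have "cnj k * k = 1" using k(1) complex_norm_square[of k] by (simp add: mult.commute)
      finally show ?thesis by simp
    qed
    have vnz: "v t \<noteq> 0" for t
    proof
      assume v0: "v t = 0"
      then have e: "complex_of_real (1 - t) *s x = (- complex_of_real t * k) *s y"
        by (simp add: v' vec_eq_iff eq_neg_iff_add_eq_0 mult.assoc)
      have "norm (complex_of_real (1 - t) *s x) = norm ((- complex_of_real t * k) *s y)" by (simp only: e)
      then have "\<bar>1 - t\<bar> = \<bar>t\<bar>" by (simp only: norm_smult norm_mult norm_minus_cancel norm_of_real x y k mult_1_right)
      then have "t = 1 / 2" by linarith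
      have "(1 - t)\<^sup>2 * F x x = t\<^sup>2 * (cnj k * k) * F y y"
        using arg_cong2[OF e e, of F] unfolding F_simps by (simp add: power2_eq_square algebra_simps)
      then show False using \<open>t = 1/2\<close> k by (auto simp: Fx Fy)
    qed
    define g where "g t = Re (F (v t) (v t)) / (norm (v t))\<^sup>2" for t
    have g0: "g 0 = 0" unfolding g_def Fv by simp
    have g1: "g 1 = 1" using y k unfolding g_def Fv by (simp add: v_def)
    have "continuous_on {0..1} g"
      unfolding g_def Fv unfolding v_def using vnz[unfolded v_def]
      by (intro continuous_intros) auto
    then obtain t where t: "g t = s" using IVT'[of g 0 s 1] g0 g1 rs by auto
    define u where "u = complex_of_real (1 / norm (v t)) *s v t"
    have u: "norm u = 1" using vnz by (simp add: u_def norm_divide)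
    have "F u u = complex_of_real (g t)"
      unfolding u_def F_simps g_def Fv by (simp add: power2_eq_square)
    then have "cinner u (A *v u) = p + s * (q - p)"
      using False u t by (simp add: F_def cinner_self field_simps)
    also have "\<dots> = r *\<^sub>R p + s *\<^sub>R q"
    proof -
      have r: "r = 1 - s" using rs by simp
      show ?thesis unfolding r by (simp add: scaleR_conv_of_real algebra_simps)
    qed
    finally show ?thesis using u unfolding numerical_range_def by (intro CollectI exI[of _ u]) simp
  qed
qed

text \<open>With \<open>s = 2 h k\<close> and \<open>p = k\<^sup>2\<close> for unimodular \<open>k\<close> this is \<open>2 k\<close> times \<open>h\<close> minus the Hermitian part of \<open>k\<^sup>-\<^sup>1 A\<close>;
with \<open>s = z + w\<close> and \<open>p = z w\<close> it belongs to the chord \<open>z w\<close> of the unit circle.\<close>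

abbreviation pencil :: "complex^'n^'n \<Rightarrow> complex \<Rightarrow> complex \<Rightarrow> complex^'n^'n" where
  "pencil A s p \<equiv> mat s - A - mat p ** conj_transpose A"

text \<open>The largest value \<open>h\<close> of the quadratic form of the Hermitian part of \<open>cnj \<zeta> A\<close> is attained by compactness.
There the nonnegative form of \<open>N = 2 h - cnj \<zeta> A - \<zeta> A\<^sup>*\<close> vanishes, and a zero of a nonnegative Hermitian
form lies in the kernel.\<close>

lemma numerical_range_support_kernel:
  fixes A :: "complex^'n^'n"
  assumes \<zeta>: "norm \<zeta> = 1"
  obtains h x where "norm x = 1" "Re (cnj \<zeta> * cinner x (A *v x)) = h"
    "\<And>u. u \<in> numerical_range A \<Longrightarrow> Re (cnj \<zeta> * u) \<le> h"
    "(pencil A (2 * complex_of_real h * \<zeta>) (\<zeta>\<^sup>2)) *v x = 0"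
proof -
  have "continuous_on (numerical_range A) (\<lambda>u. Re (cnj \<zeta> * u))" by (intro continuous_intros)
  moreover have "numerical_range A \<noteq> {}"
  proof -
    have "norm (axis undefined 1 :: complex^'n) = 1" by simp
    then show ?thesis unfolding numerical_range_def by blast
  qed
  ultimately obtain m where m: "m \<in> numerical_range A"
      "\<And>u. u \<in> numerical_range A \<Longrightarrow> Re (cnj \<zeta> * u) \<le> Re (cnj \<zeta> * m)"
    using continuous_attains_sup[OF compact_numerical_range] by metis
  define h where "h = Re (cnj \<zeta> * m)"
  obtain x where x: "norm x = 1" "cinner x (A *v x) = m" using m(1) by (auto simp: numerical_range_def)
  define N where "N = mat (2 * complex_of_real h) - mat (cnj \<zeta>) ** A - mat \<zeta> ** conj_transpose A"
  have Nv: "N *v y = (2 * complex_of_real h) *s y - cnj \<zeta> *s (A *v y) - \<zeta> *s (conj_transpose A *v y)" for y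
    by (simp add: N_def matrix_vector_mult_diff_rdistrib matrix_vector_mul_assoc[symmetric])
  have cN: "cinner y (N *v z) = (2 * complex_of_real h) * cinner y z - cnj \<zeta> * cinner y (A *v z) - \<zeta> * cnj (cinner z (A *v y))"
    for y z
    unfolding Nv cinner_simps by (metis cinner_conj_transpose cnj_cinner)
  have herm: "cinner (N *v y) z = cinner y (N *v z)" for y z
    by (subst cnj_cinner[symmetric]) (simp add: cN cnj_cinner)
  have Nself: "Re (cinner y (N *v y)) = 2 * (h * (norm y)\<^sup>2 - Re (cnj \<zeta> * cinner y (A *v y)))" for y
    by (simp add: cN cinner_self algebra_simps)
  have pos: "0 \<le> Re (cinner y (N *v y))" for y
  proof (cases "y = 0")
    case False
    define e where "e = complex_of_real (1 / norm y) *s y"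
    have "norm e = 1" using False by (simp add: e_def norm_divide)
    then have "Re (cnj \<zeta> * cinner e (A *v e)) \<le> h" using m(2) by (auto simp: numerical_range_def h_def)
    moreover have "cinner e (A *v e) = cinner y (A *v y) / (norm y)\<^sup>2"
      by (simp add: e_def vec.scale power2_eq_square)
    ultimately have "Re (cnj \<zeta> * cinner y (A *v y)) / (norm y)\<^sup>2 \<le> h"
      by (metis Re_divide_of_real times_divide_eq_right)
    then show ?thesis using False by (simp add: Nself divide_simps mult.commute)
  qed simp
  have x0: "Re (cinner x (N *v x)) = 0" by (simp add: Nself x h_def)
  have "N *v x = 0"
  proof (rule ccontr)
    assume nz: "N *v x \<noteq> 0"
    define y where "y = N *v x"
    define Q where "Q = Re (cinner y (N *v y))"
    have Y: "(norm y)\<^sup>2 > 0" using nz by (simp add: y_def)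
    have "0 \<le> - 2 * t * (norm y)\<^sup>2 + t\<^sup>2 * Q" for t :: real
    proof -
      have "0 \<le> Re (cinner (x - complex_of_real t *s y) (N *v (x - complex_of_real t *s y)))" by (rule pos)
      also have "cinner (x - complex_of_real t *s y) (N *v (x - complex_of_real t *s y))
        = cinner x (N *v x) - 2 * t * cinner y y + t\<^sup>2 * cinner y (N *v y)"
        using herm[of x y]
        by (simp add: matrix_vector_mult_diff_distrib vec.scale y_def[symmetric] power2_eq_square algebra_simps)
      finally show ?thesis by (simp add: x0 cinner_self Q_def)
    qed
    note ineq = this
    show False
    proof (cases "Q \<le> 0")
      case True
      then show False using ineq[of 1] Y by simp
    next
      case False
      define n where "n = (norm y)\<^sup>2"
      have "0 \<le> - 2 * (n / Q) * n + (n / Q)\<^sup>2 * Q" using ineq[of "n / Q"] by (simp add: n_def)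
      also have "\<dots> = - (n * n / Q)" using False by (simp add: power2_eq_square field_simps)
      finally have "n * n / Q \<le> 0" by simp
      moreover have "0 < n * n / Q" using Y False by (simp add: n_def)
      ultimately show False by simp
    qed
  qed
  then have "\<zeta> *s (N *v x) = 0" by simp
  moreover have "\<zeta> * cnj \<zeta> = 1" using \<zeta> complex_norm_square[of \<zeta>] by simp
  then have "\<zeta> *s (N *v x) = (pencil A (2 * complex_of_real h * \<zeta>) (\<zeta>\<^sup>2)) *v x"
    by (simp add: Nv matrix_vector_mult_diff_rdistrib matrix_vector_mul_assoc[symmetric] vec_eq_iff
         power2_eq_square right_diff_distrib mult.assoc[symmetric]) 
  ultimately have "(pencil A (2 * complex_of_real h * \<zeta>) (\<zeta>\<^sup>2)) *v x = 0" by simp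
  then show thesis using that[of x h] m(2) x h_def by simp
qed

section \<open>Chords of the unit circle\<close>

lemma unit_cnj: "norm (z :: complex) = 1 \<Longrightarrow> cnj z = 1 / z"
  by (metis complex_norm_square inverse_eq_divide inverse_unique of_real_1 one_power2)

lemma complex_sqrt_unit: assumes "norm (p :: complex) = 1" obtains k where "norm k = 1" "k * k = p"
proof -
  have "norm (csqrt p) = 1" using assms by simp
  moreover have "csqrt p * csqrt p = p" by (metis power2_csqrt power2_eq_square)
  ultimately show thesis using that by blast
qed

text \<open>On the circle \<open>cnj z = 1 / z\<close>, so the line through \<open>z\<close> and \<open>w\<close> depends polynomially on \<open>z + w\<close> and \<open>z w\<close>.\<close>

lemma affine_hull_unit_chord:
  assumes "norm z = 1" "norm w = 1" "z \<noteq> w"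
  shows "affine hull {z, w} = {u. u + z * w * cnj u = z + w}"
proof -
  have zw0: "z \<noteq> 0" "w \<noteq> 0" using assms by auto
  have mem: "(1 - t) *\<^sub>R z + t *\<^sub>R w + z * w * cnj ((1 - t) *\<^sub>R z + t *\<^sub>R w) = z + w" for t
    using zw0 by (simp add: unit_cnj[OF assms(1)] unit_cnj[OF assms(2)] scaleR_conv_of_real field_simps)
  have "\<exists>t. u = (1 - t) *\<^sub>R z + t *\<^sub>R w" if u: "u + z * w * cnj u = z + w" for u
  proof -
    define q where "q = (u - z) / (w - z)"
    have "cnj u = (z + w - u) / (z * w)" using u zw0 by (simp add: field_simps)
    then have "cnj q = ((z + w - u) / (z * w) - 1 / z) / (1 / w - 1 / z)"
      by (simp add: q_def unit_cnj[OF assms(1)] unit_cnj[OF assms(2)])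
    also have "\<dots> = q"
    proof -
      have "(z + w - u) / (z * w) - 1 / z = (z - u) / (z * w)" "1 / w - 1 / z = (z - w) / (z * w)"
        using zw0 by (simp_all add: field_simps)
      then have "((z + w - u) / (z * w) - 1 / z) / (1 / w - 1 / z) = (z - u) / (z - w)"
        using zw0 by simp
      then show ?thesis unfolding q_def by (metis minus_diff_eq minus_divide_divide)
    qed
    finally have "q \<in> \<real>" by (simp add: Reals_cnj_iff)
    then obtain t where "q = complex_of_real t" by (auto elim: Reals_cases)
    then have "u = (1 - t) *\<^sub>R z + t *\<^sub>R w"
      using assms(3) by (simp add: q_def scaleR_conv_of_real field_simps)
    then show ?thesis by blast
  qed
  moreover have "affine hull {z, w} = {(1 - t) *\<^sub>R z + t *\<^sub>R w | t. True}"
  proof -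
    have "(\<lambda>t. z + t *\<^sub>R (w - z)) = (\<lambda>t. (1 - t) *\<^sub>R z + t *\<^sub>R w)"
      by (simp add: fun_eq_iff algebra_simps)
    moreover have "{(1 - t) *\<^sub>R z + t *\<^sub>R w | t. True} = range (\<lambda>t. (1 - t) *\<^sub>R z + t *\<^sub>R w)"
      by auto
    ultimately show ?thesis unfolding affine_hull_2_alt by (simp only:)
  qed
  ultimately show ?thesis using mem by auto
qed

text \<open>The squared distance from the origin is a quadratic function along the line and is smaller than one at \<open>u\<close>.\<close>

lemma affine_hull_eq_unit_chord:
  fixes p q u :: complex
  assumes "p \<noteq> q" "u \<in> affine hull {p, q}" "norm u < 1"
  obtains z w where "norm z = 1" "norm w = 1" "z \<noteq> w" "affine hull {p, q} = affine hull {z, w}"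
proof -
  have hull: "affine hull {x, y} = range (\<lambda>t. x + t *\<^sub>R (y - x))" for x y :: complex
    by (rule affine_hull_2_alt)
  define e where "e = (q - p) / norm (q - p)"
  have e: "norm e = 1" using assms(1) by (simp add: e_def norm_divide)
  obtain t0 where t0: "u = p + t0 *\<^sub>R (q - p)" using assms(2) hull by auto
  define \<beta> where "\<beta> = Re (cnj e * u)"
  define \<Delta> where "\<Delta> = sqrt (\<beta>\<^sup>2 + 1 - (norm u)\<^sup>2)"
  have n2: "(norm u)\<^sup>2 < 1" using assms(3) by (simp add: abs_square_less_1)
  then have pos: "\<beta>\<^sup>2 + 1 - (norm u)\<^sup>2 > 0" by (smt (verit) zero_le_power2)
  have \<Delta>: "\<Delta> > 0" "\<Delta>\<^sup>2 = \<beta>\<^sup>2 + 1 - (norm u)\<^sup>2" using pos by (simp_all add: \<Delta>_def)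
  have nrm: "(norm (u + t *\<^sub>R e))\<^sup>2 = (norm u)\<^sup>2 + 2 * t * \<beta> + t\<^sup>2" for t
  proof -
    have "(Re e)\<^sup>2 + (Im e)\<^sup>2 = 1" using e by (simp add: cmod_def)
    then have "t\<^sup>2 * ((Re e)\<^sup>2 + (Im e)\<^sup>2) = t\<^sup>2" by simp
    then show ?thesis
      unfolding cmod_power2 \<beta>_def by (simp add: power2_eq_square algebra_simps)
  qed
  have one: "norm (u + t *\<^sub>R e) = 1" if "(t + \<beta>)\<^sup>2 = \<Delta>\<^sup>2" for t
  proof -
    have "(norm (u + t *\<^sub>R e))\<^sup>2 = 1"
      unfolding nrm using that \<Delta>(2) by (simp add: power2_eq_square algebra_simps)
    then show ?thesis by (simp add: power2_eq_1_iff) (smt (verit) norm_ge_zero)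
  qed
  define z where "z = u + (- \<beta> - \<Delta>) *\<^sub>R e"
  define w where "w = u + (- \<beta> + \<Delta>) *\<^sub>R e"
  have z: "norm z = 1" unfolding z_def by (rule one) simp
  have w: "norm w = 1" unfolding w_def by (rule one) simp
  have ez: "e \<noteq> 0" using e by auto
  have wz: "w - z = (2 * \<Delta>) *\<^sub>R e" by (simp add: z_def w_def scaleR_conv_of_real algebra_simps)
  have zw: "z \<noteq> w" using wz \<Delta>(1) ez by auto
  have qp: "q - p = norm (q - p) *\<^sub>R e" using assms(1) by (simp add: e_def scaleR_conv_of_real)
  have line: "range (\<lambda>t. x + t *\<^sub>R (k *\<^sub>R e)) = range (\<lambda>t. u + t *\<^sub>R e)" if "k \<noteq> 0" "x = u + l *\<^sub>R e" for x k l
  proof (intro equalityI subsetI)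
    fix y assume "y \<in> range (\<lambda>t. x + t *\<^sub>R (k *\<^sub>R e))"
    then obtain t where "y = x + t *\<^sub>R (k *\<^sub>R e)" by blast
    then have "y = u + (l + t * k) *\<^sub>R e" using that by (simp add: algebra_simps)
    then show "y \<in> range (\<lambda>t. u + t *\<^sub>R e)" by blast
  next
    fix y assume "y \<in> range (\<lambda>t. u + t *\<^sub>R e)"
    then obtain t where "y = u + t *\<^sub>R e" by blast
    moreover have "((t - l) / k) *\<^sub>R (k *\<^sub>R e) = (t - l) *\<^sub>R e" using that by simp
    ultimately have "y = x + ((t - l) / k) *\<^sub>R (k *\<^sub>R e)"
      using that by (simp only: scaleR_left_diff_distrib) simp
    then show "y \<in> range (\<lambda>t. x + t *\<^sub>R (k *\<^sub>R e))" by blast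
  qed
  have "p = u + (- t0 * norm (q - p)) *\<^sub>R e" unfolding t0 using qp by (metis (no_types, opaque_lifting) add_diff_cancel_right' diff_add_cancel minus_mult_left scaleR_minus_left scaleR_scaleR uminus_add_conv_diff add.commute)
  then have "affine hull {p, q} = range (\<lambda>t. u + t *\<^sub>R e)"
    using line[of "norm (q - p)" p "- t0 * norm (q - p)"] assms(1)
    unfolding hull qp[symmetric] by simp
  moreover have "affine hull {z, w} = range (\<lambda>t. u + t *\<^sub>R e)"
    unfolding hull wz using \<Delta>(1) by (intro line[where l = "- \<beta> - \<Delta>"]) (auto simp: z_def)
  ultimately show thesis using that z w zw by simp
qed

section \<open>Tangents of an ellipse\<close>

lemma quadratic_ex1_iff:
  fixes A B C :: real assumes "A \<noteq> 0"
  shows "(\<exists>!t. A * t\<^sup>2 + B * t + C = 0) \<longleftrightarrow> B\<^sup>2 = 4 * A * C"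
proof -
  have sq: "A * t\<^sup>2 + B * t + C = 0 \<longleftrightarrow> (2 * A * t + B)\<^sup>2 = B\<^sup>2 - 4 * A * C" for t
  proof -
    have "(2 * A * t + B)\<^sup>2 - (B\<^sup>2 - 4 * A * C) = 4 * A * (A * t\<^sup>2 + B * t + C)"
      by (simp add: power2_eq_square algebra_simps)
    then show ?thesis using assms by (metis eq_iff_diff_eq_0 mult_eq_0_iff zero_neq_numeral)
  qed
  show ?thesis
  proof
    assume ex: "\<exists>!t. A * t\<^sup>2 + B * t + C = 0"
    then obtain t where t: "(2 * A * t + B)\<^sup>2 = B\<^sup>2 - 4 * A * C" unfolding sq by blast
    define t' where "t' = - t - B / A"
    have "2 * A * t' + B = - (2 * A * t + B)" using assms by (simp add: t'_def field_simps)
    then have "(2 * A * t' + B)\<^sup>2 = B\<^sup>2 - 4 * A * C" using t by (simp only: power2_minus)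
    then have "t' = t" using ex t unfolding sq by blast
    then have "2 * A * t + B = 0" using assms by (simp add: t'_def field_simps)
    then show "B\<^sup>2 = 4 * A * C" using t by simp
  next
    assume "B\<^sup>2 = 4 * A * C"
    then show "\<exists>!t. A * t\<^sup>2 + B * t + C = 0"
      unfolding sq using assms by (intro ex1I[of _ "- B / (2 * A)"]) (auto simp: field_simps)
  qed
qed

text \<open>With \<open>x, y\<close> for the two focal distances, the sides of the second equation differ by
\<open>(x + y - r) (x + y + r) (r + x - y) (r + y - x)\<close>, and by the triangle inequality only the first factor can vanish. The
second equation is quadratic in the coordinates of \<open>u\<close>.\<close>

lemma focal_sum_eq_iff:
  fixes a b u :: "'a :: real_inner" and r :: real
  assumes "dist a b < r"
  shows "dist u a + dist u b = r \<longleftrightarrow> 4 * r\<^sup>2 * (dist u a)\<^sup>2 = (r\<^sup>2 + (dist u a)\<^sup>2 - (dist u b)\<^sup>2)\<^sup>2"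
proof -
  define x y where "x = dist u a" and "y = dist u b"
  have r: "r > 0" using assms by (smt (verit) zero_le_dist)
  have xy: "0 \<le> x" "0 \<le> y" by (simp_all add: x_def y_def)
  have tri: "x - y < r" "y - x < r"
    using assms dist_triangle[of u a b] dist_triangle[of u b a] by (simp_all add: x_def y_def dist_commute)
  have "4 * r\<^sup>2 * x\<^sup>2 - (r\<^sup>2 + x\<^sup>2 - y\<^sup>2)\<^sup>2 = (x + y - r) * (x + y + r) * ((r + x - y) * (r + y - x))"
    by (simp add: power2_eq_square algebra_simps)
  moreover have "x + y + r > 0" "r + x - y > 0" "r + y - x > 0" using r xy tri by linarith+
  ultimately have "4 * r\<^sup>2 * x\<^sup>2 = (r\<^sup>2 + x\<^sup>2 - y\<^sup>2)\<^sup>2 \<longleftrightarrow> x + y - r = 0"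
    by (metis eq_iff_diff_eq_0 less_irrefl mult_eq_0_iff)
  then show ?thesis by (simp add: x_def y_def)
qed

text \<open>The points of the ellipse on the line are the zeros of a real quadratic polynomial. Its discriminant is, up to
a positive factor, \<open>r\<^sup>2 - (dist a b)\<^sup>2\<close> minus four times the product of the signed distances of the foci from the line:
the classical fact that this product is constant along the tangents.\<close>

lemma tangent_vertical_line:
  fixes a b :: complex and h r :: real
  assumes r: "dist a b < r"
  shows "(\<exists>!t. dist (Complex h t) a + dist (Complex h t) b = r)
     \<longleftrightarrow> 4 * (h - Re a) * (h - Re b) = r\<^sup>2 - (dist a b)\<^sup>2"
proof -
  define p q x y where "p = h - Re a" and "q = h - Re b" and "x = Im a" and "y = Im b"
  have da: "(dist (Complex h t) a)\<^sup>2 = p\<^sup>2 + (t - x)\<^sup>2" for t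
    by (simp add: dist_norm cmod_power2 p_def x_def)
  have db: "(dist (Complex h t) b)\<^sup>2 = q\<^sup>2 + (t - y)\<^sup>2" for t
    by (simp add: dist_norm cmod_power2 q_def y_def)
  have dab: "(dist a b)\<^sup>2 = (p - q)\<^sup>2 + (x - y)\<^sup>2"
    by (simp add: dist_norm cmod_power2 p_def q_def x_def y_def) (simp add: power2_eq_square algebra_simps)
  have r0: "r > 0" using r by (smt (verit) zero_le_dist)
  have lt: "(p - q)\<^sup>2 + (x - y)\<^sup>2 < r\<^sup>2"
    using r dab by (metis power_strict_mono zero_le_dist zero_less_numeral)
  define A B C where "A = 4 * r\<^sup>2 - 4 * (x - y)\<^sup>2"
    and "B = - 8 * r\<^sup>2 * x + 4 * (r\<^sup>2 + p\<^sup>2 + x\<^sup>2 - q\<^sup>2 - y\<^sup>2) * (x - y)"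
    and "C = 4 * r\<^sup>2 * (p\<^sup>2 + x\<^sup>2) - (r\<^sup>2 + p\<^sup>2 + x\<^sup>2 - q\<^sup>2 - y\<^sup>2)\<^sup>2"
  have A: "A > 0" using lt by (simp add: A_def) (smt (verit) zero_le_power2)
  have quad: "dist (Complex h t) a + dist (Complex h t) b = r \<longleftrightarrow> A * t\<^sup>2 + B * t + C = 0" for t
  proof -
    have "4 * r\<^sup>2 * (p\<^sup>2 + (t - x)\<^sup>2) - (r\<^sup>2 + (p\<^sup>2 + (t - x)\<^sup>2) - (q\<^sup>2 + (t - y)\<^sup>2))\<^sup>2
       = A * t\<^sup>2 + B * t + C"
      unfolding A_def B_def C_def by (simp add: power2_eq_square algebra_simps)
    then show ?thesis unfolding focal_sum_eq_iff[OF r] da db by linarith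
  qed
  have disc: "B\<^sup>2 - 4 * A * C = 16 * r\<^sup>2 * ((r\<^sup>2 - (x - y)\<^sup>2 - (p - q)\<^sup>2) * (r\<^sup>2 - (x - y)\<^sup>2 - (p + q)\<^sup>2))"
    unfolding A_def B_def C_def by (simp add: power2_eq_square algebra_simps)
  have "(\<exists>!t. dist (Complex h t) a + dist (Complex h t) b = r) \<longleftrightarrow> B\<^sup>2 = 4 * A * C"
    unfolding quad using quadratic_ex1_iff[of A B C] A by simp
  also have "\<dots> \<longleftrightarrow> B\<^sup>2 - 4 * A * C = 0" by simp
  also have "\<dots> \<longleftrightarrow> r\<^sup>2 - (x - y)\<^sup>2 - (p + q)\<^sup>2 = 0" unfolding disc using r0 lt by simp
  also have "\<dots> \<longleftrightarrow> 4 * p * q = r\<^sup>2 - (dist a b)\<^sup>2"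
    unfolding dab by (auto simp: power2_eq_square algebra_simps)
  finally show ?thesis by (simp add: p_def q_def)
qed

text \<open>The right-hand side is \<open>2 k\<close> times the signed distance of \<open>a\<close> from the line with normal direction \<open>k\<close> at
distance \<open>h\<close> from the origin.\<close>

lemma pencil_at_point:
  assumes "norm (k :: complex) = 1"
  shows "2 * complex_of_real h * k - a - k\<^sup>2 * cnj a = 2 * complex_of_real (h - Re (cnj k * a)) * k"
proof -
  define c where "c = Re (cnj k * a)"
  have "k * (cnj k * a + cnj (cnj k * a)) = a * (k * cnj k) + k\<^sup>2 * cnj a"
    by (simp add: power2_eq_square algebra_simps)
  moreover have "k * cnj k = 1" using assms complex_norm_square[of k] by simp
  moreover have "cnj k * a + cnj (cnj k * a) = 2 * complex_of_real c"
    unfolding c_def by (subst complex_add_cnj) simp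
  ultimately have "k * (2 * complex_of_real c) = a + k\<^sup>2 * cnj a" by simp
  then show ?thesis unfolding c_def[symmetric] by (simp add: algebra_simps)
qed

lemma rotated_line_iff:
  assumes "norm (k :: complex) = 1"
  shows "u + k\<^sup>2 * cnj u = 2 * complex_of_real h * k \<longleftrightarrow> Re (cnj k * u) = h"
proof -
  have "u + k\<^sup>2 * cnj u = 2 * complex_of_real h * k
      \<longleftrightarrow> 2 * complex_of_real h * k - u - k\<^sup>2 * cnj u = 0" by (auto simp: algebra_simps)
  also have "\<dots> \<longleftrightarrow> h - Re (cnj k * u) = 0"
    unfolding pencil_at_point[OF assms] using assms by (simp only: mult_eq_0_iff of_real_eq_0_iff) auto
  finally show ?thesis by auto
qed

text \<open>The direction \<open>k\<close> is normal to the chord, a square root of \<open>z w\<close>; then \<open>(z + w) / k\<close> equals its conjugate.\<close>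

lemma unit_chord_frame:
  assumes "norm z = 1" "norm w = 1"
  obtains k h where "norm k = 1" "z * w = k\<^sup>2" "z + w = 2 * complex_of_real h * k"
proof -
  obtain k where k: "norm k = 1" "k * k = z * w"
    using complex_sqrt_unit[of "z * w"] assms by (auto simp: norm_mult)
  have nz: "k \<noteq> 0" "z \<noteq> 0" "w \<noteq> 0" using k assms by auto
  define q where "q = (z + w) / (2 * k)"
  have "cnj q = (1 / z + 1 / w) * k / 2"
    by (simp add: q_def unit_cnj assms k)
  also have "\<dots> = (z + w) * k / (2 * (z * w))" using nz by (simp add: field_simps)
  also have "\<dots> = q" unfolding k(2)[symmetric] q_def using nz by (simp add: field_simps)
  finally have "q \<in> \<real>" by (simp add: Reals_cnj_iff)
  then obtain h where "q = complex_of_real h" by (auto elim: Reals_cases)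
  then have "z + w = 2 * complex_of_real h * k" using nz by (simp add: q_def field_simps)
  then show thesis using that[OF k(1), of h] k(2) by (simp add: power2_eq_square)
qed

lemma rotated_vertical_line:
  assumes k: "norm (k :: complex) = 1"
  shows "{u. u + k\<^sup>2 * cnj u = 2 * complex_of_real h * k} = range (\<lambda>t. k * Complex h t)"
proof -
  have kc: "k * cnj k = 1" using k complex_norm_square[of k] by simp
  have "Re (cnj k * u) = h \<longleftrightarrow> (\<exists>t. u = k * Complex h t)" for u
  proof
    assume "Re (cnj k * u) = h"
    then have "cnj k * u = Complex h (Im (cnj k * u))" by (simp add: complex_eq_iff)
    then have "k * (cnj k * u) = k * Complex h (Im (cnj k * u))" by (rule arg_cong)
    then have "u = k * Complex h (Im (cnj k * u))" using kc by (simp add: mult.assoc[symmetric])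
    then show "\<exists>t. u = k * Complex h t" by blast
  next
    assume "\<exists>t. u = k * Complex h t"
    then obtain t where "u = k * Complex h t" by blast
    then have "cnj k * u = Complex h t" using kc by (simp add: mult.assoc[symmetric] mult.commute[of "cnj k"])
    then show "Re (cnj k * u) = h" by simp
  qed
  then show ?thesis unfolding rotated_line_iff[OF k] by blast
qed

lemma dist_rotate:
  assumes k: "norm (k :: complex) = 1" shows "dist (k * v) a = dist v (cnj k * a)"
proof -
  have "k * cnj k = 1" using k complex_norm_square[of k] by simp
  then have "k * v - a = k * (v - cnj k * a)" by (simp add: algebra_simps)
  then show ?thesis using k by (simp add: dist_norm norm_mult)
qed

lemma ex1_range_Int_iff:
  assumes "inj f" shows "(\<exists>!u. u \<in> range f \<inter> E) \<longleftrightarrow> (\<exists>!t. f t \<in> E)"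
proof
  assume "\<exists>!u. u \<in> range f \<inter> E"
  then obtain t where "f t \<in> E" "\<And>s. f s \<in> E \<Longrightarrow> f s = f t" by blast
  then show "\<exists>!t. f t \<in> E" using assms by (metis injD)
next
  assume "\<exists>!t. f t \<in> E"
  then obtain t where "f t \<in> E" "\<And>s. f s \<in> E \<Longrightarrow> s = t" by blast
  then show "\<exists>!u. u \<in> range f \<inter> E" by blast
qed

text \<open>Rotating by \<open>k\<close> reduces the tangency condition to vertical lines.\<close>

lemma tangent_rotated_line:
  assumes k: "norm k = 1" and r: "dist a b < r"
  shows "(\<exists>!u. u \<in> {u. u + k\<^sup>2 * cnj u = 2 * complex_of_real h * k} \<inter> ellipse a b r)
    \<longleftrightarrow> 4 * (h - Re (cnj k * a)) * (h - Re (cnj k * b)) = r\<^sup>2 - (dist a b)\<^sup>2"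
proof -
  have nz: "k \<noteq> 0" using k by auto
  have dab: "dist (cnj k * a) (cnj k * b) = dist a b"
    using k by (simp add: dist_norm norm_mult flip: right_diff_distrib)
  have "(\<exists>!u. u \<in> {u. u + k\<^sup>2 * cnj u = 2 * complex_of_real h * k} \<inter> ellipse a b r)
     \<longleftrightarrow> (\<exists>!t. k * Complex h t \<in> ellipse a b r)"
    unfolding rotated_vertical_line[OF k] by (rule ex1_range_Int_iff) (use nz in \<open>auto simp: inj_def\<close>)
  also have "\<dots> \<longleftrightarrow> (\<exists>!t. dist (Complex h t) (cnj k * a) + dist (Complex h t) (cnj k * b) = r)"
    by (simp add: ellipse_def dist_rotate[OF k])
  also have "\<dots> \<longleftrightarrow> 4 * (h - Re (cnj k * a)) * (h - Re (cnj k * b)) = r\<^sup>2 - (dist a b)\<^sup>2"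
    using tangent_vertical_line[of "cnj k * a" "cnj k * b" r h] r unfolding dab by simp
  finally show ?thesis .
qed

text \<open>This vanishes iff \<open>f\<close> lies on the chord \<open>z w\<close> of the unit circle. Dividing it by twice a square root of
\<open>z w\<close> gives the signed distance of \<open>f\<close> from the chord.\<close>

abbreviation incidence :: "complex \<Rightarrow> complex \<Rightarrow> complex \<Rightarrow> complex" where
  "incidence f z w \<equiv> z + w - f - z * w * cnj f"

lemma ellipse_tangent_chord_iff:
  assumes z: "norm z = 1" and w: "norm w = 1" and zw: "z \<noteq> w" and r: "dist a b < r"
  shows "(\<exists>!u. u \<in> affine hull {z, w} \<inter> ellipse a b r) \<longleftrightarrow>
    (incidence a z w) * (incidence b z w)
      = complex_of_real (r\<^sup>2 - (dist a b)\<^sup>2) * (z * w)"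
proof -
  obtain k h where k: "norm k = 1" "z * w = k\<^sup>2" "z + w = 2 * complex_of_real h * k"
    using unit_chord_frame[OF z w] .
  have nz: "k \<noteq> 0" using k by auto
  have "(incidence a z w) * (incidence b z w)
      = complex_of_real (4 * (h - Re (cnj k * a)) * (h - Re (cnj k * b))) * k\<^sup>2"
    unfolding k(2,3) pencil_at_point[OF k(1)] by (simp add: power2_eq_square algebra_simps)
  then have "(incidence a z w) * (incidence b z w)
      = complex_of_real (r\<^sup>2 - (dist a b)\<^sup>2) * (z * w)
    \<longleftrightarrow> 4 * (h - Re (cnj k * a)) * (h - Re (cnj k * b)) = r\<^sup>2 - (dist a b)\<^sup>2"
    unfolding k(2) using nz by (simp only: mult_cancel_right of_real_eq_iff) simp
  then show ?thesis
    unfolding affine_hull_unit_chord[OF z w zw] k(2,3) tangent_rotated_line[OF k(1) r] by blast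
qed

section \<open>Elliptical disks and their support functions\<close>

text \<open>Reflect \<open>b\<close> in the vertical line through \<open>v\<close> and apply the triangle inequality to the mirror image.\<close>

lemma focal_sum_reflect:
  fixes v a b :: complex
  shows "(dist a b)\<^sup>2 + 4 * (Re v - Re a) * (Re v - Re b) \<le> (dist v a + dist v b)\<^sup>2"
proof -
  define b' where "b' = Complex (2 * Re v - Re b) (Im b)"
  have "(dist v b')\<^sup>2 = (dist v b)\<^sup>2"
    unfolding dist_norm cmod_power2 by (simp add: b'_def power2_commute)
  then have vb: "dist v b' = dist v b" by (simp add: power2_eq_iff_nonneg)
  have "(dist a b)\<^sup>2 + 4 * (Re v - Re a) * (Re v - Re b) = (dist a b')\<^sup>2"
    unfolding dist_norm cmod_power2 by (simp add: b'_def power2_eq_square algebra_simps)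
  also have "\<dots> \<le> (dist v a + dist v b')\<^sup>2"
    by (intro power_mono) (auto simp: dist_triangle3)
  finally show ?thesis using vb by simp
qed

lemma focal_sum_beyond_tangent:
  assumes k: "norm k = 1" and r: "dist a b < r"
    and h: "Re (cnj k * a) \<le> h" "Re (cnj k * b) \<le> h"
    and tan: "4 * (h - Re (cnj k * a)) * (h - Re (cnj k * b)) = r\<^sup>2 - (dist a b)\<^sup>2"
    and v: "h < Re (cnj k * v)"
  shows "r < dist v a + dist v b"
proof -
  have rot: "dist (cnj k * x) (cnj k * y) = dist x y" for x y
    using k by (simp add: dist_norm norm_mult flip: right_diff_distrib)
  have "(h - Re (cnj k * a)) * (h - Re (cnj k * b))
      < (Re (cnj k * v) - Re (cnj k * a)) * (Re (cnj k * v) - Re (cnj k * b))"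
    using h v by (intro mult_strict_mono') linarith+
  then have "r\<^sup>2 < (dist a b)\<^sup>2 + 4 * (Re (cnj k * v) - Re (cnj k * a)) * (Re (cnj k * v) - Re (cnj k * b))"
    using tan by linarith
  also have "\<dots> \<le> (dist v a + dist v b)\<^sup>2"
    using focal_sum_reflect[of "cnj k * a" "cnj k * b" "cnj k * v"] unfolding rot .
  finally show ?thesis by (rule power2_less_imp_less) simp
qed

lemma convex_elliptical_disk: "convex {z. dist z a + dist z b \<le> (r :: real)}" for a b :: complex
proof -
  have c: "convex_on UNIV (\<lambda>z. dist a z + dist b z)"
    by (intro convex_on_add convex_on_dist) auto
  show ?thesis
  proof (rule convexI)
    fix x y :: complex and s t :: real
    assume xy: "x \<in> {z. dist z a + dist z b \<le> r}" "y \<in> {z. dist z a + dist z b \<le> r}"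
      and st: "0 \<le> s" "0 \<le> t" "s + t = 1"
    have "dist a (s *\<^sub>R x + t *\<^sub>R y) + dist b (s *\<^sub>R x + t *\<^sub>R y)
        \<le> s * (dist a x + dist b x) + t * (dist a y + dist b y)"
      using c st unfolding convex_on_def by blast
    also have "\<dots> \<le> r" using xy st by (intro convex_bound_le) (auto simp: dist_commute)
    finally show "s *\<^sub>R x + t *\<^sub>R y \<in> {z. dist z a + dist z b \<le> r}"
      by (simp add: dist_commute)
  qed
qed

lemma closed_elliptical_disk: "closed {z. dist z a + dist z b \<le> (r :: real)}" for a b :: complex
  by (intro closed_Collect_le continuous_intros)

text \<open>The separating hyperplane theorem in the form needed for support functions.\<close>

lemma separating_direction:
  fixes S :: "complex set"
  assumes "convex S" "closed S" "S \<noteq> {}" "u \<notin> S"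
  obtains k where "norm k = 1" "\<And>x. x \<in> S \<Longrightarrow> Re (cnj k * x) < Re (cnj k * u)"
proof -
  obtain a b where ab: "a \<bullet> u < b" "\<And>x. x \<in> S \<Longrightarrow> b < a \<bullet> x"
    using separating_hyperplane_closed_point[OF assms(1,2,4)] by blast
  have "a \<noteq> 0" using ab assms(3) by fastforce
  define k where "k = (- 1 / norm a) *\<^sub>R a"
  have "norm k = 1" using \<open>a \<noteq> 0\<close> by (simp add: k_def)
  moreover have "Re (cnj k * x) < Re (cnj k * u)" if "x \<in> S" for x
  proof -
    have "Re (cnj k * y) = (- 1 / norm a) * (a \<bullet> y)" for y
      by (simp add: k_def inner_complex_def algebra_simps add_divide_distrib)
    then show ?thesis using ab(1) ab(2)[OF that] \<open>a \<noteq> 0\<close> by (simp add: divide_strict_right_mono)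
  qed
  ultimately show thesis using that by blast
qed

text \<open>Both sets are closed and convex, so a point of one outside the other can be separated from the other by a direction
\<open>k\<close>. The supporting line of \<open>W\<close> in this direction is tangent to the ellipse, so no point of either set lies
beyond it, and both sets reach it.\<close>

lemma elliptical_disk_by_support:
  fixes W :: "complex set"
  assumes W: "convex W" "closed W" "W \<noteq> {}" and r: "dist a b < r"
    and supp: "\<And>k. norm k = 1 \<Longrightarrow> \<exists>h. (\<forall>u\<in>W. Re (cnj k * u) \<le> h) \<and> (\<exists>u\<in>W. Re (cnj k * u) = h)
      \<and> Re (cnj k * a) \<le> h \<and> Re (cnj k * b) \<le> h
      \<and> 4 * (h - Re (cnj k * a)) * (h - Re (cnj k * b)) = r\<^sup>2 - (dist a b)\<^sup>2"
  shows "W = {z. dist z a + dist z b \<le> r}" (is "W = ?D")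
proof (intro equalityI subsetI)
  fix u assume u: "u \<in> W"
  show "u \<in> ?D"
  proof (rule ccontr)
    assume nu: "u \<notin> ?D"
    have "a \<in> ?D" using r by simp
    then obtain k where k: "norm k = 1" "\<And>x. x \<in> ?D \<Longrightarrow> Re (cnj k * x) < Re (cnj k * u)"
      using separating_direction[OF convex_elliptical_disk closed_elliptical_disk _ nu] by blast
    obtain h where h: "Re (cnj k * u) \<le> h"
        "4 * (h - Re (cnj k * a)) * (h - Re (cnj k * b)) = r\<^sup>2 - (dist a b)\<^sup>2"
      using supp[OF k(1)] u by blast
    obtain v where v: "v + k\<^sup>2 * cnj v = 2 * complex_of_real h * k" "v \<in> ellipse a b r"
      using tangent_rotated_line[OF k(1) r, of h] h(2) by blast
    have "h = Re (cnj k * v)"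
      using v(1) rotated_line_iff[OF k(1)] by simp
    moreover have "v \<in> ?D" using v(2) by (simp add: ellipse_def)
    ultimately show False using k(2)[of v] h(1) by linarith
  qed
next
  fix v assume v: "v \<in> ?D"
  show "v \<in> W"
  proof (rule ccontr)
    assume "v \<notin> W"
    then obtain k where k: "norm k = 1" "\<And>x. x \<in> W \<Longrightarrow> Re (cnj k * x) < Re (cnj k * v)"
      using separating_direction[OF W] by blast
    obtain h where h: "\<exists>u\<in>W. Re (cnj k * u) = h" "Re (cnj k * a) \<le> h" "Re (cnj k * b) \<le> h"
        "4 * (h - Re (cnj k * a)) * (h - Re (cnj k * b)) = r\<^sup>2 - (dist a b)\<^sup>2"
      using supp[OF k(1)] by blast
    have "h < Re (cnj k * v)" using h(1) k(2) by blast
    from focal_sum_beyond_tangent[OF k(1) r h(2-4) this] v show False by simp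
  qed
qed

lemma frontier_elliptical_disk:
  fixes a b :: complex
  assumes r: "dist a b < r"
  shows "frontier {z. dist z a + dist z b \<le> r} = ellipse a b r" (is "frontier ?D = _")
proof -
  have "interior ?D = {z. dist z a + dist z b < r}"
  proof (intro equalityI subsetI)
    fix u assume u: "u \<in> interior ?D"
    define c where "c = u - a"
    have lim: "((\<lambda>t. u + t *\<^sub>R c) \<longlongrightarrow> u + 0 *\<^sub>R c) (at_right 0)"
      by (intro tendsto_intros)
    then have "\<forall>\<^sub>F t in at_right 0. u + t *\<^sub>R c \<in> interior ?D"
      using u by (intro topological_tendstoD[OF lim]) auto
    then have "\<forall>\<^sub>F t in at_right (0 :: real). u + t *\<^sub>R c \<in> interior ?D \<and> 0 < t"
      by (intro eventually_conj) (auto simp: eventually_at_right_less)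
    then obtain t where t: "0 < t" "u + t *\<^sub>R c \<in> interior ?D"
      using eventually_happens'[OF trivial_limit_at_right_real] by blast
    \<comment> \<open>\<open>u\<close> is a proper convex combination of the focus \<open>a\<close> and a further point of the disk\<close>
    define y where "y = u + t *\<^sub>R c"
    have y: "dist y a + dist y b \<le> r" using t(2) interior_subset by (auto simp: y_def)
    have ua: "dist y a = (1 + t) * dist u a"
    proof -
      have "y - a = (1 + t) *\<^sub>R (u - a)" by (simp add: y_def c_def algebra_simps)
      then show ?thesis using t(1) by (simp add: dist_norm)
    qed
    have ub: "(1 + t) * dist u b \<le> t * dist a b + dist y b"
    proof -
      have "(1 + t) *\<^sub>R (u - b) = t *\<^sub>R (a - b) + (y - b)" by (simp add: y_def c_def algebra_simps)
      then have "norm ((1 + t) *\<^sub>R (u - b)) \<le> norm (t *\<^sub>R (a - b)) + norm (y - b)"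
        by (metis norm_triangle_ineq)
      then show ?thesis using t(1) by (simp add: dist_norm)
    qed
    have "(1 + t) * (dist u a + dist u b) \<le> t * dist a b + r"
      using ua ub y by (simp add: distrib_left)
    also have "\<dots> < (1 + t) * r" using r t(1) by (simp add: distrib_right)
    finally show "u \<in> {z. dist z a + dist z b < r}" using t(1) by simp
  next
    fix u assume "u \<in> {z. dist z a + dist z b < r}"
    moreover have "open {z. dist z a + dist z b < r}"
      by (intro open_Collect_less continuous_intros)
    ultimately show "u \<in> interior ?D" by (auto intro!: interiorI)
  qed
  then show ?thesis
    using closed_elliptical_disk[of a b r] by (auto simp: frontier_def ellipse_def)
qed

section \<open>Points in cyclic order\<close>

text \<open>Twice the signed area of the triangle. It is positive iff the triangle is positively oriented, and affine in its last vertex.\<close>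

definition orient :: "complex \<Rightarrow> complex \<Rightarrow> complex \<Rightarrow> real" where
  "orient a b c = Im (cnj (b - a) * (c - a))"

lemma orient_swap: "orient a c b = - orient a b c"
  by (simp add: orient_def algebra_simps)

lemma orient_degenerate [simp]: "orient a b a = 0" "orient a b b = 0"
  by (simp_all add: orient_def algebra_simps)

lemma orient_affine:
  assumes "s + t = 1"
  shows "orient a b (s *\<^sub>R x + t *\<^sub>R y) = s * orient a b x + t * orient a b y"
proof -
  have s: "s = 1 - t" using assms by simp
  show ?thesis by (simp add: s orient_def algebra_simps)
qed

lemma orient_affine_hull: "u \<in> affine hull {a, b} \<Longrightarrow> orient a b u = 0"
  by (auto simp: affine_hull_2 orient_affine)

text \<open>The half differences of the angles lie between \<open>0\<close> and \<open>\<pi>\<close> for points in cyclic order, so this product formula shows the sign.\<close>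

lemma orient_cis:
  fixes x y z :: real
  shows "orient (cis x) (cis y) (cis z) = 4 * sin ((y - x) / 2) * sin ((z - y) / 2) * sin ((z - x) / 2)"
proof -
  define p q where "p = (y - x) / 2" and "q = (z - y) / 2"
  have y: "y = x + 2 * p" and z: "z = x + 2 * p + 2 * q" by (simp_all add: p_def q_def field_simps)
  have "orient (cis x) (cis y) (cis z) = sin (y - x) + sin (z - y) - sin (z - x)"
    using sin_cos_squared_add[of x] by (simp add: orient_def sin_diff power2_eq_square algebra_simps)
  also have "\<dots> = sin (2 * p) + sin (2 * q) - sin (2 * (p + q))" by (simp add: y z)
  also have "\<dots> = 2 * sin p * cos p + 2 * sin q * cos q - 2 * sin (p + q) * cos (p + q)"
    by (simp only: sin_double)
  also have "\<dots> = 4 * sin p * sin q * sin (p + q)"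
  proof -
    have 1: "cos p * cos p = 1 - sin p * sin p" "cos q * cos q = 1 - sin q * sin q"
      using sin_cos_squared_add3[of p] sin_cos_squared_add3[of q] by linarith+
    have "(sin p * cos q + cos p * sin q) * (cos p * cos q - sin p * sin q)
       = sin p * cos p * (cos q * cos q) - sin p * sin p * (sin q * cos q)
        + sin q * cos q * (cos p * cos p) - sin p * cos p * (sin q * sin q)"
      by (simp add: algebra_simps)
    also have "\<dots> = sin p * cos p + sin q * cos q - 2 * sin p * sin q * (sin p * cos q + cos p * sin q)"
      unfolding 1 by (simp add: algebra_simps)
    finally show ?thesis unfolding sin_add cos_add by (simp add: algebra_simps)
  qed
  finally show ?thesis by (simp add: p_def q_def add_divide_distrib[symmetric])
qed

lemma cyclically_ordered_orient:
  assumes P: "cyclically_ordered m P" and ijk: "i < j" "j < k" "k < m"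
  shows "orient (P i) (P j) (P k) > 0"
proof -
  obtain t where t: "strict_mono_on {..<m} t" "\<And>j. j < m \<Longrightarrow> t j < t 0 + 2 * pi \<and> P j = cis (t j)"
    using P unfolding cyclically_ordered_def by blast
  have "t i < t j" "t j < t k" using t(1) ijk by (auto simp: strict_mono_on_def)
  moreover have "t 0 \<le> t i" using t(1) ijk by (cases "i = 0") (auto simp: strict_mono_on_def intro!: less_imp_le)
  moreover have "t k < t 0 + 2 * pi" using t(2) ijk by blast
  ultimately have "sin ((t j - t i) / 2) > 0" "sin ((t k - t j) / 2) > 0" "sin ((t k - t i) / 2) > 0"
    by (auto intro!: sin_gt_zero)
  then show ?thesis using t(2) ijk by (simp add: orient_cis)
qed

lemma cyclically_ordered_norm: "cyclically_ordered m P \<Longrightarrow> j < m \<Longrightarrow> norm (P j) = 1"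
  unfolding cyclically_ordered_def using norm_cis by metis

lemma cyclically_ordered_inj:
  assumes P: "cyclically_ordered m P" shows "inj_on P {..<m}"
proof (rule inj_onI)
  obtain t where t: "strict_mono_on {..<m} t" "\<And>j. j < m \<Longrightarrow> t j < t 0 + 2 * pi \<and> P j = cis (t j)"
    using P unfolding cyclically_ordered_def by blast
  have ne: "P i \<noteq> P j" if ij: "i < j" "j < m" for i j
  proof
    assume "P i = P j"
    then have "cis (t j - t i) = 1" using t(2) ij by (simp add: cis_divide[symmetric])
    then have "cos (t j - t i) = 1" by (metis cis.sel(1) one_complex.sel(1))
    then obtain n where n: "t j - t i = real_of_int n * (2 * pi)"
      by (auto simp: cos_one_2pi_int)
    have "t i < t j" using t(1) ij by (auto simp: strict_mono_on_def)
    moreover have "t 0 \<le> t i" using t(1) ij by (cases "i = 0") (auto simp: strict_mono_on_def intro!: less_imp_le)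
    moreover have "t j < t 0 + 2 * pi" using t(2) ij by blast
    ultimately have "0 < real_of_int n * (2 * pi)" "real_of_int n * (2 * pi) < 1 * (2 * pi)" using n by linarith+
    then have "0 < n" "real_of_int n < 1" by (simp_all add: zero_less_mult_iff)
    then show False by linarith
  qed
  fix i j assume "i \<in> {..<m}" "j \<in> {..<m}" "P i = P j"
  then show "i = j" using ne[of i j] ne[of j i] by (cases i j rule: linorder_cases) auto
qed

lemma cyclically_ordered_shift1:
  assumes P: "cyclically_ordered m P"
  shows "cyclically_ordered m (\<lambda>j. P (Suc j mod m))"
proof -
  obtain t where t: "strict_mono_on {..<m} t" "\<And>j. j < m \<Longrightarrow> t j < t 0 + 2 * pi \<and> P j = cis (t j)"
    using P unfolding cyclically_ordered_def by blast
  define s where "s j = (if Suc j < m then t (Suc j) else t 0 + 2 * pi)" for j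
  have mono: "t i < t j" if "i < j" "j < m" for i j using t(1) that by (auto simp: strict_mono_on_def)
  have "strict_mono_on {..<m} s"
    by (rule strict_mono_onI) (auto simp: s_def mono t(2))
  moreover have "s j < s 0 + 2 * pi \<and> P (Suc j mod m) = cis (s j)" if j: "j < m" for j
  proof (cases "Suc j < m")
    case True
    have "t (Suc j) < t 0 + 2 * pi" "t 0 < t (Suc 0)" using t(2) mono True by auto
    then have "s j < s 0 + 2 * pi" using True by (simp add: s_def)
    moreover have "P (Suc j mod m) = cis (s j)" using True t(2)[of "Suc j"] by (simp add: s_def)
    ultimately show ?thesis by blast
  next
    case False
    then have m: "m = Suc j" using j by simp
    have "t 0 + 2 * pi < s 0 + 2 * pi"
      using mono[of 0 1] by (auto simp: s_def)
    moreover have "cis (t 0 + 2 * pi) = cis (t 0)" by (simp add: cis_mult[symmetric])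
    ultimately show ?thesis using m t(2)[of 0] by (auto simp: s_def)
  qed
  ultimately show ?thesis unfolding cyclically_ordered_def by blast
qed

lemma cyclically_ordered_shift:
  assumes P: "cyclically_ordered m P" and m: "0 < m"
  shows "cyclically_ordered m (\<lambda>j. P ((j + n) mod m))"
proof (induction n)
  case 0
  have "cyclically_ordered m (\<lambda>j. P (j mod m)) = cyclically_ordered m P"
    unfolding cyclically_ordered_def by (intro arg_cong[where f = Ex] ext) auto
  then show ?case using P by simp
next
  case (Suc n)
  from cyclically_ordered_shift1[OF Suc] show ?case by (simp add: mod_simps)
qed

lemma image_shift_mod:
  fixes m :: nat assumes "0 < m" shows "(\<lambda>j. P ((j + n) mod m)) ` {..<m} = P ` {..<m}"
proof -
  have "(\<lambda>j. (j + n) mod m) ` {..<m} = {..<m}"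
  proof (intro equalityI subsetI)
    fix k assume k: "k \<in> {..<m}"
    have "k + (m - n mod m) + n mod m = k + m"
      using mod_less_divisor[OF assms, of n] by linarith
    then have "((k + (m - n mod m)) mod m + n) mod m = (k + m) mod m"
      by (metis mod_add_left_eq mod_add_right_eq)
    also have "\<dots> = k" using k by simp
    finally have "k = (\<lambda>j. (j + n) mod m) ((k + (m - n mod m)) mod m)" by simp
    moreover have "(k + (m - n mod m)) mod m \<in> {..<m}" using assms by simp
    ultimately show "k \<in> (\<lambda>j. (j + n) mod m) ` {..<m}" by (rule image_eqI)
  qed (use assms in auto)
  then show ?thesis by (metis image_image)
qed

text \<open>Sort the points by their angles.\<close>

lemma cyclic_enumeration:
  assumes S: "finite S" "card S = m" and unit: "\<And>z. z \<in> S \<Longrightarrow> norm z = 1"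
  obtains P where "cyclically_ordered m P" "P ` {..<m} = S"
proof -
  define xs where "xs = sorted_list_of_set (Arg2pi ` S)"
  have cisA: "cis (Arg2pi z) = z" if "z \<in> S" for z
    using complex_norm_eq_1_exp[of z] unit[OF that] by (simp add: cis_conv_exp)
  have inj: "inj_on Arg2pi S" by (metis cisA inj_onI)
  have xs: "set xs = Arg2pi ` S" "length xs = m" "sorted_wrt (<) xs"
    using S inj by (simp_all add: xs_def card_image)
  have rng: "0 \<le> xs ! j \<and> xs ! j < 2 * pi" if "j < m" for j
  proof -
    have "xs ! j \<in> Arg2pi ` S" using that xs by (metis nth_mem)
    then show ?thesis using Arg2pi_ge_0 Arg2pi_lt_2pi by auto
  qed
  define P where "P j = cis (xs ! j)" for j
  have "strict_mono_on {..<m} (\<lambda>j. xs ! j)"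
    using xs by (auto simp: strict_mono_on_def sorted_wrt_iff_nth_less)
  moreover have "xs ! j < xs ! 0 + 2 * pi" if "j < m" for j
    using rng[OF that] rng[of 0] that by auto
  ultimately have "cyclically_ordered m P" unfolding cyclically_ordered_def P_def by blast
  moreover have "P ` {..<m} = cis ` set xs"
    using xs(2) by (auto simp: P_def set_conv_nth)
  then have "P ` {..<m} = S" using cisA by (force simp: xs(1))
  ultimately show thesis using that by blast
qed

text \<open>Expanding the norm of \<open>s z + t w\<close> with \<open>s + t = 1\<close> gives \<open>1 - 2 s t (1 - Re (cnj z w))\<close>; it is smaller than
one only if \<open>s t\<close> is positive.\<close>

lemma interior_point_of_chord:
  assumes z: "norm z = 1" and w: "norm w = 1" and u: "u \<in> affine hull {z, w}" "norm (u :: complex) < 1"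
  obtains s t where "0 < s" "0 < t" "s + t = 1" "u = s *\<^sub>R z + t *\<^sub>R w"
proof -
  obtain s t where st: "u = s *\<^sub>R z + t *\<^sub>R w" "s + t = 1" using u(1) by (auto simp: affine_hull_2)
  have s: "s = 1 - t" using st by simp
  define c where "c = Re (cnj z * w)"
  have c: "c \<le> 1"
    using complex_Re_le_cmod[of "cnj z * w"] z w by (simp add: c_def norm_mult)
  have "(norm u)\<^sup>2 = s\<^sup>2 * (norm z)\<^sup>2 + t\<^sup>2 * (norm w)\<^sup>2 + 2 * s * t * c"
    unfolding st(1) cmod_power2 c_def by (simp add: power2_eq_square algebra_simps)
  also have "\<dots> = 1 - 2 * (s * t * (1 - c))"
    by (simp add: z w s power2_eq_square algebra_simps)
  finally have "(norm u)\<^sup>2 = 1 - 2 * (s * t * (1 - c))" .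
  moreover have "(norm u)\<^sup>2 < 1" using u(2) by (simp add: abs_square_less_1)
  ultimately have "0 < s * t * (1 - c)" by linarith
  then have "0 < s * t" using c by (simp add: zero_less_mult_iff)
  then have "0 < s \<and> 0 < t" using st(2) by (auto simp: zero_less_mult_iff)
  then show thesis using that st by blast
qed

text \<open>An involution \<open>g\<close> pairs the points by chords through the interior point \<open>f\<close>. The chord from \<open>P 0\<close> to
\<open>g (P 0) = P k\<close> contains \<open>f\<close>, hence every other chord of the family crosses it, and \<open>g\<close> exchanges the \<open>k - 1\<close>
points on one side with the \<open>m - k - 1\<close> points on the other.\<close>

lemma concurrent_chords_opposite:
  fixes g :: "complex \<Rightarrow> complex"
  assumes P: "cyclically_ordered m P" and m: "0 < m"
    and V: "P ` {..<m} = V"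
    and g: "\<And>p. p \<in> V \<Longrightarrow> g p \<in> V \<and> g p \<noteq> p \<and> g (g p) = p \<and> f \<in> affine hull {p, g p}"
    and f: "norm f < 1"
  obtains k where "m = 2 * k" "g (P 0) = P k"
proof -
  have g0: "g (P 0) \<in> V" "g (P 0) \<noteq> P 0" "f \<in> affine hull {P 0, g (P 0)}"
    using g[of "P 0"] V m by auto
  obtain k where k: "k < m" "g (P 0) = P k" using g0(1) V by auto
  have k0: "0 < k" using g0(2) k(2) by (cases k) auto
  have unit: "norm p = 1" if "p \<in> V" for p using that V cyclically_ordered_norm[OF P] by auto
  have of: "orient (P 0) (P k) f = 0" using g0(3) k(2) by (auto intro: orient_affine_hull)
  have opp: "orient (P 0) (P k) (g p) * orient (P 0) (P k) p < 0"
    if p: "p \<in> V" "orient (P 0) (P k) p \<noteq> 0" for p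
  proof -
    obtain s t where st: "0 < s" "0 < t" "s + t = 1" "f = s *\<^sub>R p + t *\<^sub>R g p"
      using interior_point_of_chord[of p "g p" f] g[OF p(1)] unit p(1) f by metis
    have "s * orient (P 0) (P k) p + t * orient (P 0) (P k) (g p) = 0"
      using of orient_affine[OF st(3)] st(4) by simp
    then have "orient (P 0) (P k) (g p) = - (s / t) * orient (P 0) (P k) p"
      using st(2) by (simp add: field_simps)
    then have "orient (P 0) (P k) (g p) * orient (P 0) (P k) p = - (s / t) * (orient (P 0) (P k) p)\<^sup>2"
      by (simp add: power2_eq_square)
    also have "\<dots> < 0" using st p(2) by (simp add: mult_neg_pos divide_pos_pos)
    finally show ?thesis .
  qed
  have before: "orient (P 0) (P k) (P i) < 0" if "0 < i" "i < k" for i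
    using cyclically_ordered_orient[OF P that k(1)] orient_swap[of "P 0" "P k" "P i"] by simp
  have after: "orient (P 0) (P k) (P i) > 0" if "k < i" "i < m" for i
    using cyclically_ordered_orient[OF P k0 that] .
  have gi: "inj_on g V" by (metis g inj_onI)
  let ?A = "P ` {0<..<k}" and ?B = "P ` {k<..<m}"
  have sub: "?A \<subseteq> V" "?B \<subseteq> V" using V k by auto
  have side: "i = 0 \<or> i = k \<or> (0 < i \<and> i < k) \<or> (k < i \<and> i < m)" if "i < m" for i using that by auto
  have AB: "g ` ?A \<subseteq> ?B"
  proof
    fix q assume "q \<in> g ` ?A"
    then obtain p where p: "q = g p" "p \<in> ?A" by blast
    have op: "orient (P 0) (P k) p < 0" using p(2) before by auto
    then have "orient (P 0) (P k) q > 0" using opp[of p] p sub by (auto simp: mult_less_0_iff)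
    moreover obtain i where "i < m" "q = P i" using g[of p] p sub V by auto
    ultimately show "q \<in> ?B" using side[of i] before[of i] by fastforce
  qed
  have BA: "g ` ?B \<subseteq> ?A"
  proof
    fix q assume "q \<in> g ` ?B"
    then obtain p where p: "q = g p" "p \<in> ?B" by blast
    have op: "orient (P 0) (P k) p > 0" using p(2) after by auto
    then have "orient (P 0) (P k) q < 0" using opp[of p] p sub by (auto simp: mult_less_0_iff)
    moreover obtain i where "i < m" "q = P i" using g[of p] p sub V by auto
    ultimately show "q \<in> ?A" using side[of i] after[of i] by fastforce
  qed
  have Pi: "inj_on P {..<m}" by (rule cyclically_ordered_inj[OF P])
  have cA: "card ?A = k - 1" using k(1) by (subst card_image) (auto intro: inj_on_subset[OF Pi])
  have cB: "card ?B = m - k - 1" using k(1) by (subst card_image) (auto intro: inj_on_subset[OF Pi])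
  have "card ?A \<le> card ?B" by (rule card_inj_on_le[OF inj_on_subset[OF gi sub(1)] AB]) simp
  moreover have "card ?B \<le> card ?A" by (rule card_inj_on_le[OF inj_on_subset[OF gi sub(2)] BA]) simp
  ultimately have "m = 2 * k" using cA cB k0 k(1) by linarith
  then show thesis using that k by blast
qed

section \<open>Blaschke products\<close>

definition blaschke_num :: "complex list \<Rightarrow> complex poly" where
  "blaschke_num fs = (\<Prod>f\<leftarrow>fs. [:- f, 1:])"

definition blaschke_den :: "complex list \<Rightarrow> complex poly" where
  "blaschke_den fs = (\<Prod>f\<leftarrow>fs. [:1, - cnj f:])"

lemma blaschke_simps [simp]:
  "blaschke_num [] = 1" "blaschke_num (f # fs) = [:- f, 1:] * blaschke_num fs"
  "blaschke_den [] = 1" "blaschke_den (f # fs) = [:1, - cnj f:] * blaschke_den fs"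
  by (simp_all add: blaschke_num_def blaschke_den_def)

lemma poly_blaschke_Cons:
  "poly (blaschke_num (f # fs)) z = (z - f) * poly (blaschke_num fs) z"
  "poly (blaschke_den (f # fs)) z = (1 - cnj f * z) * poly (blaschke_den fs) z"
  by (simp_all add: algebra_simps)

text \<open>This identity shows where a Blaschke factor has modulus smaller than, equal to or larger than one.\<close>

lemma norm_reflected_diff: "(norm (1 - cnj f * z))\<^sup>2 - (norm (z - f))\<^sup>2 = (1 - (norm f)\<^sup>2) * (1 - (norm z)\<^sup>2)"
  unfolding cmod_power2 by (simp add: power2_eq_square algebra_simps)

lemma reflected_factor_nz:
  assumes "norm f < 1" "norm z \<le> 1" shows "1 - cnj f * z \<noteq> 0"
proof
  assume "1 - cnj f * z = 0"
  then have "norm (cnj f * z) = 1" by (metis eq_iff_diff_eq_0 norm_one)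
  moreover have "norm (cnj f * z) \<le> norm f * 1" unfolding norm_mult complex_mod_cnj
    using assms by (intro mult_left_mono) auto
  ultimately show False using assms by simp
qed

lemma blaschke_inside:
  assumes "\<And>f. f \<in> set fs \<Longrightarrow> norm f < 1" "norm z < 1"
  shows "poly (blaschke_den fs) z \<noteq> 0 \<and> norm (poly (blaschke_num fs) z) \<le> norm (poly (blaschke_den fs) z)
    \<and> (fs \<noteq> [] \<longrightarrow> norm (poly (blaschke_num fs) z) < norm (poly (blaschke_den fs) z))"
  using assms(1)
proof (induction fs)
  case (Cons f fs)
  have f: "norm f < 1" using Cons.prems by simp
  have IH: "poly (blaschke_den fs) z \<noteq> 0" "norm (poly (blaschke_num fs) z) \<le> norm (poly (blaschke_den fs) z)"
    using Cons by auto
  have "(1 - (norm f)\<^sup>2) * (1 - (norm z)\<^sup>2) > 0"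
    using f assms(2) by (intro mult_pos_pos) (auto simp: abs_square_less_1)
  then have "(norm (z - f))\<^sup>2 < (norm (1 - cnj f * z))\<^sup>2" using norm_reflected_diff[of f z] by linarith
  then have "norm (z - f) < norm (1 - cnj f * z)" by (rule power2_less_imp_less) simp
  moreover have "norm (poly (blaschke_den fs) z) > 0" using IH by simp
  ultimately have "norm (z - f) * norm (poly (blaschke_num fs) z)
      < norm (1 - cnj f * z) * norm (poly (blaschke_den fs) z)"
    using IH(2) by (intro le_less_trans[OF mult_left_mono mult_strict_right_mono]) auto
  moreover have "1 - cnj f * z \<noteq> 0" using reflected_factor_nz f assms(2) by simp
  ultimately show ?case using IH(1) unfolding poly_blaschke_Cons by (simp add: norm_mult)
qed simp

lemma blaschke_outside:
  assumes "\<And>f. f \<in> set fs \<Longrightarrow> norm f < 1" "norm z > 1"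
  shows "poly (blaschke_num fs) z \<noteq> 0 \<and> norm (poly (blaschke_den fs) z) \<le> norm (poly (blaschke_num fs) z)
    \<and> (fs \<noteq> [] \<longrightarrow> norm (poly (blaschke_den fs) z) < norm (poly (blaschke_num fs) z))"
  using assms(1)
proof (induction fs)
  case (Cons f fs)
  have f: "norm f < 1" using Cons.prems by simp
  have IH: "poly (blaschke_num fs) z \<noteq> 0" "norm (poly (blaschke_den fs) z) \<le> norm (poly (blaschke_num fs) z)"
    using Cons by auto
  have "(norm f)\<^sup>2 < 1" using f by (simp add: abs_square_less_1)
  moreover have "(norm z)\<^sup>2 > 1" using assms(2) by (simp add: one_less_power)
  ultimately have "(1 - (norm f)\<^sup>2) * (1 - (norm z)\<^sup>2) < 0"
    by (intro mult_pos_neg) auto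
  then have "(norm (1 - cnj f * z))\<^sup>2 < (norm (z - f))\<^sup>2" using norm_reflected_diff[of f z] by linarith
  then have "norm (1 - cnj f * z) < norm (z - f)" by (rule power2_less_imp_less) simp
  moreover have "norm (poly (blaschke_num fs) z) > 0" using IH by simp
  ultimately have "norm (1 - cnj f * z) * norm (poly (blaschke_den fs) z)
      < norm (z - f) * norm (poly (blaschke_num fs) z)"
    using IH(2) by (intro le_less_trans[OF mult_left_mono mult_strict_right_mono]) auto
  moreover have "z - f \<noteq> 0" using f assms(2) by auto
  ultimately show ?case using IH(1) unfolding poly_blaschke_Cons by (simp add: norm_mult)
qed simp

text \<open>The number \<open>S\<close> is \<open>z B' / B\<close> for the Blaschke product \<open>B\<close>; on the circle it is the sum over the zeros \<open>f\<close> of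
the Poisson kernels \<open>(1 - |f|\<^sup>2) / |z - f|\<^sup>2\<close>. The quotient rule is cleared of denominators. Positivity is what
makes the points of a fibre simple, and it gives the positive weights in \<open>cubic_fibre_surrounds_zero\<close>.\<close>

lemma blaschke_log_derivative:
  assumes "\<And>f. f \<in> set fs \<Longrightarrow> norm f < 1" "norm z = 1"
  obtains S :: real where
    "z * (poly (pderiv (blaschke_num fs)) z * poly (blaschke_den fs) z
       - poly (blaschke_num fs) z * poly (pderiv (blaschke_den fs)) z)
     = poly (blaschke_num fs) z * poly (blaschke_den fs) z * complex_of_real S"
    "0 \<le> S" "fs \<noteq> [] \<Longrightarrow> 0 < S"
    "poly (blaschke_num fs) z \<noteq> 0" "poly (blaschke_den fs) z \<noteq> 0"
proof -
  have "\<exists>S :: real. z * (poly (pderiv (blaschke_num fs)) z * poly (blaschke_den fs) z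
       - poly (blaschke_num fs) z * poly (pderiv (blaschke_den fs)) z)
     = poly (blaschke_num fs) z * poly (blaschke_den fs) z * complex_of_real S
     \<and> 0 \<le> S \<and> (fs \<noteq> [] \<longrightarrow> 0 < S) \<and> poly (blaschke_num fs) z \<noteq> 0 \<and> poly (blaschke_den fs) z \<noteq> 0"
    using assms(1)
  proof (induction fs)
    case Nil show ?case by (rule exI[of _ 0]) (simp add: pderiv_1)
  next
    case (Cons f fs)
    then obtain S where S: "z * (poly (pderiv (blaschke_num fs)) z * poly (blaschke_den fs) z
         - poly (blaschke_num fs) z * poly (pderiv (blaschke_den fs)) z)
       = poly (blaschke_num fs) z * poly (blaschke_den fs) z * complex_of_real S"
       "0 \<le> S" "poly (blaschke_num fs) z \<noteq> 0" "poly (blaschke_den fs) z \<noteq> 0" by auto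
    have f: "norm f < 1" using Cons.prems by simp
    have zf: "z - f \<noteq> 0" using f assms(2) by auto
    have rf: "1 - cnj f * z \<noteq> 0" using reflected_factor_nz f assms(2) by simp
    define T where "T = (1 - (norm f)\<^sup>2) / (norm (z - f))\<^sup>2"
    have T: "T > 0" using f zf by (simp add: T_def abs_square_less_1)
    \<comment> \<open>the Poisson kernel\<close>
    have zz: "z * cnj z = 1" using assms(2) complex_norm_square[of z] by simp
    have "z * (cnj z - cnj f) = 1 - cnj f * z" using zz by (simp add: algebra_simps)
    then have 1: "(z - f) * (1 - cnj f * z) = z * ((z - f) * cnj (z - f))"
      by (simp add: mult.left_commute)
    have "(z - f) * (1 - cnj f * z) * complex_of_real T = z * (1 - f * cnj f)"
      unfolding 1 T_def using zf by (simp add: complex_norm_square[symmetric] del: complex_cnj_diff)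
    then have key: "z * ((1 - cnj f * z) + (z - f) * cnj f) = (z - f) * (1 - cnj f * z) * complex_of_real T"
      by (simp add: algebra_simps)
    let ?N = "poly (blaschke_num fs) z" and ?D = "poly (blaschke_den fs) z"
    let ?N' = "poly (pderiv (blaschke_num fs)) z" and ?D' = "poly (pderiv (blaschke_den fs)) z"
    have dN: "poly (pderiv (blaschke_num (f # fs))) z = ?N + (z - f) * ?N'"
      unfolding blaschke_simps pderiv_mult by (simp add: pderiv_pCons algebra_simps)
    have dD: "poly (pderiv (blaschke_den (f # fs))) z = - cnj f * ?D + (1 - cnj f * z) * ?D'"
      unfolding blaschke_simps pderiv_mult by (simp add: pderiv_pCons algebra_simps)
    have "z * (poly (pderiv (blaschke_num (f # fs))) z * poly (blaschke_den (f # fs)) z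
         - poly (blaschke_num (f # fs)) z * poly (pderiv (blaschke_den (f # fs))) z)
      = z * ((?N + (z - f) * ?N') * ((1 - cnj f * z) * ?D) - (z - f) * ?N * (- cnj f * ?D + (1 - cnj f * z) * ?D'))"
      unfolding dN dD poly_blaschke_Cons ..
    also have "\<dots> = z * ((1 - cnj f * z) + (z - f) * cnj f) * (?N * ?D)
        + (z - f) * (1 - cnj f * z) * (z * (?N' * ?D - ?N * ?D'))"
      by (simp add: algebra_simps)
    also have "\<dots> = ((z - f) * ?N) * ((1 - cnj f * z) * ?D) * (complex_of_real T + complex_of_real S)"
      unfolding key S(1) by (simp add: algebra_simps)
    also have "\<dots> = poly (blaschke_num (f # fs)) z * poly (blaschke_den (f # fs)) z * complex_of_real (T + S)"
      unfolding poly_blaschke_Cons by simp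
    finally show ?case using T S zf rf unfolding poly_blaschke_Cons
      by (intro exI[of _ "T + S"] conjI) (auto simp del: blaschke_simps)
  qed
  then show thesis using that by blast
qed

lemma degree_blaschke_num: "degree (blaschke_num fs) = length fs" "lead_coeff (blaschke_num fs) = 1"
proof -
  have "degree (blaschke_num fs) = length fs \<and> lead_coeff (blaschke_num fs) = 1"
  proof (induction fs)
    case (Cons f fs)
    then have "blaschke_num fs \<noteq> 0" by auto
    then have "degree ([:- f, 1:] * blaschke_num fs) = 1 + length fs"
      using Cons by (subst degree_mult_eq) auto
    moreover have "lead_coeff ([:- f, 1:] * blaschke_num fs) = 1"
      using Cons by (subst lead_coeff_mult) auto
    ultimately show ?case by simp
  qed simp
  then show "degree (blaschke_num fs) = length fs" "lead_coeff (blaschke_num fs) = 1" by auto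
qed

lemma degree_blaschke_den: "degree (blaschke_den fs) \<le> length fs"
proof (induction fs)
  case (Cons f fs)
  have "degree ([:1, - cnj f:] * blaschke_den fs) \<le> degree [:1, - cnj f:] + degree (blaschke_den fs)"
    by (rule degree_mult_le)
  also have "\<dots> \<le> 1 + length fs" using Cons by (intro add_mono) auto
  finally show ?case by simp
qed simp

text \<open>For \<open>|z| < 1\<close> the Blaschke product has modulus less than one and for \<open>|z| > 1\<close> more than one, so its fibres over the
circle lie on the circle. They are simple because the logarithmic derivative does not vanish. The zero at the
origin keeps the degree of the denominator below that of the numerator, so the polynomial is monic.\<close>

lemma blaschke_fibre:
  fixes fs :: "complex list" and c :: complex
  assumes fs: "\<And>f. f \<in> set fs \<Longrightarrow> norm f < 1" and c: "norm c = 1"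
  defines "R \<equiv> blaschke_num (0 # fs) - smult c (blaschke_den (0 # fs))"
  shows "finite {z. poly R z = 0}" "card {z. poly R z = 0} = Suc (length fs)"
    "\<And>z. poly R z = 0 \<Longrightarrow> norm z = 1" "R = (\<Prod>z\<in>{z. poly R z = 0}. [:- z, 1:])"
proof -
  let ?gs = "0 # fs"
  have gs: "norm f < 1" if "f \<in> set ?gs" for f using fs that by auto
  have Rz: "poly R z = poly (blaschke_num ?gs) z - c * poly (blaschke_den ?gs) z" for z
    by (simp add: R_def)
  show unit: "norm z = 1" if "poly R z = 0" for z
  proof -
    have "norm (poly (blaschke_num ?gs) z) = norm (poly (blaschke_den ?gs) z)"
      using that c unfolding Rz by (metis eq_iff_diff_eq_0 mult_1 norm_mult)
    then show ?thesis using blaschke_inside[OF gs, of ?gs z] blaschke_outside[OF gs, of ?gs z]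
      by (cases "norm z" "1 :: real" rule: linorder_cases) auto
  qed
  have deg: "degree (smult c (blaschke_den ?gs)) < degree (blaschke_num ?gs)"
  proof -
    have "degree (smult c (blaschke_den ?gs)) \<le> length fs"
      using degree_smult_le[of c "blaschke_den ?gs"] degree_blaschke_den[of fs] by simp
    then show ?thesis using degree_blaschke_num(1)[of ?gs] by simp
  qed
  have dR: "degree R = Suc (length fs)"
  proof -
    have "degree (blaschke_num ?gs + - smult c (blaschke_den ?gs)) = degree (blaschke_num ?gs)"
      using deg by (intro degree_add_eq_left) (simp del: blaschke_simps)
    then show ?thesis using degree_blaschke_num(1)[of ?gs] by (simp add: R_def del: blaschke_simps)
  qed
  have lR: "lead_coeff R = 1"
  proof -
    have "lead_coeff R = coeff (blaschke_num ?gs) (Suc (length fs)) - coeff (smult c (blaschke_den ?gs)) (Suc (length fs))"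
      unfolding dR unfolding R_def by (rule coeff_diff)
    also have "coeff (smult c (blaschke_den ?gs)) (Suc (length fs)) = 0"
      using deg degree_blaschke_num(1)[of ?gs] by (intro coeff_eq_0) simp
    also have "coeff (blaschke_num ?gs) (Suc (length fs)) = 1"
      using degree_blaschke_num[of ?gs] by (metis length_Cons)
    finally show ?thesis by simp
  qed
  from lR have "R \<noteq> 0" by auto
  then show "finite {z. poly R z = 0}" by (rule poly_roots_finite)
  have sqf: "rsquarefree R"
    unfolding rsquarefree_roots
  proof (intro allI notI)
    fix z assume z: "poly R z = 0 \<and> poly (pderiv R) z = 0"
    then have u: "norm z = 1" using unit by blast
    obtain S where S: "z * (poly (pderiv (blaschke_num ?gs)) z * poly (blaschke_den ?gs) z
         - poly (blaschke_num ?gs) z * poly (pderiv (blaschke_den ?gs)) z)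
       = poly (blaschke_num ?gs) z * poly (blaschke_den ?gs) z * complex_of_real S" "0 < S"
       "poly (blaschke_num ?gs) z \<noteq> 0" "poly (blaschke_den ?gs) z \<noteq> 0"
      using blaschke_log_derivative[OF gs u, of ?gs] by (metis list.discI)
    have "poly (blaschke_num ?gs) z = c * poly (blaschke_den ?gs) z"
      using z Rz by simp
    moreover have "poly (pderiv (blaschke_num ?gs)) z = c * poly (pderiv (blaschke_den ?gs)) z"
      using z by (simp add: R_def pderiv_diff pderiv_smult del: blaschke_simps)
    ultimately have "poly (pderiv (blaschke_num ?gs)) z * poly (blaschke_den ?gs) z
         - poly (blaschke_num ?gs) z * poly (pderiv (blaschke_den ?gs)) z = 0"
      by (simp only: mult_ac diff_self)
    then show False using S by (simp del: blaschke_simps)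
  qed
  show fac: "R = (\<Prod>z\<in>{z. poly R z = 0}. [:- z, 1:])"
    using complex_poly_decompose_rsquarefree[OF sqf] lR by simp
  have "degree (\<Prod>z\<in>{z. poly R z = 0}. [:- z, 1:]) = card {z. poly R z = 0}"
    by (subst degree_prod_eq_sum_degree) auto
  then show "card {z. poly R z = 0} = Suc (length fs)" using fac dR by simp
qed

section \<open>Vertex polynomials\<close>

lemma coeff_conj_reversal:
  "coeff (conj_reversal n p) k = (if k \<le> n then cnj (coeff p (n - k)) else 0)"
proof -
  have "coeff (conj_reversal n p) k = (\<Sum>i\<le>n. if n - i = k then cnj (coeff p i) else 0)"
    by (simp add: conj_reversal_def coeff_sum)
  also have "\<dots> = (\<Sum>i\<le>n. if i = n - k \<and> k \<le> n then cnj (coeff p i) else 0)"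
    by (intro sum.cong) auto
  also have "\<dots> = (if k \<le> n then cnj (coeff p (n - k)) else 0)" by auto
  finally show ?thesis .
qed

text \<open>Reversal is multiplicative when the degrees add up, and turns \<open>z - f\<close> into \<open>1 - cnj f z\<close>.\<close>

lemma conj_reversal_blaschke: "conj_reversal (length fs) (blaschke_num fs) = blaschke_den fs"
proof (induction fs)
  case Nil
  show ?case by (rule poly_eqI) (simp add: coeff_conj_reversal)
next
  case (Cons f fs)
  have 0: "coeff (blaschke_num fs) (Suc (length fs)) = 0"
    by (rule coeff_eq_0) (simp add: degree_blaschke_num)
  have "conj_reversal (length (f # fs)) (blaschke_num (f # fs))
      = [:1, - cnj f:] * conj_reversal (length fs) (blaschke_num fs)"
  proof (rule poly_eqI)
    fix k
    show "coeff (conj_reversal (length (f # fs)) (blaschke_num (f # fs))) k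
      = coeff ([:1, - cnj f:] * conj_reversal (length fs) (blaschke_num fs)) k"
    proof (cases k)
      case (Suc j)
      show ?thesis
      proof (cases "Suc j \<le> length fs")
        case True
        then obtain l where "length fs - j = Suc l" "length fs - Suc j = l"
          by (metis Suc_diff_Suc Suc_le_eq)
        then show ?thesis using True Suc by (simp add: coeff_conj_reversal)
      qed (auto simp: Suc coeff_conj_reversal)
    qed (use 0 in \<open>simp add: coeff_conj_reversal\<close>)
  qed
  then show ?case using Cons by simp
qed

lemma poly_charpoly:
  fixes A :: "complex^'n^'n"
  shows "poly (charpoly A) z = det (mat z - A)"
  unfolding charpoly_def det_def map_matrix_def
  by (simp add: poly_sum poly_prod mat_def if_distrib if_distribR cong: if_cong)

lemma eigenvalue_iff_charpoly_root:
  fixes A :: "complex^'n^'n"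
  shows "eigenvalue A c \<longleftrightarrow> poly (charpoly A) c = 0"
  unfolding poly_charpoly det_eq_0_iff_kernel eigenvalue_def
  by (auto simp: matrix_vector_mult_diff_rdistrib)

lemma vertex_poly_blaschke:
  fixes A :: "complex^'n^'n"
  assumes "charpoly A = blaschke_num fs" "length fs = CARD('n)"
  shows "vertex_poly A lam = blaschke_num (0 # fs) - smult (cnj lam) (blaschke_den (0 # fs))"
  unfolding vertex_poly_def assms(1) assms(2)[symmetric] conj_reversal_blaschke by simp

lemma vertex_labelling_exists:
  fixes A :: "complex^'n^'n"
  assumes A: "charpoly A = blaschke_num fs" "length fs = CARD('n)"
    and fs: "\<And>f. f \<in> set fs \<Longrightarrow> norm f < 1" and lam: "norm lam = 1"
  obtains P where "vertex_labelling A lam P"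
proof -
  have c: "norm (cnj lam) = 1" using lam by simp
  note F = blaschke_fibre[OF fs c]
  obtain P where "cyclically_ordered (CARD('n) + 1) P"
      "P ` {..<CARD('n) + 1} = {z. poly (vertex_poly A lam) z = 0}"
    using cyclic_enumeration[OF F(1)[of fs] F(2)[of fs] F(3)[of fs]]
    unfolding vertex_poly_blaschke[OF A] A(2) by auto
  then show thesis using that unfolding vertex_labelling_def by blast
qed

lemma vertex_labelling_factor:
  fixes A :: "complex^'n^'n"
  assumes A: "charpoly A = blaschke_num fs" "length fs = CARD('n)"
    and fs: "\<And>f. f \<in> set fs \<Longrightarrow> norm f < 1" and lam: "norm lam = 1"
    and P: "vertex_labelling A lam P"
  shows "poly (vertex_poly A lam) z = (\<Prod>j<CARD('n) + 1. z - P j)"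
proof -
  have c: "norm (cnj lam) = 1" using lam by simp
  let ?V = "{z. poly (vertex_poly A lam) z = 0}"
  have "vertex_poly A lam = (\<Prod>v\<in>?V. [:- v, 1:])"
    using blaschke_fibre(4)[OF fs c] unfolding vertex_poly_blaschke[OF A] by blast
  then have "poly (vertex_poly A lam) z = (\<Prod>v\<in>?V. z - v)"
    by (metis (no_types, lifting) poly_prod prod.cong poly_pCons poly_0 mult_zero_right add_0_right mult_1_right uminus_add_conv_diff)
  also have "?V = P ` {..<CARD('n) + 1}" using P unfolding vertex_labelling_def by blast
  also have "(\<Prod>v\<in>P ` {..<CARD('n) + 1}. z - v) = (\<Prod>j<CARD('n) + 1. z - P j)"
    using P unfolding vertex_labelling_def
    by (subst prod.reindex[OF cyclically_ordered_inj]) auto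
  finally show ?thesis .
qed

lemma vertex_labelling_shift:
  fixes A :: "complex^'n^'n"
  assumes "vertex_labelling A lam P"
  shows "vertex_labelling A lam (\<lambda>j. P ((j + n) mod (CARD('n) + 1)))"
  using assms cyclically_ordered_shift[of "CARD('n) + 1" P n] image_shift_mod[of "CARD('n) + 1" P n]
  unfolding vertex_labelling_def by simp

section \<open>Blaschke products of degree three\<close>

text \<open>Together with \<open>cubic_den\<close> the numerator and denominator of the Blaschke product with zeros \<open>0, a, b\<close>; as plain functions they are convenient for polynomial identities.\<close>

definition cubic_num :: "complex \<Rightarrow> complex \<Rightarrow> complex \<Rightarrow> complex" where
  "cubic_num a b z = z * (z - a) * (z - b)"

definition cubic_den :: "complex \<Rightarrow> complex \<Rightarrow> complex \<Rightarrow> complex" where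
  "cubic_den a b z = (1 - cnj a * z) * (1 - cnj b * z)"

lemma cubic_den_nz: "norm a < 1 \<Longrightarrow> norm b < 1 \<Longrightarrow> norm z \<le> 1 \<Longrightarrow> cubic_den a b z \<noteq> 0"
  unfolding cubic_den_def using reflected_factor_nz[of a z] reflected_factor_nz[of b z] by simp

lemma cubic_three_roots:
  fixes p q r :: complex
  assumes d: "x \<noteq> y" "y \<noteq> z" "x \<noteq> z"
    and "x^3 + p * x^2 + q * x + r = 0" "y^3 + p * y^2 + q * y + r = 0" "z^3 + p * z^2 + q * z + r = 0"
  shows "t^3 + p * t^2 + q * t + r = (t - x) * (t - y) * (t - z)"
proof -
  have "(x - y) * (x^2 + x * y + y^2 + p * (x + y) + q) = 0"
    using assms(4,5) by algebra
  then have 1: "x^2 + x * y + y^2 + p * (x + y) + q = 0" using d by simp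
  have "(y - z) * (y^2 + y * z + z^2 + p * (y + z) + q) = 0"
    using assms(5,6) by algebra
  then have 2: "y^2 + y * z + z^2 + p * (y + z) + q = 0" using d by simp
  have "(x - z) * (x + y + z + p) = 0" using 1 2 by algebra
  then have "x + y + z + p = 0" using d by simp
  then have p: "p = - (x + y + z)" by algebra
  have q: "q = x * y + y * z + x * z" using 1 p by algebra
  have r: "r = - (x * y * z)" using assms(4) p q by algebra
  show ?thesis unfolding p q r by algebra
qed

text \<open>For fixed \<open>u\<close> the tangency condition is a quadratic equation in the other endpoint, with leading coefficient
\<open>cubic_den a b u\<close> and constant term \<open>(u - a) (u - b)\<close>. Its two roots are the other two vertices, so \<open>\<kappa>\<close>
drops out of their product, and \<open>cubic_num a b u\<close> equals \<open>cubic_den a b u\<close> times the product of all three vertices.\<close>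

lemma circumscribed_triangle_fibre:
  assumes d: "x \<noteq> y" "y \<noteq> z" "x \<noteq> z"
    and tan: "(incidence a x y) * (incidence b x y) = \<kappa> * (x * y)"
      "(incidence a y z) * (incidence b y z) = \<kappa> * (y * z)"
      "(incidence a x z) * (incidence b x z) = \<kappa> * (x * z)"
  shows "cubic_num a b t - x * y * z * cubic_den a b t = (t - x) * (t - y) * (t - z)"
proof -
  have key: "cubic_num a b u = u * v * w * cubic_den a b u"
    if "v \<noteq> w" "(incidence a u v) * (incidence b u v) = \<kappa> * (u * v)"
      "(incidence a u w) * (incidence b u w) = \<kappa> * (u * w)" for u v w
  proof -
    have "(v - w) * ((u - a) * (u - b) - v * w * ((1 - cnj a * u) * (1 - cnj b * u))) = 0"
      using that(2,3) by algebra
    then show ?thesis using that(1) by (simp add: cubic_num_def cubic_den_def mult_ac)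
  qed
  have kx: "cubic_num a b x = x * y * z * cubic_den a b x" by (rule key[OF d(2) tan(1) tan(3)])
  have ky: "cubic_num a b y = y * x * z * cubic_den a b y"
    using tan by (intro key d) (simp_all add: ac_simps)
  have kz: "cubic_num a b z = z * x * y * cubic_den a b z"
    using tan by (intro key d) (simp_all add: ac_simps)
  define p q r where "p = - (a + b) - x * y * z * (cnj a * cnj b)"
    and "q = a * b + x * y * z * (cnj a + cnj b)" and "r = - (x * y * z)"
  have expand: "cubic_num a b s - x * y * z * cubic_den a b s = s^3 + p * s^2 + q * s + r" for s
    unfolding cubic_num_def cubic_den_def p_def q_def r_def by algebra
  show ?thesis unfolding expand
    by (rule cubic_three_roots[OF d]) (use kx ky kz in \<open>simp_all add: expand[symmetric] mult_ac\<close>)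
qed

section \<open>From the envelopes to the equations\<close>

text \<open>The automorphism of the disk that exchanges \<open>0\<close> and \<open>f\<close>; it is its own inverse.\<close>

definition disk_involution :: "complex \<Rightarrow> complex \<Rightarrow> complex" where
  "disk_involution f z = (f - z) / (1 - cnj f * z)"

text \<open>Four points of the closed disk suffice; the disk is where the denominators below do not vanish.\<close>

lemma cubic_vanishes:
  fixes c0 c1 c2 c3 :: complex
  assumes "\<And>t. norm t \<le> 1 \<Longrightarrow> c0 + c1 * t + c2 * t^2 + c3 * t^3 = 0"
  shows "c0 = 0" "c1 = 0" "c2 = 0" "c3 = 0"
proof -
  show 0: "c0 = 0" using assms[of 0] by simp
  have "c1 + c2 + c3 = 0" using assms[of 1] 0 by simp
  moreover have "- c1 + c2 - c3 = 0" using assms[of "-1"] 0 by simp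
  moreover have "4 * c1 + 2 * c2 + c3 = 0"
  proof -
    have "c1 * (1/2) + c2 * (1/2)^2 + c3 * (1/2)^3 = 0" using assms[of "1/2"] 0 by simp
    then have "8 * (c1 * (1/2) + c2 * (1/2)^2 + c3 * (1/2)^3) = 0" by simp
    then show ?thesis by (simp add: power2_eq_square power3_eq_cube algebra_simps)
  qed
  ultimately show "c1 = 0" "c2 = 0" "c3 = 0" by algebra+
qed

text \<open>The order of the zeros fixes their roles: \<open>f3, f4\<close> for the pentagram curve, \<open>f5\<close> for the Brianchon point.\<close>

locale quintic =
  fixes A :: "complex^5^5" and f1 f2 f3 f4 f5 :: complex
  assumes disk: "norm f1 < 1" "norm f2 < 1" "norm f3 < 1" "norm f4 < 1" "norm f5 < 1"
    and charpoly_A: "charpoly A = blaschke_num [f1, f2, f3, f4, f5]"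
begin

lemma foci_disk: "f \<in> set [f1, f2, f3, f4, f5] \<Longrightarrow> norm f < 1"
  using disk by auto

lemma poly_vertex:
  "poly (vertex_poly A lam) t =
     cubic_num f3 f4 t * ((t - f1) * (t - f2) * (t - f5))
     - cnj lam * (cubic_den f3 f4 t * ((1 - cnj f1 * t) * (1 - cnj f2 * t) * (1 - cnj f5 * t)))"
proof -
  have "length [f1, f2, f3, f4, f5] = CARD(5)" by simp
  note V = vertex_poly_blaschke[OF charpoly_A this]
  show ?thesis
    unfolding V poly_diff poly_smult poly_blaschke_Cons by (simp add: cubic_num_def cubic_den_def mult_ac)
qed

lemma labelling_exists: "norm lam = 1 \<Longrightarrow> \<exists>P. vertex_labelling A lam P"
  using vertex_labelling_exists[OF charpoly_A _ foci_disk] by fastforce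

lemma labelling_factor:
  assumes "norm lam = 1" "vertex_labelling A lam P"
  shows "poly (vertex_poly A lam) t = (\<Prod>j<6. t - P j)"
  using vertex_labelling_factor[OF charpoly_A _ foci_disk assms] by simp

lemma labelling_unit: "vertex_labelling A lam P \<Longrightarrow> j < 6 \<Longrightarrow> norm (P j) = 1"
  unfolding vertex_labelling_def using cyclically_ordered_norm[of 6 P j] by simp

lemma labelling_inj: "vertex_labelling A lam P \<Longrightarrow> inj_on P {..<6}"
  unfolding vertex_labelling_def using cyclically_ordered_inj[of 6 P] by simp

lemma labelling_distinct: "vertex_labelling A lam P \<Longrightarrow> i < 6 \<Longrightarrow> j < 6 \<Longrightarrow> i \<noteq> j \<Longrightarrow> P i \<noteq> P j"
  using labelling_inj by (meson inj_onD lessThan_iff)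

lemma labelling_shift: "vertex_labelling A lam P \<Longrightarrow> vertex_labelling A lam (\<lambda>j. P ((j + n) mod 6))"
  using vertex_labelling_shift[of A lam P n] by simp

lemma diagonal_mem:
  "norm lam = 1 \<Longrightarrow> vertex_labelling A lam P \<Longrightarrow> j < 6 \<Longrightarrow> i = (j + k) mod 6 \<Longrightarrow>
    affine hull {P j, P i} \<in> diagonal_lines k A"
  unfolding diagonal_lines_def by fastforce

text \<open>The three diagonals \<open>P 0 P 2\<close>, \<open>P 2 P 4\<close>, \<open>P 4 P 0\<close> form a triangle circumscribed about the ellipse.\<close>

lemma pentagram_imp_fibres:
  assumes pent: "pentagram_is_ellipse_with_foci A f3 f4"
    and lam: "norm lam = 1" and P: "vertex_labelling A lam P"
  shows "cubic_num f3 f4 t - P 0 * P 2 * P 4 * cubic_den f3 f4 t = (t - P 0) * (t - P 2) * (t - P 4)"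
proof -
  obtain r where r: "dist f3 f4 < r" "diagonal_lines 2 A = tangent_lines (ellipse f3 f4 r)"
    using pent unfolding pentagram_is_ellipse_with_foci_def envelope_is_ellipse_with_foci_def
      is_ellipse_with_foci_def by blast
  define \<kappa> where "\<kappa> = complex_of_real (r\<^sup>2 - (dist f3 f4)\<^sup>2)"
  have tan: "(incidence f3 (P i) (P j)) * (incidence f4 (P i) (P j))
      = \<kappa> * (P i * P j)"
    if ij: "i < 6" "j < 6" "i \<noteq> j" "affine hull {P i, P j} \<in> diagonal_lines 2 A" for i j
  proof -
    have "\<exists>!u. u \<in> affine hull {P i, P j} \<inter> ellipse f3 f4 r"
      using ij(4) unfolding r(2) tangent_lines_def by blast
    then show ?thesis
      using ellipse_tangent_chord_iff[OF labelling_unit[OF P ij(1)] labelling_unit[OF P ij(2)]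
        labelling_distinct[OF P ij(1-3)] r(1)]
      unfolding \<kappa>_def by blast
  qed
  have "affine hull {P 0, P 2} \<in> diagonal_lines 2 A" "affine hull {P 2, P 4} \<in> diagonal_lines 2 A"
     "affine hull {P 4, P 0} \<in> diagonal_lines 2 A"
    by (rule diagonal_mem[OF lam P]; simp)+
  then show ?thesis
    using labelling_distinct[OF P]
    by (intro circumscribed_triangle_fibre[where \<kappa> = \<kappa>])
      (auto intro!: tan simp: insert_commute)
qed

lemma pentagram_imp_two_fibres:
  assumes pent: "pentagram_is_ellipse_with_foci A f3 f4"
    and lam: "norm lam = 1" and P: "vertex_labelling A lam P"
  obtains c c' where
    "\<And>t. cubic_num f3 f4 t - c * cubic_den f3 f4 t = (t - P 0) * (t - P 2) * (t - P 4)"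
    "\<And>t. cubic_num f3 f4 t - c' * cubic_den f3 f4 t = (t - P 1) * (t - P 3) * (t - P 5)"
    "\<And>t. poly (vertex_poly A lam) t
       = (cubic_num f3 f4 t - c * cubic_den f3 f4 t) * (cubic_num f3 f4 t - c' * cubic_den f3 f4 t)"
    "c \<noteq> c'"
proof -
  let ?c = "P 0 * P 2 * P 4" and ?c' = "P 1 * P 3 * P 5"
  have 1: "cubic_num f3 f4 t - ?c * cubic_den f3 f4 t = (t - P 0) * (t - P 2) * (t - P 4)" for t
    by (rule pentagram_imp_fibres[OF assms])
  have 2: "cubic_num f3 f4 t - ?c' * cubic_den f3 f4 t = (t - P 1) * (t - P 3) * (t - P 5)" for t
    using pentagram_imp_fibres[OF pent lam labelling_shift[OF P, of 1]] by simp
  have "poly (vertex_poly A lam) t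
       = (cubic_num f3 f4 t - ?c * cubic_den f3 f4 t) * (cubic_num f3 f4 t - ?c' * cubic_den f3 f4 t)" for t
    unfolding 1 2 labelling_factor[OF lam P] by (simp add: numeral_eq_Suc lessThan_Suc mult_ac)
  moreover have "?c \<noteq> ?c'"
  proof
    assume "?c = ?c'"
    then have "(P 0 - P 0) * (P 0 - P 2) * (P 0 - P 4) = (P 0 - P 1) * (P 0 - P 3) * (P 0 - P 5)"
      using 1[of "P 0"] 2[of "P 0"] by metis
    then show False using labelling_distinct[OF P, of 0] by auto
  qed
  ultimately show thesis using that 1 2 by blast
qed

text \<open>The vertex polynomial is \<open>z \<Phi> - cnj \<lambda> \<Phi>\<^sup>*\<close> and also \<open>X\<^sup>2 - s X Y - cnj \<lambda> Y\<^sup>2\<close>, where only \<open>s\<close> depends on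
\<open>\<lambda>\<close> in an unknown way. The difference of the cases \<open>\<lambda> = 1\<close> and \<open>\<lambda> = -1\<close> eliminates \<open>X\<^sup>2\<close> and yields
\<open>\<Phi>\<^sup>* = Y (Y + k X)\<close>, and cancelling \<open>Y\<close> leaves the conjugates of the two equations in its coefficients.\<close>

lemma pentagram_imp_equations:
  assumes pent: "pentagram_is_ellipse_with_foci A f3 f4"
  shows "f3 + f4 + f1 * f2 * f5 * cnj f4 * cnj f3 = f1 + f2 + f5"
    and "f3 * f4 + f1 * f2 * f5 * (cnj f4 + cnj f3) = f1 * f2 + f2 * f5 + f1 * f5"
proof -
  let ?X = "cubic_num f3 f4" and ?Y = "cubic_den f3 f4"
  have prod: "\<exists>s. \<forall>t. poly (vertex_poly A lam) t = (?X t)\<^sup>2 - s * (?X t * ?Y t) - cnj lam * (?Y t)\<^sup>2"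
    if lam: "norm lam = 1" for lam
  proof -
    obtain P where P: "vertex_labelling A lam P" using labelling_exists[OF lam] by blast
    obtain c c' where cc: "\<And>t. poly (vertex_poly A lam) t = (?X t - c * ?Y t) * (?X t - c' * ?Y t)"
      using pentagram_imp_two_fibres[OF pent lam P] by metis
    have "c * c' = - cnj lam" using cc[of 0] by (simp add: poly_vertex cubic_num_def cubic_den_def)
    then have "poly (vertex_poly A lam) t = (?X t)\<^sup>2 - (c + c') * (?X t * ?Y t) - cnj lam * (?Y t)\<^sup>2" for t
      unfolding cc by algebra
    then show ?thesis by blast
  qed
  obtain s where s: "\<And>t. poly (vertex_poly A 1) t = (?X t)\<^sup>2 - s * (?X t * ?Y t) - (?Y t)\<^sup>2"
    using prod[of 1] by auto
  obtain s' where s': "\<And>t. poly (vertex_poly A (-1)) t = (?X t)\<^sup>2 - s' * (?X t * ?Y t) + (?Y t)\<^sup>2"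
    using prod[of "-1"] by auto
  define k where "k = (s - s') / 2"
  let ?Y5 = "\<lambda>t. (1 - cnj f1 * t) * (1 - cnj f2 * t) * (1 - cnj f5 * t)"
  have Y5: "?Y5 t = ?Y t + k * ?X t" if t: "norm t \<le> 1" for t
  proof -
    have "2 * (?Y t * ?Y5 t) = poly (vertex_poly A (-1)) t - poly (vertex_poly A 1) t"
      by (simp add: poly_vertex)
    also have "\<dots> = 2 * (?Y t * (?Y t + k * ?X t))" unfolding s s' k_def by (simp add: field_simps power2_eq_square)
    finally show ?thesis using cubic_den_nz[OF disk(3,4) t] by simp
  qed
  have "0 + (- (cnj f1 + cnj f2 + cnj f5) + (cnj f3 + cnj f4) - k * (f3 * f4)) * t
     + (cnj f1 * cnj f2 + cnj f2 * cnj f5 + cnj f1 * cnj f5 - cnj f3 * cnj f4 + k * (f3 + f4)) * t^2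
     + (- (cnj f1 * cnj f2 * cnj f5) - k) * t^3 = 0" if "norm t \<le> 1" for t
    using Y5[OF that] unfolding cubic_num_def cubic_den_def by algebra
  note coeffs = cubic_vanishes(2-4)[OF this]
  have k: "k = - (cnj f1 * cnj f2 * cnj f5)" using coeffs(3) by (simp add: algebra_simps)
  have "cnj (f3 + f4 + f1 * f2 * f5 * cnj f4 * cnj f3 - (f1 + f2 + f5)) = 0"
    using coeffs(1) unfolding k by (simp add: algebra_simps)
  then show "f3 + f4 + f1 * f2 * f5 * cnj f4 * cnj f3 = f1 + f2 + f5"
    by (metis complex_cnj_zero_iff eq_iff_diff_eq_0)
  have "cnj (f3 * f4 + f1 * f2 * f5 * (cnj f4 + cnj f3) - (f1 * f2 + f2 * f5 + f1 * f5)) = 0"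
    using coeffs(2) unfolding k by (simp add: algebra_simps)
  then show "f3 * f4 + f1 * f2 * f5 * (cnj f4 + cnj f3) = f1 * f2 + f2 * f5 + f1 * f5"
    by (metis complex_cnj_zero_iff eq_iff_diff_eq_0)
qed

end

text \<open>The two equations compare the coefficients of these cubic polynomials.\<close>

lemma cubic_equations_imp:
  assumes "f3 + f4 + f1 * f2 * f5 * cnj f4 * cnj f3 = f1 + f2 + f5"
    and "f3 * f4 + f1 * f2 * f5 * (cnj f4 + cnj f3) = f1 * f2 + f2 * f5 + f1 * f5"
  shows "(t - f1) * (t - f2) * (t - f5) = cubic_num f3 f4 t - f1 * f2 * f5 * cubic_den f3 f4 t"
    and "(1 - cnj f1 * t) * (1 - cnj f2 * t) * (1 - cnj f5 * t)
      = cubic_den f3 f4 t - cnj (f1 * f2 * f5) * cubic_num f3 f4 t"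
proof -
  show "(t - f1) * (t - f2) * (t - f5) = cubic_num f3 f4 t - f1 * f2 * f5 * cubic_den f3 f4 t"
    unfolding cubic_num_def cubic_den_def using assms by algebra
  have "cnj f3 + cnj f4 + cnj f1 * cnj f2 * cnj f5 * f4 * f3 = cnj f1 + cnj f2 + cnj f5"
    using arg_cong[OF assms(1), of cnj] by simp
  moreover have "cnj f3 * cnj f4 + cnj f1 * cnj f2 * cnj f5 * (f4 + f3) = cnj f1 * cnj f2 + cnj f2 * cnj f5 + cnj f1 * cnj f5"
    using arg_cong[OF assms(2), of cnj] by simp
  ultimately show "(1 - cnj f1 * t) * (1 - cnj f2 * t) * (1 - cnj f5 * t)
      = cubic_den f3 f4 t - cnj (f1 * f2 * f5) * cubic_num f3 f4 t"
    unfolding cubic_num_def cubic_den_def complex_cnj_mult by algebra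
qed

lemma disk_involution_involutive:
  assumes "norm f < 1" "1 - cnj f * z \<noteq> 0"
  shows "disk_involution f (disk_involution f z) = z"
proof -
  have n: "1 - cnj f * f \<noteq> 0" using reflected_factor_nz[OF assms(1), of f] assms(1) by simp
  have "1 - cnj f * disk_involution f z = (1 - cnj f * f) / (1 - cnj f * z)"
    using assms(2) by (simp add: disk_involution_def field_simps)
  moreover have "f - disk_involution f z = z * (1 - cnj f * f) / (1 - cnj f * z)"
    using assms(2) by (simp add: disk_involution_def field_simps)
  ultimately show ?thesis unfolding disk_involution_def[of f "disk_involution f z"] using n assms(2) by simp
qed

text \<open>The equation of the chord is linear in \<open>w\<close>, and solving it gives the involution.\<close>

lemma chord_through_point_iff:
  assumes "norm f < 1" "norm z = 1" "norm w = 1" "z \<noteq> w"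
  shows "f \<in> affine hull {z, w} \<longleftrightarrow> w = disk_involution f z"
proof -
  have n: "1 - cnj f * z \<noteq> 0" using reflected_factor_nz assms by simp
  have "f \<in> affine hull {z, w} \<longleftrightarrow> f + z * w * cnj f = z + w"
    unfolding affine_hull_unit_chord[OF assms(2-4)] by simp
  also have "\<dots> \<longleftrightarrow> w * (1 - cnj f * z) = f - z" by (auto simp: algebra_simps)
  also have "\<dots> \<longleftrightarrow> w = disk_involution f z" using n by (simp add: disk_involution_def eq_divide_eq)
  finally show ?thesis .
qed

text \<open>The involution permutes linear factors up to constants once the denominator \<open>1 - cnj f t\<close> is cleared.\<close>

lemma product_after_involution:
  assumes "1 - cnj f * x \<noteq> 0" "1 - cnj f * y \<noteq> 0" "1 - cnj f * z \<noteq> 0" "1 - cnj f * t \<noteq> 0"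
  shows "(disk_involution f t - x) * (disk_involution f t - y) * (disk_involution f t - z) * (1 - cnj f * t)^3
    = - ((1 - cnj f * x) * (1 - cnj f * y) * (1 - cnj f * z))
      * ((t - disk_involution f x) * (t - disk_involution f y) * (t - disk_involution f z))"
proof -
  have 1: "(disk_involution f t - u) * (1 - cnj f * t) = - (1 - cnj f * u) * (t - disk_involution f u)"
    if "1 - cnj f * u \<noteq> 0" for u
  proof -
    have "disk_involution f t * (1 - cnj f * t) = f - t" "disk_involution f u * (1 - cnj f * u) = f - u"
      using assms(4) that by (simp_all add: disk_involution_def)
    then show ?thesis by algebra
  qed
  have "(disk_involution f t - x) * (disk_involution f t - y) * (disk_involution f t - z) * (1 - cnj f * t)^3
    = ((disk_involution f t - x) * (1 - cnj f * t)) * ((disk_involution f t - y) * (1 - cnj f * t))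
      * ((disk_involution f t - z) * (1 - cnj f * t))"
    by (simp add: power3_eq_cube mult_ac)
  then show ?thesis unfolding 1[OF assms(1)] 1[OF assms(2)] 1[OF assms(3)] by algebra
qed

lemma monic_quadratic_roots:
  fixes p q x y :: complex
  assumes "p + q = x + y" "p * q = x * y"
  shows "(x = p \<and> y = q) \<or> (x = q \<and> y = p)"
proof -
  have "(x - p) * (x - q) = 0" using assms by algebra
  then show ?thesis using assms(1) by auto
qed

lemma cubic_num_after_involution:
  assumes "norm f < 1" "norm a < 1" "norm b < 1" "norm t \<le> 1"
  shows "cubic_num a b (disk_involution f t) * (1 - cnj f * t)^3
    = - ((1 - cnj f * a) * (1 - cnj f * b))
      * ((t - f) * (t - disk_involution f a) * (t - disk_involution f b))"
proof -
  have "disk_involution f 0 = f" by (simp add: disk_involution_def)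
  then show ?thesis
    using product_after_involution[of f 0 a b t] reflected_factor_nz[OF assms(1)] assms
    by (simp add: cubic_num_def)
qed

context quintic
begin

text \<open>The involution exchanges the two triangles of a hexagon. So, after clearing denominators, \<open>X \<circ> \<tau>\<close> and
\<open>Y \<circ> \<tau>\<close> are combinations of \<open>X\<close> and \<open>Y\<close>, and \<open>X \<circ> \<tau>\<close> vanishes at \<open>f5\<close>. Up to a factor the only such
combination is \<open>X - m Y\<close>, the polynomial with the zeros \<open>f1, f2, f5\<close>. Comparing zeros gives the claim.\<close>

lemma forward_foci:
  assumes pent: "pentagram_is_ellipse_with_foci A f3 f4" and bri: "brianchon_is_point A f5"
  shows "{f3, f4} = {(f5 - f2) / (1 - f2 * cnj f5), (f5 - f1) / (1 - f1 * cnj f5)}"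
proof -
  let ?X = "cubic_num f3 f4" and ?Y = "cubic_den f3 f4" and ?\<tau> = "disk_involution f5"
  have one: "norm (1 :: complex) = 1" by simp
  obtain P where P: "vertex_labelling A 1 P" using labelling_exists[OF one] by blast
  obtain c c' where c: "\<And>t. ?X t - c * ?Y t = (t - P 0) * (t - P 2) * (t - P 4)"
    and c': "\<And>t. ?X t - c' * ?Y t = (t - P 1) * (t - P 3) * (t - P 5)" and cc: "c \<noteq> c'"
    using pentagram_imp_two_fibres[OF pent one P] by metis
  have opp: "?\<tau> (P j) = P i" if "j < 6" "i = (j + 3) mod 6" for i j
  proof -
    have "i < 6" "i \<noteq> j" using that by auto presburger
    moreover have "f5 \<in> affine hull {P j, P i}"
      using bri diagonal_mem[OF one P that] unfolding brianchon_is_point_def envelope_is_point_def by blast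
    ultimately show ?thesis
      using chord_through_point_iff[of f5 "P j" "P i"] disk(5) labelling_unit[OF P] labelling_distinct[OF P] that(1)
      by metis
  qed
  have nz: "1 - cnj f5 * t \<noteq> 0" if "norm t \<le> 1" for t using reflected_factor_nz disk(5) that by blast
  have nzP: "1 - cnj f5 * P j \<noteq> 0" if "j < 6" for j using nz labelling_unit[OF P that] by simp
  define k where "k = - ((1 - cnj f5 * P 0) * (1 - cnj f5 * P 2) * (1 - cnj f5 * P 4))"
  define k' where "k' = - ((1 - cnj f5 * P 1) * (1 - cnj f5 * P 3) * (1 - cnj f5 * P 5))"
  \<comment> \<open>the involution exchanges the two triangles\<close>
  have h: "(?X (?\<tau> t) - c * ?Y (?\<tau> t)) * (1 - cnj f5 * t)^3 = k * (?X t - c' * ?Y t)" if "norm t \<le> 1" for t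
    using product_after_involution[OF nzP[of 0] nzP[of 2] nzP[of 4] nz[OF that]]
      opp[of 0 3] opp[of 2 5] opp[of 4 1]
    unfolding c c' k_def by (simp add: mult_ac)
  have h': "(?X (?\<tau> t) - c' * ?Y (?\<tau> t)) * (1 - cnj f5 * t)^3 = k' * (?X t - c * ?Y t)" if "norm t \<le> 1" for t
    using product_after_involution[OF nzP[of 1] nzP[of 3] nzP[of 5] nz[OF that]]
      opp[of 1 4] opp[of 3 0] opp[of 5 2]
    unfolding c c' k'_def by (simp add: mult_ac)
  define \<alpha> \<beta> where "\<alpha> = (c' * k - c * k') / (c' - c)" and "\<beta> = (c * c * k' - c' * c' * k) / (c' - c)"
  have span: "?X (?\<tau> t) * (1 - cnj f5 * t)^3 = \<alpha> * ?X t + \<beta> * ?Y t" if "norm t \<le> 1" for t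
  proof -
    have "(c' - c) * (?X (?\<tau> t) * (1 - cnj f5 * t)^3) = (c' * k - c * k') * ?X t + (c * c * k' - c' * c' * k) * ?Y t"
      using h[OF that] h'[OF that] by algebra
    moreover have "(c' - c) * \<alpha> = c' * k - c * k'" "(c' - c) * \<beta> = c * c * k' - c' * c' * k"
      using cc by (simp_all add: \<alpha>_def \<beta>_def)
    ultimately have "(c' - c) * (?X (?\<tau> t) * (1 - cnj f5 * t)^3) = (c' - c) * (\<alpha> * ?X t + \<beta> * ?Y t)"
      by algebra
    then show ?thesis using cc by simp
  qed
  note eqs = pentagram_imp_equations[OF pent]
  note X5 = cubic_equations_imp(1)[OF eqs]
  have "\<beta> = - \<alpha> * (f1 * f2 * f5)"
  proof -
    have "?\<tau> f5 = 0" by (simp add: disk_involution_def)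
    then have "\<alpha> * ?X f5 + \<beta> * ?Y f5 = 0" using span[of f5] disk(5) by (simp add: cubic_num_def)
    moreover have "?X f5 = f1 * f2 * f5 * ?Y f5" using X5[of f5] by simp
    ultimately have "?Y f5 * (\<alpha> * (f1 * f2 * f5) + \<beta>) = 0" by algebra
    then show ?thesis using cubic_den_nz[of f3 f4 f5] disk by (simp add: eq_neg_iff_add_eq_0 add.commute)
  qed
  then have hat: "?X (?\<tau> t) * (1 - cnj f5 * t)^3 = \<alpha> * ((t - f1) * (t - f2) * (t - f5))" if "norm t \<le> 1" for t
    unfolding span[OF that] X5 by algebra
  define \<kappa> where "\<kappa> = - ((1 - cnj f5 * f3) * (1 - cnj f5 * f4))"
  have \<kappa>: "\<kappa> \<noteq> 0" using nz[of f3] nz[of f4] disk by (simp add: \<kappa>_def)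
  define p q where "p = ?\<tau> f3" and "q = ?\<tau> f4"
  have quot: "\<kappa> * ((t - f5) * (t - p) * (t - q)) = \<alpha> * ((t - f1) * (t - f2) * (t - f5))" if "norm t \<le> 1" for t
    using hat[OF that] cubic_num_after_involution[OF disk(5,3,4) that] by (simp add: \<kappa>_def p_def q_def)
  have "(\<alpha> * (f1 * f2 * f5) - \<kappa> * (f5 * p * q))
      + (\<kappa> * (f5 * p + f5 * q + p * q) - \<alpha> * (f5 * f1 + f5 * f2 + f1 * f2)) * t
      + (\<alpha> * (f1 + f2 + f5) - \<kappa> * (f5 + p + q)) * t^2
      + (\<kappa> - \<alpha>) * t^3 = 0" if "norm t \<le> 1" for t
    using quot[OF that] by algebra
  note co = cubic_vanishes[OF this]
  have \<alpha>: "\<alpha> = \<kappa>" using co(4) by simp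
  have "\<kappa> * (f1 + f2 - (p + q)) = 0" using co(3) unfolding \<alpha> by algebra
  then have s: "p + q = f1 + f2" using \<kappa> by simp
  have "\<kappa> * (p * q - f1 * f2) = 0" using co(2) s unfolding \<alpha> by algebra
  then have "p * q = f1 * f2" using \<kappa> by simp
  with s have "(f1 = p \<and> f2 = q) \<or> (f1 = q \<and> f2 = p)" by (rule monic_quadratic_roots)
  moreover have "?\<tau> p = f3" "?\<tau> q = f4"
    unfolding p_def q_def using disk nz by (auto intro!: disk_involution_involutive)
  ultimately have "{f3, f4} = {?\<tau> f2, ?\<tau> f1}" by auto
  then show ?thesis by (simp add: disk_involution_def mult.commute)
qed

end

section \<open>Fibres and inscribed ellipses in degree three\<close>

lemma norm_reflected_unit: "norm z = 1 \<Longrightarrow> norm (1 - cnj f * z) = norm (z - f)"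
  using norm_reflected_diff[of f z] by (simp add: power2_eq_iff_nonneg)

lemma cubic_unit: "norm z = 1 \<Longrightarrow> norm (cubic_num a b z) = norm (cubic_den a b z)"
  by (simp add: cubic_num_def cubic_den_def norm_mult norm_reflected_unit)

lemma cubic_den_after_involution:
  assumes "norm f < 1" "norm a < 1" "norm b < 1" "norm t \<le> 1"
  shows "cubic_den a b (disk_involution f t) * (1 - cnj f * t)^3
    = (1 - cnj a * f) * (1 - cnj b * f)
      * ((1 - cnj (disk_involution f a) * t) * (1 - cnj (disk_involution f b) * t) * (1 - cnj f * t))"
proof -
  have d: "1 - cnj f * t \<noteq> 0" using reflected_factor_nz assms by blast
  have 1: "(1 - cnj u * disk_involution f t) * (1 - cnj f * t)
      = (1 - cnj u * f) * (1 - cnj (disk_involution f u) * t)" if "norm u < 1" for u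
  proof -
    have "1 - cnj u * f \<noteq> 0" using reflected_factor_nz that assms by simp
    then have "cnj (disk_involution f u) * (1 - cnj u * f) = cnj f - cnj u"
      by (simp add: disk_involution_def mult.commute)
    moreover have "disk_involution f t * (1 - cnj f * t) = f - t"
      using d by (simp add: disk_involution_def)
    ultimately show ?thesis by algebra
  qed
  have "cubic_den a b (disk_involution f t) * (1 - cnj f * t)^3
     = ((1 - cnj a * disk_involution f t) * (1 - cnj f * t))
     * ((1 - cnj b * disk_involution f t) * (1 - cnj f * t)) * (1 - cnj f * t)"
    unfolding cubic_den_def by algebra
  then show ?thesis unfolding 1[OF assms(2)] 1[OF assms(3)] by algebra
qed

lemma disk_involution_unit:
  assumes "norm f < 1" "norm z = 1" shows "norm (disk_involution f z) = 1" "disk_involution f z \<noteq> z"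
proof -
  have n: "1 - cnj f * z \<noteq> 0" using reflected_factor_nz assms by simp
  show "norm (disk_involution f z) = 1"
  proof -
    have "z - f \<noteq> 0" using assms by auto
    then show ?thesis
      using assms(2) by (simp add: disk_involution_def norm_divide norm_reflected_unit norm_minus_commute[of f z])
  qed
  show "disk_involution f z \<noteq> z"
  proof
    assume "disk_involution f z = z"
    then have "2 * z = f + cnj f * z * z" using n by (simp add: disk_involution_def field_simps)
    then have "norm (2 * z) \<le> norm f + norm (cnj f * z * z)" by (metis norm_triangle_ineq)
    then show False using assms by (simp add: norm_mult)
  qed
qed

text \<open>The factor \<open>S\<close> is the positive logarithmic derivative at \<open>x\<close>: by the fibre equation the left-hand side is the
derivative at \<open>x\<close> of \<open>cubic_num a b - c cubic_den a b\<close>.\<close>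

lemma cubic_fibre_residue:
  assumes a: "norm a < 1" and b: "norm b < 1"
    and x: "norm x = 1" and d: "x \<noteq> y" "y \<noteq> z" "x \<noteq> z"
    and fib: "cubic_num a b x = c * cubic_den a b x" "cubic_num a b y = c * cubic_den a b y"
      "cubic_num a b z = c * cubic_den a b z"
  obtains S :: real where "0 < S" "(x - y) * (x - z) = (x - a) * (x - b) * complex_of_real S"
proof -
  have ab: "norm f < 1" if "f \<in> set [0, a, b]" for f using that a b by auto
  obtain S :: real where S: "x * (poly (pderiv (blaschke_num [0, a, b])) x * poly (blaschke_den [0, a, b]) x
       - poly (blaschke_num [0, a, b]) x * poly (pderiv (blaschke_den [0, a, b])) x)
     = poly (blaschke_num [0, a, b]) x * poly (blaschke_den [0, a, b]) x * complex_of_real S" "0 < S"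
    using blaschke_log_derivative[OF ab x] by (metis list.discI)
  have N: "poly (blaschke_num [0, a, b]) x = cubic_num a b x"
    by (simp only: poly_blaschke_Cons cubic_num_def blaschke_simps(1) poly_1 diff_zero mult_1_right mult.assoc)
  have D: "poly (blaschke_den [0, a, b]) x = cubic_den a b x"
    by (simp only: poly_blaschke_Cons cubic_den_def blaschke_simps(3) poly_1 complex_cnj_zero mult_zero_left
        diff_zero mult_1_right mult_1_left)
  have N': "poly (pderiv (blaschke_num [0, a, b])) x = (x - a) * (x - b) + x * (x - b) + x * (x - a)"
    by (simp add: pderiv_mult pderiv_pCons algebra_simps)
  have D': "poly (pderiv (blaschke_den [0, a, b])) x = - cnj a * (1 - cnj b * x) - cnj b * (1 - cnj a * x)"
    by (simp add: pderiv_mult pderiv_pCons algebra_simps)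
  define p q r where "p = - (a + b) - c * (cnj a * cnj b)" and "q = a * b + c * (cnj a + cnj b)" and "r = - c"
  have expand: "cubic_num a b s - c * cubic_den a b s = s^3 + p * s^2 + q * s + r" for s
    unfolding cubic_num_def cubic_den_def p_def q_def r_def by algebra
  have fac: "t^3 + p * t^2 + q * t + r = (t - x) * (t - y) * (t - z)" for t
    by (rule cubic_three_roots[OF d]) (use fib in \<open>simp_all add: expand[symmetric]\<close>)
  have r: "r = - (x * y * z)" using fac[of 0] by simp
  have "1 + p + q + r = (1 - x) * (1 - y) * (1 - z)" "- 1 + p - q + r = (- 1 - x) * (- 1 - y) * (- 1 - z)"
    using fac[of 1] fac[of "-1"] by simp_all
  then have pq: "p = - (x + y + z)" "q = x * y + y * z + x * z" using r by algebra+
  have deriv: "(x - a) * (x - b) + x * (x - b) + x * (x - a) - c * (- cnj a * (1 - cnj b * x) - cnj b * (1 - cnj a * x))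
     = (x - y) * (x - z)"
  proof -
    have "(x - a) * (x - b) + x * (x - b) + x * (x - a) - c * (- cnj a * (1 - cnj b * x) - cnj b * (1 - cnj a * x))
      = 3 * x^2 + 2 * p * x + q"
      unfolding p_def q_def by algebra
    then show ?thesis unfolding pq by algebra
  qed
  have Dnz: "cubic_den a b x \<noteq> 0" using cubic_den_nz a b x by simp
  have xnz: "x \<noteq> 0" using x by auto
  have "x * cubic_den a b x * ((x - y) * (x - z)) = cubic_num a b x * cubic_den a b x * complex_of_real S"
    unfolding deriv[symmetric] using S(1) unfolding N D N' D' fib(1) by algebra
  then have "(x * cubic_den a b x) * ((x - y) * (x - z)) = (x * cubic_den a b x) * ((x - a) * (x - b) * complex_of_real S)"
    unfolding cubic_num_def by algebra
  then have "(x - y) * (x - z) = (x - a) * (x - b) * complex_of_real S" using Dnz xnz by simp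
  then show thesis using that S(2) by blast
qed

text \<open>The zero \<open>a\<close> is a convex combination of the points of each fibre. With \<open>S\<close> from the previous lemma,
\<open>1 / (S (x - a)) = (x - b) / ((x - y) (x - z))\<close>, and the sum over the three points is a second divided difference
of a linear function. Conjugating the resulting relation gives positive weights.\<close>

lemma cubic_fibre_surrounds_zero:
  assumes a: "norm a < 1" and b: "norm b < 1"
    and unit: "norm x = 1" "norm y = 1" "norm z = 1" and d: "x \<noteq> y" "y \<noteq> z" "x \<noteq> z"
    and fib: "cubic_num a b x = c * cubic_den a b x" "cubic_num a b y = c * cubic_den a b y"
      "cubic_num a b z = c * cubic_den a b z"
  obtains u v w :: real where "0 < u" "0 < v" "0 < w"
    "u *\<^sub>R (x - a) + v *\<^sub>R (y - a) + w *\<^sub>R (z - a) = 0"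
proof -
  obtain S1 where S1: "0 < S1" "(x - y) * (x - z) = (x - a) * (x - b) * complex_of_real S1"
    using cubic_fibre_residue[OF a b unit(1) d fib] .
  obtain S2 where S2: "0 < S2" "(y - z) * (y - x) = (y - a) * (y - b) * complex_of_real S2"
    using cubic_fibre_residue[OF a b unit(2), of z x] d fib by metis
  obtain S3 where S3: "0 < S3" "(z - x) * (z - y) = (z - a) * (z - b) * complex_of_real S3"
    using cubic_fibre_residue[OF a b unit(3), of x y] d fib by metis
  have nz: "x - a \<noteq> 0" "y - a \<noteq> 0" "z - a \<noteq> 0" "x - b \<noteq> 0" "y - b \<noteq> 0" "z - b \<noteq> 0"
    using a b unit by auto
  have inv: "inverse (complex_of_real S) / (s - a) = (s - b) / ((s - t) * (s - t'))"
    if "0 < S" "(s - t) * (s - t') = (s - a) * (s - b) * complex_of_real S" "s - b \<noteq> 0" for S s t t'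
  proof -
    have "(s - a) * (s - b) * complex_of_real S = (s - b) * ((s - a) * complex_of_real S)" by simp
    then show ?thesis unfolding that(2) using that(3) by (simp add: divide_inverse)
  qed
  \<comment> \<open>the second divided difference of the linear function \<open>s - b\<close> vanishes\<close>
  have "(x - b) / ((x - y) * (x - z)) + (y - b) / ((y - z) * (y - x)) + (z - b) / ((z - x) * (z - y)) = 0"
  proof -
    have n: "x - y \<noteq> 0" "y - z \<noteq> 0" "x - z \<noteq> 0" using d by auto
    define q where "q = (x - y) * (x - z) * (y - z)"
    have nz: "q \<noteq> 0" "(x - y) * (x - z) \<noteq> 0" "(y - z) * (y - x) \<noteq> 0" "(z - x) * (z - y) \<noteq> 0"
      using n by (auto simp: q_def)
    have "(x - b) / ((x - y) * (x - z)) = (x - b) * (y - z) / q"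
      unfolding frac_eq_eq[OF nz(2,1)] unfolding q_def by algebra
    moreover have "(y - b) / ((y - z) * (y - x)) = - (y - b) * (x - z) / q"
      unfolding frac_eq_eq[OF nz(3,1)] unfolding q_def by algebra
    moreover have "(z - b) / ((z - x) * (z - y)) = (z - b) * (x - y) / q"
      unfolding frac_eq_eq[OF nz(4,1)] unfolding q_def by algebra
    moreover have "(x - b) * (y - z) + - (y - b) * (x - z) + (z - b) * (x - y) = 0" by algebra
    ultimately show ?thesis by (simp only: add_divide_distrib[symmetric]) simp
  qed
  then have "inverse (complex_of_real S1) / (x - a) + inverse (complex_of_real S2) / (y - a)
      + inverse (complex_of_real S3) / (z - a) = 0"
    unfolding inv[OF S1 nz(4)] inv[OF S2 nz(5)] inv[OF S3 nz(6)] .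
  then have "cnj (inverse (complex_of_real S1) / (x - a) + inverse (complex_of_real S2) / (y - a)
      + inverse (complex_of_real S3) / (z - a)) = 0" by simp
  moreover have "cnj (inverse (complex_of_real S) / s) = (inverse S / (norm s)\<^sup>2) *\<^sub>R s" for S s
  proof (cases "s = 0")
    case False
    then have "inverse (cnj s) = s / complex_of_real ((norm s)\<^sup>2)"
      unfolding complex_norm_square by (simp add: field_simps)
    then show ?thesis by (simp add: divide_inverse scaleR_conv_of_real mult_ac)
  qed simp
  ultimately have "(inverse S1 / (norm (x - a))\<^sup>2) *\<^sub>R (x - a) + (inverse S2 / (norm (y - a))\<^sup>2) *\<^sub>R (y - a)
     + (inverse S3 / (norm (z - a))\<^sup>2) *\<^sub>R (z - a) = 0" by (simp only: complex_cnj_add)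
  then show thesis using S1(1) S2(1) S3(1) nz
    by (intro that[of "inverse S1 / (norm (x - a))\<^sup>2" "inverse S2 / (norm (y - a))\<^sup>2" "inverse S3 / (norm (z - a))\<^sup>2"])
      auto
qed

lemma orient_diff: "orient p q x - orient p q y = Im (cnj (q - p) * (x - y))"
  by (simp add: orient_def algebra_simps)

lemma orient_barycentric:
  assumes "u *\<^sub>R (x - a) + v *\<^sub>R (y - a) + w *\<^sub>R (z - a) = 0"
  shows "(u + v + w) * orient p q a = u * orient p q x + v * orient p q y + w * orient p q z"
proof -
  have "0 = Im (cnj (q - p) * (u *\<^sub>R (x - a) + v *\<^sub>R (y - a) + w *\<^sub>R (z - a)))"
    unfolding assms by simp
  also have "\<dots> = u * (orient p q x - orient p q a) + v * (orient p q y - orient p q a) + w * (orient p q z - orient p q a)"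
    unfolding orient_diff by (simp add: algebra_simps)
  finally show ?thesis by (simp add: algebra_simps)
qed

text \<open>Two points lie in the same fibre iff their chord satisfies the tangency condition of an ellipse with foci
\<open>a, b\<close> and squared minor axis \<open>(1 - |a|\<^sup>2) (1 - |b|\<^sup>2)\<close>.\<close>

lemma cubic_fibre_chord_identity:
  "cubic_num a b z * cubic_den a b w - cubic_num a b w * cubic_den a b z
   = (z - w) * ((incidence a z w) * (incidence b z w)
       - (1 - a * cnj a) * (1 - b * cnj b) * (z * w))"
  unfolding cubic_num_def cubic_den_def by algebra

text \<open>The major axis \<open>norm (1 - cnj a * b)\<close> belongs to the minor axis in \<open>cubic_fibre_chord_identity\<close>.\<close>

lemma inellipse_axis:
  assumes "norm a < 1" "norm b < 1"
  shows "dist a b < norm (1 - cnj a * b)"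
    and "complex_of_real ((norm (1 - cnj a * b))\<^sup>2 - (dist a b)\<^sup>2) = (1 - a * cnj a) * (1 - b * cnj b)"
proof -
  have e: "(norm (1 - cnj a * b))\<^sup>2 - (dist a b)\<^sup>2 = (1 - (norm a)\<^sup>2) * (1 - (norm b)\<^sup>2)"
    using norm_reflected_diff[of a b] by (simp add: dist_norm norm_minus_commute)
  also have "\<dots> > 0" using assms by (intro mult_pos_pos) (auto simp: abs_square_less_1)
  finally have "(dist a b)\<^sup>2 < (norm (1 - cnj a * b))\<^sup>2" by simp
  then show "dist a b < norm (1 - cnj a * b)" by (rule power2_less_imp_less) simp
  show "complex_of_real ((norm (1 - cnj a * b))\<^sup>2 - (dist a b)\<^sup>2) = (1 - a * cnj a) * (1 - b * cnj b)"
    unfolding e by (simp add: complex_norm_square[symmetric])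
qed

lemma inellipse_tangent_iff:
  assumes "norm a < 1" "norm b < 1" "norm z = 1" "norm w = 1" "z \<noteq> w"
  shows "(\<exists>!u. u \<in> affine hull {z, w} \<inter> ellipse a b (norm (1 - cnj a * b)))
    \<longleftrightarrow> cubic_num a b z * cubic_den a b w = cubic_num a b w * cubic_den a b z"
proof -
  have "cubic_num a b z * cubic_den a b w = cubic_num a b w * cubic_den a b z \<longleftrightarrow>
     (incidence a z w) * (incidence b z w) = (1 - a * cnj a) * (1 - b * cnj b) * (z * w)"
    using cubic_fibre_chord_identity[of a b z w] assms(5)
    by (metis eq_iff_diff_eq_0 mult_eq_0_iff)
  then show ?thesis
    unfolding ellipse_tangent_chord_iff[OF assms(3-5) inellipse_axis(1)[OF assms(1,2)]]
      inellipse_axis(2)[OF assms(1,2)] by blast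
qed

text \<open>Every tangent of the ellipse is therefore a chord of the circle. For \<open>norm u \<ge> 1\<close> the decomposition
\<open>1 - cnj a b = (1 - cnj a u) + cnj a (u - b)\<close> bounds the sum of the focal distances strictly below.\<close>

lemma inellipse_inside:
  assumes "norm a < 1" "norm b < 1" "u \<in> ellipse a b (norm (1 - cnj a * b))"
  shows "norm u < 1"
proof (rule ccontr)
  assume "\<not> norm u < 1"
  then have u: "1 \<le> norm u" by simp
  have "(1 - (norm a)\<^sup>2) * (1 - (norm u)\<^sup>2) \<le> 0"
    using assms(1) u by (intro mult_nonneg_nonpos) (auto simp: abs_square_le_1)
  then have "(norm (1 - cnj a * u))\<^sup>2 \<le> (norm (u - a))\<^sup>2" using norm_reflected_diff[of a u] by linarith
  then have 1: "norm (1 - cnj a * u) \<le> norm (u - a)" by (rule power2_le_imp_le) simp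
  have "norm (1 - cnj a * b) = norm ((1 - cnj a * u) + cnj a * (u - b))" by (simp add: algebra_simps)
  also have "\<dots> \<le> norm (1 - cnj a * u) + norm a * norm (u - b)"
    using norm_triangle_ineq[of "1 - cnj a * u" "cnj a * (u - b)"] by (simp add: norm_mult)
  also have "\<dots> < norm (u - a) + norm (u - b)"
  proof -
    have "norm (u - b) > 0" using u assms(2) by auto
    then have "norm a * norm (u - b) < 1 * norm (u - b)" using assms(1) by (intro mult_strict_right_mono) auto
    then show ?thesis using 1 by simp
  qed
  finally show False using assms(3) by (simp add: ellipse_def dist_norm)
qed

section \<open>The equations give the Brianchon point\<close>

locale quintic_decomposition = quintic +
  assumes eq1: "f3 + f4 + f1 * f2 * f5 * cnj f4 * cnj f3 = f1 + f2 + f5"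
    and eq2: "f3 * f4 + f1 * f2 * f5 * (cnj f4 + cnj f3) = f1 * f2 + f2 * f5 + f1 * f5"
    and foci: "{f3, f4} = {(f5 - f2) / (1 - f2 * cnj f5), (f5 - f1) / (1 - f1 * cnj f5)}"
begin

abbreviation \<tau> where "\<tau> \<equiv> disk_involution f5"
abbreviation X where "X \<equiv> cubic_num f3 f4"
abbreviation Y where "Y \<equiv> cubic_den f3 f4"

definition X5 where "X5 t = (t - f1) * (t - f2) * (t - f5)"
definition Y5 where "Y5 t = (1 - cnj f1 * t) * (1 - cnj f2 * t) * (1 - cnj f5 * t)"
definition m where "m = f1 * f2 * f5"
text \<open>The factor that appears when \<open>\<tau>\<close> carries \<open>X\<close> to \<open>X5\<close>.\<close>

definition \<alpha> where "\<alpha> = - ((1 - cnj f5 * f3) * (1 - cnj f5 * f4))"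

lemma X5_eq: "X5 t = X t - m * Y t" and Y5_eq: "Y5 t = Y t - cnj m * X t"
  using cubic_equations_imp[OF eq1 eq2] unfolding X5_def Y5_def m_def by blast+

lemma norm_m: "norm m < 1"
proof -
  have "norm (f1 * f2) < 1" using disk mult_strict_mono'[of "norm f1" 1 "norm f2" 1] by (simp add: norm_mult)
  then have "norm (f1 * f2) * norm f5 < 1" using disk mult_strict_mono'[of "norm (f1 * f2)" 1 "norm f5" 1] by simp
  then show ?thesis by (simp add: m_def norm_mult)
qed

lemma involution_nz: "norm t \<le> 1 \<Longrightarrow> 1 - cnj f5 * t \<noteq> 0"
  using reflected_factor_nz disk(5) by blast

lemma involution_foci: "(\<tau> f3 = f1 \<and> \<tau> f4 = f2) \<or> (\<tau> f3 = f2 \<and> \<tau> f4 = f1)"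
proof -
  have "{f3, f4} = {\<tau> f2, \<tau> f1}" using foci by (simp add: disk_involution_def mult.commute)
  moreover have "\<tau> (\<tau> f1) = f1" "\<tau> (\<tau> f2) = f2"
    using disk involution_nz by (auto intro!: disk_involution_involutive)
  ultimately show ?thesis by (auto simp: doubleton_eq_iff)
qed

lemma \<alpha>_nz: "\<alpha> \<noteq> 0"
  using involution_nz[of f3] involution_nz[of f4] disk by (simp add: \<alpha>_def)

lemma X_involution: "norm t \<le> 1 \<Longrightarrow> X (\<tau> t) * (1 - cnj f5 * t)^3 = \<alpha> * X5 t"
  using cubic_num_after_involution[OF disk(5,3,4)] involution_foci by (auto simp: \<alpha>_def X5_def)

lemma Y_involution_cnj: "norm t \<le> 1 \<Longrightarrow> Y (\<tau> t) * (1 - cnj f5 * t)^3 = - cnj \<alpha> * Y5 t"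
  using cubic_den_after_involution[OF disk(5,3,4)] involution_foci
  by (auto simp: \<alpha>_def Y5_def mult.commute)

text \<open>That \<open>\<alpha>\<close> is real is what makes the Blaschke product invariant under \<open>\<tau>\<close>, and not just invariant up to a
unimodular constant. Applying \<open>\<tau>\<close> twice expresses \<open>N\<^sup>3 X\<close> as \<open>\<alpha> (\<alpha> (X - m Y) + m cnj \<alpha> (Y - cnj m X))\<close>.
At \<open>0\<close> this forces \<open>m (cnj \<alpha> - \<alpha>) = 0\<close>. If \<open>m = 0\<close>, then \<open>\<alpha>\<^sup>2\<close> is the positive number \<open>N\<^sup>3\<close>.\<close>

lemma cnj_\<alpha>: "cnj \<alpha> = \<alpha>"
proof -
  define N where "N = 1 - cnj f5 * f5"
  have Nr: "N = complex_of_real (1 - (norm f5)\<^sup>2)"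
    by (simp add: N_def mult_cnj_self mult.commute[of "cnj f5"])
  have twice: "N ^ 3 * X t = \<alpha> * (\<alpha> * (X t - m * Y t) + m * cnj \<alpha> * (Y t - cnj m * X t))"
    if t: "norm t \<le> 1" "norm (\<tau> t) \<le> 1" for t
  proof -
    let ?d = "1 - cnj f5 * t"
    have d: "?d \<noteq> 0" using involution_nz[OF t(1)] .
    have \<tau>d: "\<tau> t * ?d = f5 - t" using d by (simp add: disk_involution_def)
    have dd: "(1 - cnj f5 * \<tau> t) * ?d = N" unfolding N_def using \<tau>d by algebra
    have "X (\<tau> (\<tau> t)) * (1 - cnj f5 * \<tau> t)^3 = \<alpha> * X5 (\<tau> t)" by (rule X_involution[OF t(2)])
    moreover have "\<tau> (\<tau> t) = t" by (rule disk_involution_involutive[OF disk(5) d])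
    ultimately have "X t * ((1 - cnj f5 * \<tau> t) * ?d)^3 = \<alpha> * (X5 (\<tau> t) * ?d^3)"
      by algebra
    also have "X5 (\<tau> t) * ?d^3 = X (\<tau> t) * ?d^3 - m * (Y (\<tau> t) * ?d^3)"
      unfolding X5_eq by algebra
    also have "\<dots> = \<alpha> * X5 t + m * cnj \<alpha> * Y5 t"
      unfolding X_involution[OF t(1)] Y_involution_cnj[OF t(1)] by algebra
    finally show ?thesis unfolding dd X5_eq Y5_eq by (simp add: mult.commute)
  qed
  have "\<tau> 0 = f5" by (simp add: disk_involution_def)
  then have "\<alpha> * (m * (cnj \<alpha> - \<alpha>)) = 0"
    using twice[of 0] disk(5) by (auto simp: cubic_num_def cubic_den_def algebra_simps)
  then have "m = 0 \<or> cnj \<alpha> = \<alpha>" using \<alpha>_nz by auto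
  then show ?thesis
  proof
    assume m0: "m = 0"
    have "X 1 \<noteq> 0" using disk by (auto simp: cubic_num_def)
    moreover have "norm (\<tau> 1) = 1" using disk_involution_unit(1)[OF disk(5), of 1] by simp
    then have "N ^ 3 * X 1 = \<alpha>\<^sup>2 * X 1" using twice[of 1] m0 by (simp add: power2_eq_square)
    ultimately have sq: "\<alpha>\<^sup>2 = complex_of_real ((1 - (norm f5)\<^sup>2) ^ 3)" by (simp add: Nr)
    have pos: "0 < (1 - (norm f5)\<^sup>2) ^ 3" using disk(5) by (simp add: abs_square_less_1)
    have "Im (\<alpha>\<^sup>2) = 0" "Re (\<alpha>\<^sup>2) > 0" unfolding sq using pos by (simp_all del: of_real_power of_real_diff)
    then have "Im \<alpha> = 0" by (auto simp: power2_eq_square mult_eq_0_iff)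
    then show ?thesis by (simp add: complex_eq_iff)
  qed
qed

lemma Y_involution: "norm t \<le> 1 \<Longrightarrow> Y (\<tau> t) * (1 - cnj f5 * t)^3 = - \<alpha> * Y5 t"
  using Y_involution_cnj cnj_\<alpha> by simp

lemma vertex_eq: "poly (vertex_poly A lam) t = X t * X5 t - cnj lam * (Y t * Y5 t)"
  by (simp add: poly_vertex X5_def Y5_def)

text \<open>Both products \<open>X X5\<close> and \<open>Y Y5\<close> are reproduced by \<open>\<tau>\<close> with the same factor.\<close>

lemma vertex_involution:
  assumes "norm t \<le> 1" "poly (vertex_poly A lam) t = 0"
  shows "poly (vertex_poly A lam) (\<tau> t) = 0"
proof -
  let ?d = "1 - cnj f5 * t"
  note x = X_involution[OF assms(1)] and y = Y_involution[OF assms(1)]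
  have x5: "X5 (\<tau> t) * ?d^3 = \<alpha> * (1 - m * cnj m) * X t"
    using x y unfolding X5_eq Y5_eq by algebra
  have y5: "Y5 (\<tau> t) * ?d^3 = - \<alpha> * (1 - m * cnj m) * Y t"
    using x y unfolding X5_eq Y5_eq by algebra
  have "poly (vertex_poly A lam) (\<tau> t) * ?d^6 = (X (\<tau> t) * ?d^3) * (X5 (\<tau> t) * ?d^3)
      - cnj lam * ((Y (\<tau> t) * ?d^3) * (Y5 (\<tau> t) * ?d^3))"
    unfolding vertex_eq by algebra
  also have "\<dots> = \<alpha>\<^sup>2 * (1 - m * cnj m) * poly (vertex_poly A lam) t"
    unfolding x y x5 y5 vertex_eq by algebra
  finally show ?thesis using assms(2) involution_nz[OF assms(1)] by simp
qed

lemma vertices_unit: "norm lam = 1 \<Longrightarrow> poly (vertex_poly A lam) z = 0 \<Longrightarrow> norm z = 1"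
proof -
  assume lam: "norm lam = 1" and z: "poly (vertex_poly A lam) z = 0"
  obtain P where P: "vertex_labelling A lam P" using labelling_exists[OF lam] by blast
  then have "z \<in> P ` {..<6}" using z unfolding vertex_labelling_def by simp
  then show "norm z = 1" using labelling_unit[OF P] by blast
qed

lemma involution_opposite:
  assumes lam: "norm lam = 1" and P: "vertex_labelling A lam P" and ij: "j < 6" "i = (j + 3) mod 6"
  shows "\<tau> (P j) = P i"
proof -
  define Q where "Q k = P ((k + j) mod 6)" for k
  have Q: "vertex_labelling A lam Q" unfolding Q_def by (rule labelling_shift[OF P])
  let ?V = "{z. poly (vertex_poly A lam) z = 0}"
  have g: "\<tau> p \<in> ?V \<and> \<tau> p \<noteq> p \<and> \<tau> (\<tau> p) = p \<and> f5 \<in> affine hull {p, \<tau> p}" if p: "p \<in> ?V" for p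
  proof -
    have u: "norm p = 1" using vertices_unit[OF lam] p by blast
    have ne: "\<tau> p \<noteq> p" "norm (\<tau> p) = 1" using disk_involution_unit[OF disk(5) u] by auto
    moreover have "\<tau> (\<tau> p) = p" using disk_involution_involutive disk(5) involution_nz u by simp
    moreover have "f5 \<in> affine hull {p, \<tau> p}"
      using chord_through_point_iff[OF disk(5) u ne(2)] ne(1) by metis
    ultimately show ?thesis using vertex_involution u p by simp
  qed
  obtain k where "6 = 2 * k" "\<tau> (Q 0) = Q k"
    using concurrent_chords_opposite[of 6 Q ?V \<tau> f5] Q g disk(5) unfolding vertex_labelling_def by auto
  then have "k = 3" "\<tau> (Q 0) = Q k" by simp_all
  then have "\<tau> (Q 0) = Q 3" by simp
  then show ?thesis using ij by (simp add: Q_def add.commute)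
qed

lemma brianchon: "brianchon_is_point A f5"
  unfolding brianchon_is_point_def envelope_is_point_def diagonal_lines_def
proof clarsimp
  fix lam P and j :: nat
  assume lam: "norm lam = 1" and P: "vertex_labelling A lam P" and j: "j < 6"
  have "(j + 3) mod 6 \<noteq> j" "(j + 3) mod 6 < 6" using j by presburger+
  then show "f5 \<in> affine hull {P j, P ((j + 3) mod 6)}"
    using chord_through_point_iff[of f5 "P j" "P ((j + 3) mod 6)"] disk(5) labelling_unit[OF P]
      labelling_distinct[OF P] involution_opposite[OF lam P j refl] j by metis
qed

definition C where "C t = X t / Y t"

lemma Y_nz: "norm t \<le> 1 \<Longrightarrow> Y t \<noteq> 0"
  using cubic_den_nz disk by blast

lemma norm_C: "norm t = 1 \<Longrightarrow> norm (C t) = 1"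
  using cubic_unit[of t f3 f4] Y_nz[of t] by (simp add: C_def norm_divide)

text \<open>The Blaschke product factors through \<open>C\<close>: its fibres are given by a quadratic equation for the value of \<open>C\<close>.\<close>

lemma vertex_iff_C:
  assumes "norm t = 1"
  shows "poly (vertex_poly A lam) t = 0 \<longleftrightarrow> (C t)\<^sup>2 - m * C t - cnj lam * (1 - cnj m * C t) = 0"
proof -
  have X: "X t = C t * Y t" using Y_nz[of t] assms by (simp add: C_def)
  have "poly (vertex_poly A lam) t = ((C t)\<^sup>2 - m * C t - cnj lam * (1 - cnj m * C t)) * (Y t)\<^sup>2"
    unfolding vertex_eq X5_eq Y5_eq X by algebra
  then show ?thesis using Y_nz[of t] assms by simp
qed

text \<open>In terms of \<open>C\<close> the involution acts as \<open>c \<mapsto> (m - c) / (1 - cnj m c)\<close>, which has no fixed point on the circle since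
\<open>norm m < 1\<close>.\<close>

lemma C_involution_neq:
  assumes "norm t = 1" shows "C (\<tau> t) \<noteq> C t"
proof
  assume e: "C (\<tau> t) = C t"
  have d: "1 - cnj f5 * t \<noteq> 0" using involution_nz assms by simp
  have \<tau>: "norm (\<tau> t) = 1" using disk_involution_unit disk(5) assms by blast
  have X: "X t = C t * Y t" "X (\<tau> t) = C t * Y (\<tau> t)"
  proof -
    show "X t = C t * Y t" using Y_nz[of t] assms by (simp add: C_def)
    show "X (\<tau> t) = C t * Y (\<tau> t)" using Y_nz[of "\<tau> t"] \<tau> unfolding e[symmetric] by (simp add: C_def)
  qed
  have "\<alpha> * X5 t = C t * (- \<alpha> * Y5 t)"
    using X_involution[of t] Y_involution[of t] X(2) assms by (simp add: mult.assoc)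
  then have "\<alpha> * Y t * (m - 2 * C t + cnj m * (C t)\<^sup>2) = 0"
    unfolding X5_eq Y5_eq X(1) by algebra
  then have "m - 2 * C t + cnj m * (C t)\<^sup>2 = 0" using \<alpha>_nz Y_nz[of t] assms by simp
  then have "2 * C t = m + cnj m * (C t)\<^sup>2" by algebra
  then have "norm (2 * C t) \<le> norm m + norm (cnj m * (C t)\<^sup>2)" by (metis norm_triangle_ineq)
  then show False using norm_C[OF assms] norm_m by (simp add: norm_mult norm_power)
qed

lemma C_vertices:
  assumes "norm lam = 1" "poly (vertex_poly A lam) p = 0" "poly (vertex_poly A lam) q = 0"
  shows "C q = C p \<or> C q = C (\<tau> p)"
proof -
  have u: "norm p = 1" "norm q = 1" using vertices_unit assms by auto
  have v: "norm (\<tau> p) = 1" using disk_involution_unit disk(5) u by blast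
  define g where "g c = c\<^sup>2 - m * c - cnj lam * (1 - cnj m * c)" for c
  have "g (C p) = 0" "g (C q) = 0" "g (C (\<tau> p)) = 0"
    using assms vertex_involution[of p lam] vertex_iff_C u v by (simp_all add: g_def)
  then have "(C p - C (\<tau> p)) * ((C q - C p) * (C q - C (\<tau> p))) = 0"
    unfolding g_def by algebra
  then show ?thesis using C_involution_neq[OF u(1)] by auto
qed

end

context quintic_decomposition
begin

section \<open>Interlacing fibres and the pentagram curve\<close>

lemma vertex_root: "vertex_labelling A lam P \<Longrightarrow> j < 6 \<Longrightarrow> poly (vertex_poly A lam) (P j) = 0"
  unfolding vertex_labelling_def by auto

lemma labelling_orient:
  assumes "vertex_labelling A lam P" "i < j" "j < k" "k < 6"
  shows "orient (P i) (P k) (P j) < 0" "orient (P i) (P j) (P k) > 0"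
  using cyclically_ordered_orient[of 6 P i j k] assms orient_swap[of "P i" "P k" "P j"]
  unfolding vertex_labelling_def by auto

lemma C_opposite:
  assumes lam: "norm lam = 1" and P: "vertex_labelling A lam P" and ij: "j < 6" "i = (j + 3) mod 6"
  shows "C (P i) \<noteq> C (P j)"
  using C_involution_neq labelling_unit[OF P ij(1)] involution_opposite[OF lam P ij] by metis

lemma C_two_values:
  assumes lam: "norm lam = 1" and P: "vertex_labelling A lam P" and ij: "j < 6" "i = (j + 3) mod 6" and k: "k < 6"
  shows "C (P k) = C (P j) \<or> C (P k) = C (P i)"
  using C_vertices[OF lam vertex_root[OF P ij(1)] vertex_root[OF P k]] involution_opposite[OF lam P ij] by metis

text \<open>Otherwise the vertices \<open>P 3, P 4, P 5\<close> form the other fibre. The two triangles are then separated by the chord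
\<open>P 0 P 2\<close>, although the zero \<open>f3\<close> lies in both.\<close>

lemma no_three_consecutive:
  assumes lam: "norm lam = 1" and P: "vertex_labelling A lam P"
  shows "\<not> (C (P 0) = C (P 1) \<and> C (P 0) = C (P 2))"
proof
  assume e: "C (P 0) = C (P 1) \<and> C (P 0) = C (P 2)"
  have o: "C (P 3) \<noteq> C (P 0)" "C (P 4) \<noteq> C (P 1)" "C (P 5) \<noteq> C (P 2)"
    by (rule C_opposite[OF lam P]; simp)+
  have e': "C (P 4) = C (P 3)" "C (P 5) = C (P 3)"
    using C_two_values[OF lam P, of 0 3 4] C_two_values[OF lam P, of 0 3 5] o e by auto
  have fib: "X (P j) = C (P j) * Y (P j)" if "j < 6" for j
    using Y_nz labelling_unit[OF P that] by (simp add: C_def)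
  have u: "norm (P j) = 1" if "j < 6" for j using labelling_unit[OF P that] .
  have d: "P i \<noteq> P j" if "i < 6" "j < 6" "i \<noteq> j" for i j using labelling_distinct[OF P that] .
  have bary: "\<exists>u v w. 0 < u \<and> 0 < v \<and> 0 < w \<and>
      u *\<^sub>R (P i - f3) + v *\<^sub>R (P j - f3) + w *\<^sub>R (P k - f3) = 0"
    if "i < 6" "j < 6" "k < 6" "i \<noteq> j" "j \<noteq> k" "i \<noteq> k" "C (P j) = C (P i)" "C (P k) = C (P i)" for i j k
  proof -
    have "X (P i) = C (P i) * Y (P i)" "X (P j) = C (P i) * Y (P j)" "X (P k) = C (P i) * Y (P k)"
      using fib that by metis+
    from cubic_fibre_surrounds_zero[OF disk(3,4) u u u d d d this] that show ?thesis by metis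
  qed
  \<comment> \<open>the two triangles lie on different sides of the chord from \<open>P 0\<close> to \<open>P 2\<close>, but both contain \<open>f3\<close>\<close>
  obtain u v w where uvw: "0 < u" "0 < v" "0 < w"
      "u *\<^sub>R (P 0 - f3) + v *\<^sub>R (P 1 - f3) + w *\<^sub>R (P 2 - f3) = 0"
    using bary[of 0 1 2] e by auto
  have "(u + v + w) * orient (P 0) (P 2) f3 = v * orient (P 0) (P 2) (P 1)"
    using orient_barycentric[OF uvw(4), of "P 0" "P 2"] by simp
  also have "\<dots> < 0" using uvw labelling_orient(1)[OF P, of 0 1 2] by (simp add: mult_pos_neg)
  finally have neg: "orient (P 0) (P 2) f3 < 0" using uvw by (simp add: mult_less_0_iff)
  obtain u v w where uvw: "0 < u" "0 < v" "0 < w"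
      "u *\<^sub>R (P 3 - f3) + v *\<^sub>R (P 4 - f3) + w *\<^sub>R (P 5 - f3) = 0"
    using bary[of 3 4 5] e' by auto
  have "0 < u * orient (P 0) (P 2) (P 3) + v * orient (P 0) (P 2) (P 4) + w * orient (P 0) (P 2) (P 5)"
    using uvw labelling_orient(2)[OF P, of 0 2] by (intro add_pos_pos mult_pos_pos) auto
  also have "\<dots> = (u + v + w) * orient (P 0) (P 2) f3"
    using orient_barycentric[OF uvw(4), of "P 0" "P 2"] by simp
  finally have "orient (P 0) (P 2) f3 > 0" using uvw by (simp add: zero_less_mult_iff)
  with neg show False by simp
qed

text \<open>Opposite vertices lie in different fibres. If two neighbours lay in the same fibre, this would force three
consecutive vertices into one fibre.\<close>

lemma C_neighbours:
  assumes lam: "norm lam = 1" and P: "vertex_labelling A lam P" and ij: "j < 6" "i = (j + 1) mod 6"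
  shows "C (P i) \<noteq> C (P j)"
proof -
  define Q where "Q k = P ((k + j) mod 6)" for k
  have Q: "vertex_labelling A lam Q" unfolding Q_def by (rule labelling_shift[OF P])
  have "C (Q 1) \<noteq> C (Q 0)"
  proof
    assume e: "C (Q 1) = C (Q 0)"
    have o: "C (Q 3) \<noteq> C (Q 0)" "C (Q 4) \<noteq> C (Q 1)" "C (Q 5) \<noteq> C (Q 2)"
      by (rule C_opposite[OF lam Q]; simp)+
    have t: "C (Q k) = C (Q 0) \<or> C (Q k) = C (Q 3)" if "k < 6" for k
      by (rule C_two_values[OF lam Q _ _ that]) simp_all
    have "C (Q 2) \<noteq> C (Q 0)" using no_three_consecutive[OF lam Q] e by metis
    then have "C (Q 5) = C (Q 0)" using t[of 2] t[of 5] o by auto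
    moreover define R where "R k = Q ((k + 5) mod 6)" for k
    have R: "vertex_labelling A lam R" unfolding R_def by (rule labelling_shift[OF Q])
    moreover have "R 0 = Q 5" "R 1 = Q 0" "R 2 = Q 1" by (simp_all add: R_def)
    ultimately show False using no_three_consecutive[OF lam R] e by metis
  qed
  then show ?thesis using ij by (simp add: Q_def add.commute)
qed

lemma fibres_interlace:
  assumes lam: "norm lam = 1" and P: "vertex_labelling A lam P" and k: "k < 6"
  shows "C (P k) = C (P 0) \<longleftrightarrow> even k"
proof -
  have n: "C (P 1) \<noteq> C (P 0)" "C (P 2) \<noteq> C (P 1)" "C (P 3) \<noteq> C (P 2)" "C (P 4) \<noteq> C (P 3)" "C (P 5) \<noteq> C (P 4)"
    by (rule C_neighbours[OF lam P]; simp)+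
  have t: "C (P k) = C (P 0) \<or> C (P k) = C (P 3)" if "k < 6" for k
    by (rule C_two_values[OF lam P _ _ that]) simp_all
  have "C (P 2) = C (P 0)" "C (P 1) = C (P 3)" "C (P 4) = C (P 0)" "C (P 5) = C (P 3)" "C (P 3) \<noteq> C (P 0)"
    using t[of 1] t[of 2] t[of 3] t[of 4] t[of 5] n by auto
  moreover have "k \<in> {0, 1, 2, 3, 4, 5}" using k by auto
  ultimately show ?thesis using n(1) by auto
qed

lemma C_eq_iff: "norm z = 1 \<Longrightarrow> norm w = 1 \<Longrightarrow> C z = C w \<longleftrightarrow> X z * Y w = X w * Y z"
  using Y_nz[of z] Y_nz[of w] by (simp add: C_def frac_eq_eq)

text \<open>Every point of the circle is a vertex of one of the hexagons.\<close>

lemma vertex_parameter: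
  assumes "norm z = 1" obtains lam where "norm lam = 1" "poly (vertex_poly A lam) z = 0"
proof -
  have "Y z * Y5 z \<noteq> 0"
    unfolding Y5_def using Y_nz reflected_factor_nz disk assms by simp
  moreover have "norm (X z * X5 z) = norm (Y z * Y5 z)"
    using cubic_unit[OF assms] norm_reflected_unit[OF assms] by (simp add: norm_mult X5_def Y5_def)
  ultimately have q: "norm (X z * X5 z / (Y z * Y5 z)) = 1"
    "X z * X5 z - X z * X5 z / (Y z * Y5 z) * (Y z * Y5 z) = 0"
    by (simp_all only: norm_divide nonzero_eq_divide_eq) simp_all
  define q where "q = X z * X5 z / (Y z * Y5 z)"
  have "norm (cnj q) = 1" "poly (vertex_poly A (cnj q)) z = 0"
    using q by (simp_all add: vertex_eq q_def[symmetric])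
  then show thesis using that by blast
qed

text \<open>By interlacing, the diagonals are the chords that join two points of a fibre of \<open>C\<close>. Conversely every tangent of
the ellipse is a chord of the circle, and its endpoints are vertices of one hexagon since the value of \<open>C\<close> at a point of
the circle decides of which hexagon it is a vertex.\<close>

lemma pentagram: "pentagram_is_ellipse_with_foci A f3 f4"
proof -
  let ?E = "ellipse f3 f4 (norm (1 - cnj f3 * f4))"
  have tan: "(\<exists>!u. u \<in> affine hull {z, w} \<inter> ?E) \<longleftrightarrow> C z = C w" if "norm z = 1" "norm w = 1" "z \<noteq> w" for z w
    using inellipse_tangent_iff[OF disk(3,4) that] C_eq_iff[OF that(1,2)] by metis
  have "diagonal_lines 2 A = tangent_lines ?E"
  proof (intro equalityI subsetI)
    fix L assume "L \<in> diagonal_lines 2 A"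
    then obtain lam P j where L: "L = affine hull {P j, P ((j + 2) mod 6)}" "norm lam = 1" "vertex_labelling A lam P" "j < 6"
      unfolding diagonal_lines_def by auto
    define i where "i = (j + 2) mod 6"
    have i: "i < 6" "i \<noteq> j" using L(4) unfolding i_def by presburger+
    have u: "norm (P i) = 1" "norm (P j) = 1" "P j \<noteq> P i"
      using labelling_unit[OF L(3)] labelling_distinct[OF L(3)] i L(4) by auto
    have "even i = even j" unfolding i_def by presburger
    then have "C (P i) = C (P j)"
      using fibres_interlace[OF L(2,3) i(1)] fibres_interlace[OF L(2,3) L(4)]
        C_two_values[OF L(2,3), of 0 3 i] C_two_values[OF L(2,3), of 0 3 j] i(1) L(4) by auto
    then have "\<exists>!u. u \<in> L \<inter> ?E" using tan[OF u(2,1,3)] L(1) by (simp add: i_def)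
    then show "L \<in> tangent_lines ?E" unfolding tangent_lines_def using L(1) u(3) i_def by blast
  next
    fix L assume "L \<in> tangent_lines ?E"
    then obtain p q where pq: "p \<noteq> q" "L = affine hull {p, q}" and ex: "\<exists>!z. z \<in> L \<inter> ?E"
      unfolding tangent_lines_def by blast
    obtain u where u: "u \<in> L" "u \<in> ?E" using ex by blast
    obtain z w where zw: "norm z = 1" "norm w = 1" "z \<noteq> w" "L = affine hull {z, w}"
      using affine_hull_eq_unit_chord[OF pq(1) _ inellipse_inside[OF disk(3,4) u(2)]] u(1) pq(2) by metis
    have Cz: "C z = C w" using tan[OF zw(1-3)] ex zw(4) by blast
    obtain lam where lam: "norm lam = 1" "poly (vertex_poly A lam) z = 0" using vertex_parameter[OF zw(1)] .
    have w0: "poly (vertex_poly A lam) w = 0" using lam(2) vertex_iff_C zw(1,2) Cz by metis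
    obtain P0 where P0: "vertex_labelling A lam P0" using labelling_exists[OF lam(1)] by blast
    then obtain n where n: "n < 6" "z = P0 n" using lam(2) unfolding vertex_labelling_def by auto
    define P where "P k = P0 ((k + n) mod 6)" for k
    have P: "vertex_labelling A lam P" unfolding P_def by (rule labelling_shift[OF P0])
    have z: "z = P 0" using n by (simp add: P_def)
    obtain k where k: "k < 6" "w = P k" using w0 P unfolding vertex_labelling_def by auto
    have "even k" using fibres_interlace[OF lam(1) P k(1)] Cz z k(2) by simp
    moreover have "k \<noteq> 0" using zw(3) z k(2) by metis
    ultimately have "k = 2 \<or> k = 4" using k(1) by presburger
    then show "L \<in> diagonal_lines 2 A"
    proof
      assume "k = 2"
      then show ?thesis using diagonal_mem[OF lam(1) P, of 0 2 2] zw(4) z k(2) by simp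
    next
      assume "k = 4"
      then show ?thesis using diagonal_mem[OF lam(1) P, of 4 0 2] zw(4) z k(2) by (simp add: insert_commute)
    qed
  qed
  then show ?thesis
    unfolding pentagram_is_ellipse_with_foci_def envelope_is_ellipse_with_foci_def is_ellipse_with_foci_def
    using inellipse_axis(1)[OF disk(3,4)] by blast
qed

section \<open>The conic of the sides\<close>

text \<open>This is \<open>Y z Y w\<close> times \<open>c + c' - m - cnj m c c'\<close> for \<open>c = C z\<close> and \<open>c' = C w\<close>. It expresses that \<open>c\<close> and \<open>c'\<close>
are the two different values of \<open>C\<close> on one hexagon.\<close>

definition K where "K z w = X z * Y w + X w * Y z - m * (Y z * Y w) - cnj m * (X z * X w)"

text \<open>Eliminating the parameter from the quadratic equations for the two values of \<open>C\<close> leaves the product of their difference with the factor in \<open>K\<close>.\<close>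

lemma K_vanishes:
  assumes lam: "norm lam = 1" and z: "poly (vertex_poly A lam) z = 0" and w: "poly (vertex_poly A lam) w = 0"
    and ne: "C z \<noteq> C w"
  shows "K z w = 0"
proof -
  have u: "norm z = 1" "norm w = 1" using vertices_unit[OF lam] z w by auto
  have "(C z)\<^sup>2 - m * C z - cnj lam * (1 - cnj m * C z) = 0" "(C w)\<^sup>2 - m * C w - cnj lam * (1 - cnj m * C w) = 0"
    using z w vertex_iff_C u by blast+
  then have "(C z - C w) * (C z + C w - m - cnj m * (C z * C w)) = 0" by algebra
  then have "C z + C w - m - cnj m * (C z * C w) = 0" using ne by simp
  moreover have "X z = C z * Y z" "X w = C w * Y w" using Y_nz u by (simp_all add: C_def)
  ultimately show ?thesis unfolding K_def by algebra
qed

text \<open>A chord through \<open>f5\<close> joins the two fibres of \<open>C\<close> in a hexagon.\<close>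

lemma K_involution: "norm t \<le> 1 \<Longrightarrow> K t (\<tau> t) = 0"
proof -
  assume t: "norm t \<le> 1"
  have "K t (\<tau> t) * (1 - cnj f5 * t)^3 = X (\<tau> t) * (1 - cnj f5 * t)^3 * Y5 t + Y (\<tau> t) * (1 - cnj f5 * t)^3 * X5 t"
    unfolding K_def X5_eq Y5_eq by algebra
  also have "\<dots> = 0" unfolding X_involution[OF t] Y_involution[OF t] by algebra
  finally show ?thesis using involution_nz[OF t] by simp
qed

text \<open>As a polynomial in \<open>s = z + w\<close> and \<open>p = z w\<close>, \<open>K\<close> differs from the product of the three incidence forms by
\<open>p\<close> times a linear form: \<open>K\<close> and the product agree for \<open>p = 0\<close> and have the same symmetry under reflection in
the circle. The linear form vanishes on all chords through \<open>f5\<close>, so it is a multiple of the incidence form of \<open>f5\<close>.\<close>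

lemma K_factor:
  obtains \<kappa> where "\<And>z w. K z w = (incidence f5 z w)
    * ((incidence f1 z w) * (incidence f2 z w) - \<kappa> * (z * w))"
proof -
  define \<sigma> \<pi> s' p' where "\<sigma> = f3 + f4" and "\<pi> = f3 * f4" and "s' = cnj f3 + cnj f4" and "p' = cnj f3 * cnj f4"
  define m' where "m' = cnj m"
  define T where "T = f1 * (cnj f2 + cnj f5) + f2 * (cnj f1 + cnj f5) + f5 * (cnj f1 + cnj f2)"
  define U where "U = f1 * f2 * cnj f5 + f1 * f5 * cnj f2 + f2 * f5 * cnj f1"
  define V where "V = cnj f1 * cnj f2 * f5 + cnj f1 * cnj f5 * f2 + cnj f2 * cnj f5 * f1"
  define c0 c1 c2 where "c0 = 2 * \<sigma> - 2 * \<pi> * s' - m * (s'^2 - 2 * p') - m' * \<pi>^2 + U"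
    and "c1 = - 3 + \<sigma> * s' + \<pi> * p' + m * s' * p' + m' * \<sigma> * \<pi> - T"
    and "c2 = 2 * s' - 2 * \<sigma> * p' - m * p'^2 - m' * (\<sigma>^2 - 2 * \<pi>) + V"
  let ?L = "\<lambda>f z w. z + w - f - z * w * cnj f"
  have e: "f1 + f2 + f5 = \<sigma> + m * p'" "f1 * f2 + f2 * f5 + f1 * f5 = \<pi> + m * s'" "f1 * f2 * f5 = m"
    using eq1 eq2 by (simp_all add: \<sigma>_def \<pi>_def s'_def p'_def m_def mult_ac add_ac)
  have e': "cnj f1 + cnj f2 + cnj f5 = s' + m' * \<pi>" "cnj f1 * cnj f2 + cnj f2 * cnj f5 + cnj f1 * cnj f5 = p' + m' * \<sigma>"
      "cnj f1 * cnj f2 * cnj f5 = m'"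
    using arg_cong[OF e(1), of cnj] arg_cong[OF e(2), of cnj]
    by (simp_all add: \<sigma>_def \<pi>_def s'_def p'_def m'_def m_def)
  have L: "?L f1 z w * ?L f2 z w * ?L f5 z w = (z + w)^3 - (z + w)^2 * ((\<sigma> + m * p') + z * w * (s' + m' * \<pi>))
     + (z + w) * ((\<pi> + m * s') + z * w * T + (z * w)^2 * (p' + m' * \<sigma>))
     - (m + z * w * U + (z * w)^2 * V + (z * w)^3 * m')" for z w
    unfolding e(1,2)[symmetric] e'(1,2)[symmetric]
    unfolding e(3)[symmetric] e'(3)[symmetric] T_def U_def V_def by algebra
  have Xe: "X t = t^3 - \<sigma> * t^2 + \<pi> * t" and Ye: "Y t = 1 - s' * t + p' * t^2" for t
    unfolding cubic_num_def cubic_den_def \<sigma>_def \<pi>_def s'_def p'_def by algebra+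
  have Kl: "K z w = ?L f1 z w * ?L f2 z w * ?L f5 z w + z * w * (c0 + c1 * (z + w) + c2 * (z * w))" for z w
  proof -
    define s p where "s = z + w" and "p = z * w"
    \<comment> \<open>\<open>K\<close> in terms of the elementary symmetric functions of \<open>z\<close> and \<open>w\<close>\<close>
    have XX: "X z * X w = p * (p^2 - \<sigma> * p * s + \<sigma>^2 * p + \<pi> * (s^2 - 2 * p) - \<sigma> * \<pi> * s + \<pi>^2)"
      unfolding Xe s_def p_def by algebra
    have YY: "Y z * Y w = 1 - s' * s + s'^2 * p + p' * (s^2 - 2 * p) - s' * p' * p * s + p'^2 * p^2"
      unfolding Ye s_def p_def by algebra
    have XY: "X z * Y w + X w * Y z = s^3 - 3 * p * s - s' * p * (s^2 - 2 * p) + p' * p^2 * s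
        - \<sigma> * (s^2 - 2 * p) + \<sigma> * s' * p * s - 2 * \<sigma> * p' * p^2 + \<pi> * s - 2 * \<pi> * s' * p + \<pi> * p' * p * s"
      unfolding Xe Ye s_def p_def by algebra
    show ?thesis
      unfolding L K_def XY XX YY m'_def[symmetric] c0_def c1_def c2_def
      unfolding s_def[symmetric] p_def[symmetric]
      by (simp add: power2_eq_square power3_eq_cube algebra_simps)
  qed
  have line: "(c0 + c1 * f5) * (1 - cnj f5 * t) + t * (f5 - t) * (c2 + c1 * cnj f5) = 0"
    if t: "norm t = 1" for t
  proof -
    have d: "1 - cnj f5 * t \<noteq> 0" using involution_nz t by simp
    have \<tau>d: "\<tau> t * (1 - cnj f5 * t) = f5 - t" using d by (simp add: disk_involution_def)
    then have "?L f5 t (\<tau> t) = 0" by algebra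
    then have "t * \<tau> t * (c0 + c1 * (t + \<tau> t) + c2 * (t * \<tau> t)) = 0"
      using Kl[of t "\<tau> t"] K_involution[of t] t by simp
    moreover have "t \<noteq> 0" "\<tau> t \<noteq> 0" using t disk_involution_unit(1)[OF disk(5) t] by auto
    ultimately have "c0 + c1 * (t + \<tau> t) + c2 * (t * \<tau> t) = 0" by simp
    then show ?thesis using \<tau>d by algebra
  qed
  define a b where "a = c0 + c1 * f5" and "b = c2 + c1 * cnj f5"
  have line': "a * (1 - cnj f5 * t) + t * (f5 - t) * b = 0" if "norm t = 1" for t
    using line[OF that] unfolding a_def b_def .
  \<comment> \<open>three points of the circle suffice\<close>
  have ab: "a = b"
  proof -
    have "2 * a - 2 * b = (a * (1 - cnj f5 * 1) + 1 * (f5 - 1) * b) + (a * (1 - cnj f5 * (-1)) + (-1) * (f5 - (-1)) * b)"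
      by (simp add: algebra_simps)
    also have "\<dots> = 0" using line'[of 1] line'[of "-1"] by simp
    finally show ?thesis by simp
  qed
  have "a = 0"
  proof -
    have 1: "a * (f5 - cnj f5) = 0" using line'[of 1] unfolding ab by (simp add: algebra_simps)
    have "2 * a = (a * (1 - cnj f5 * \<i>) + \<i> * (f5 - \<i>) * a) - \<i> * (a * (f5 - cnj f5))"
      by (simp add: algebra_simps)
    also have "\<dots> = 0" using line'[of "\<i>"] 1 unfolding ab by simp
    finally show ?thesis by simp
  qed
  then have c: "c0 = - (c1 * f5)" "c2 = - (c1 * cnj f5)"
    using ab by (simp_all add: a_def b_def eq_neg_iff_add_eq_0)
  have "K z w = ?L f5 z w * (?L f1 z w * ?L f2 z w - (- c1) * (z * w))" for z w
    unfolding Kl c by algebra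
  then show thesis using that by blast
qed

end

section \<open>Matrices of the class S\<close>

lemma det_conj_transpose: "det (conj_transpose M) = cnj (det M)" for M :: "complex^'n^'n"
proof -
  have "conj_transpose M = transpose (map_matrix cnj M)"
    by (simp add: conj_transpose_def transpose_def map_matrix_def vec_eq_iff)
  then have "det (conj_transpose M) = det (map_matrix cnj M)" by simp
  also have "\<dots> = cnj (det M)" unfolding det_def map_matrix_def by (simp add: cnj_sum cnj_prod)
  finally show ?thesis .
qed

text \<open>On the circle \<open>w\<close> is the inverse of \<open>cnj w\<close>, so the matrix is \<open>w\<close> times the adjoint of \<open>w - A\<close>.\<close>

lemma det_pencil_adjoint:
  fixes A :: "complex^'n^'n"
  assumes w: "norm w = 1"
  shows "det (mat 1 - mat w ** conj_transpose A) = w ^ CARD('n) * cnj (det (mat w - A))"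
proof -
  have ww: "w * cnj w = 1" using w complex_norm_square[of w] by simp
  have "mat 1 - mat w ** conj_transpose A = mat w ** conj_transpose (mat w - A)"
  proof (rule matrix_eq[THEN iffD2], rule allI)
    fix x :: "complex^'n"
    have e: "conj_transpose (mat w - A) = mat (cnj w) - conj_transpose A"
      by (simp add: conj_transpose_def mat_def vec_eq_iff)
    show "(mat 1 - mat w ** conj_transpose A) *v x = (mat w ** conj_transpose (mat w - A)) *v x"
      unfolding e using ww by (simp add: matrix_vector_mult_diff_rdistrib matrix_vector_mul_assoc[symmetric] vec_eq_iff
          right_diff_distrib mult.assoc[symmetric])
  qed
  moreover have "det (mat w :: complex^'n^'n) = w ^ CARD('n)"
    by (subst det_diagonal) (auto simp: mat_def)
  ultimately show ?thesis by (simp add: det_mul det_conj_transpose)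
qed

lemma blaschke_den_on_circle:
  assumes "norm z = 1"
  shows "z ^ length fs * cnj (poly (blaschke_num fs) z) = poly (blaschke_den fs) z"
proof (induction fs)
  case (Cons f fs)
  have "z * cnj z = 1" using assms complex_norm_square[of z] by simp
  then have "z * cnj (z - f) = 1 - cnj f * z" by (simp add: algebra_simps)
  moreover have "z ^ length (f # fs) * cnj (poly (blaschke_num (f # fs)) z)
      = (z * cnj (z - f)) * (z ^ length fs * cnj (poly (blaschke_num fs) z))"
    unfolding poly_blaschke_Cons complex_cnj_mult by (simp only: length_Cons power_Suc mult_ac)
  ultimately show ?case unfolding poly_blaschke_Cons by (simp only: Cons)
qed simp

text \<open>The right-hand side says that \<open>z\<close> and \<open>w\<close> have the same image under the Blaschke product with the zeros
\<open>0\<close> and the eigenvalues. The determinants in \<open>pencil_singular_iff\<close> are its numerator and denominator.\<close>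

lemma S_class_pencil_iff:
  fixes A :: "complex^'n^'n"
  assumes S: "A \<in> S_class" and cp: "charpoly A = blaschke_num fs" and len: "length fs = CARD('n)"
    and fs: "\<And>f. f \<in> set fs \<Longrightarrow> norm f < 1"
    and z: "norm z = 1" and w: "norm w = 1" and zw: "z \<noteq> w"
  shows "det (pencil A (z + w) (z * w)) = 0 \<longleftrightarrow>
    poly (blaschke_num (0 # fs)) z * poly (blaschke_den (0 # fs)) w
      = poly (blaschke_num (0 # fs)) w * poly (blaschke_den (0 # fs)) z"
proof -
  let ?B = "conj_transpose A"
  obtain c d where cd: "c \<noteq> 0" "d \<noteq> 0" "mat 1 - A ** ?B = outer c d"
    using S rank_one_imp_outer unfolding S_class_def by blast
  obtain a b where ab: "a \<noteq> 0" "b \<noteq> 0" "mat 1 - ?B ** A = outer a b"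
    using S rank_one_imp_outer unfolding S_class_def by blast
  interpret rank_one_defect A ?B a b c d
    using ab cd by unfold_locales (simp_all add: algebra_simps)
  have \<Phi>: "det (mat v - A) = poly (blaschke_num fs) v" for v using cp poly_charpoly[of A v] by simp
  have \<Psi>: "det (mat 1 - mat v ** ?B) = poly (blaschke_den fs) v" if "norm v = 1" for v
    unfolding det_pencil_adjoint[OF that] \<Phi> len[symmetric] by (rule blaschke_den_on_circle[OF that])
  have nz: "poly (blaschke_num fs) v \<noteq> 0" "poly (blaschke_den fs) v \<noteq> 0" if "norm v = 1" for v
    using blaschke_log_derivative[OF fs that, of fs] by blast+
  show ?thesis
    using pencil_singular_iff[OF zw] nz[OF z] nz[OF w] unfolding \<Phi> \<Psi>[OF z] \<Psi>[OF w]
    by (simp add: poly_blaschke_Cons mult_ac del: blaschke_simps)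
qed

lemma numerical_range_eigenvalue:
  assumes "eigenvalue A c" shows "c \<in> numerical_range A"
proof -
  obtain v where v: "v \<noteq> 0" "A *v v = c *s v" using assms unfolding eigenvalue_def by blast
  define x where "x = complex_of_real (1 / norm v) *s v"
  have "norm x = 1" using v(1) by (simp add: x_def norm_divide)
  moreover have "A *v x = c *s x"
    unfolding x_def vec.scale v(2) by (simp add: vec_eq_iff)
  ultimately have "cinner x (A *v x) = c" "norm x = 1" by (simp_all add: cinner_self)
  then show ?thesis unfolding numerical_range_def by blast
qed

lemma S_class_contraction:
  assumes "A \<in> S_class" shows "norm (A *v x) \<le> norm (x :: complex^'n)"
  using onorm[OF matrix_vector_mul_bounded_linear, of A x] assms by (simp add: S_class_def)

text \<open>Equality in the Cauchy-Schwarz inequality makes a unimodular value an eigenvalue, and the eigenvalues lie in the open disk.\<close>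

lemma S_class_numerical_range_disk:
  assumes S: "A \<in> S_class" and u: "u \<in> numerical_range A"
  shows "norm u < 1"
proof -
  obtain x where x: "norm x = 1" "cinner x (A *v x) = u" using u unfolding numerical_range_def by blast
  have Ax: "norm (A *v x) \<le> 1" using S_class_contraction[OF S, of x] x by simp
  have le: "norm u \<le> 1" using cinner_Cauchy_Schwarz[of x "A *v x"] x Ax by simp
  have "norm u \<noteq> 1"
  proof
    assume u1: "norm u = 1"
    have yx: "cinner (A *v x) x = cnj u" using x(2) cnj_cinner[of x "A *v x"] by simp
    have "cinner (A *v x - u *s x) (A *v x - u *s x)
        = cinner (A *v x) (A *v x) - u * cnj u - cnj u * u + cnj u * u * cinner x x"
      unfolding cinner_simps x(2) yx by (simp add: algebra_simps)
    also have "\<dots> = complex_of_real ((norm (A *v x))\<^sup>2 - 1)"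
      using u1 x(1) by (simp add: cinner_self mult_cnj_self mult.commute[of "cnj u"])
    finally have "(norm (A *v x - u *s x))\<^sup>2 = (norm (A *v x))\<^sup>2 - 1"
      unfolding cinner_self of_real_eq_iff .
    moreover have "(norm (A *v x))\<^sup>2 \<le> 1" using Ax by (simp add: abs_square_le_1)
    ultimately have "(norm (A *v x - u *s x))\<^sup>2 \<le> 0" by linarith
    then have "A *v x = u *s x" by simp
    moreover have "x \<noteq> 0" using x by auto
    ultimately have "eigenvalue A u" unfolding eigenvalue_def by blast
    then show False using S u1 unfolding S_class_def by fastforce
  qed
  then show ?thesis using le by simp
qed

text \<open>Pair the kernel vector with the equation it satisfies.\<close>

lemma numerical_range_meets_line:
  fixes A :: "complex^'n^'n"
  assumes "det (pencil A s p) = 0"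
  obtains u where "u \<in> numerical_range A" "u + p * cnj u = s"
proof -
  obtain y where y: "y \<noteq> 0" "(pencil A s p) *v y = 0"
    using assms det_eq_0_iff_kernel by blast
  define x where "x = complex_of_real (1 / norm y) *s y"
  have x: "norm x = 1" using y(1) by (simp add: x_def norm_divide)
  have "(pencil A s p) *v x = 0" unfolding x_def vec.scale y(2) by simp
  then have "s *s x - A *v x - p *s (conj_transpose A *v x) = 0"
    by (simp add: matrix_vector_mult_diff_rdistrib matrix_vector_mul_assoc[symmetric])
  then have "cinner x (s *s x - A *v x - p *s (conj_transpose A *v x)) = 0" by simp
  then have "s - cinner x (A *v x) - p * cinner x (conj_transpose A *v x) = 0"
    using x by (simp add: cinner_self)
  moreover have "cinner x (conj_transpose A *v x) = cnj (cinner x (A *v x))"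
    by (metis cinner_conj_transpose cnj_cinner)
  ultimately have "cinner x (A *v x) + p * cnj (cinner x (A *v x)) = s" by (simp add: algebra_simps)
  moreover have "cinner x (A *v x) \<in> numerical_range A" using x unfolding numerical_range_def by blast
  ultimately show thesis using that by blast
qed

text \<open>The chord is perpendicular to \<open>k\<close> at signed distance \<open>h\<close> from the origin. Its endpoints are labelled so
that the positive side is the outer one.\<close>

lemma chord_at_height:
  assumes k: "norm k = 1" and h: "\<bar>h\<bar> < 1"
  obtains z w l where "norm z = 1" "norm w = 1" "z \<noteq> w" "z + w = 2 * complex_of_real h * k" "z * w = k\<^sup>2"
    "0 < l" "\<And>q. orient z w q = l * (Re (cnj k * q) - h)" "Re (cnj k * z) = h"
proof -
  define g where "g = sqrt (1 - h\<^sup>2)"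
  have "h\<^sup>2 < 1" using h by (simp add: abs_square_less_1)
  then have g: "g > 0" "g\<^sup>2 = 1 - h\<^sup>2" by (simp_all add: g_def)
  define z where "z = k * Complex h g"
  define w where "w = k * Complex h (- g)"
  have nz: "k \<noteq> 0" using k by auto
  have kk: "cnj k * k = 1" using k complex_norm_square[of k] by (simp add: mult.commute)
  have "norm (Complex h g) = 1" "norm (Complex h (- g)) = 1" using g by (simp_all add: complex_norm)
  then have "norm z = 1" "norm w = 1" using k by (simp_all add: z_def w_def norm_mult)
  moreover have "z \<noteq> w" using nz g by (simp add: z_def w_def)
  moreover have "z + w = 2 * complex_of_real h * k"
  proof -
    have "z + w = k * (Complex h g + Complex h (- g))" by (simp only: z_def w_def distrib_left)
    also have "Complex h g + Complex h (- g) = 2 * complex_of_real h" by (simp add: complex_eq_iff)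
    finally show ?thesis by simp
  qed
  moreover have "z * w = k\<^sup>2"
  proof -
    have "z * w = k\<^sup>2 * (Complex h g * Complex h (- g))" by (simp add: z_def w_def power2_eq_square mult_ac)
    also have "Complex h g * Complex h (- g) = 1" using g by (simp add: complex_eq_iff power2_eq_square)
    finally show ?thesis by simp
  qed
  moreover have kz: "cnj k * z = Complex h g" using kk by (simp add: z_def mult.assoc[symmetric])
  then have "Re (cnj k * z) = h" by (simp only: complex.sel)
  moreover have "orient z w q = (2 * g) * (Re (cnj k * q) - h)" for q
  proof -
    have "w - z = k * (Complex h (- g) - Complex h g)" by (simp only: z_def w_def right_diff_distrib)
    also have "Complex h (- g) - Complex h g = - (2 * complex_of_real g * \<i>)" by (simp add: complex_eq_iff)
    finally have wz: "w - z = k * - (2 * complex_of_real g * \<i>)" .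
    have "cnj (w - z) = 2 * complex_of_real g * \<i> * cnj k" unfolding wz by simp
    then have "cnj (w - z) * (q - z) = complex_of_real (2 * g) * (\<i> * (cnj k * q - cnj k * z))"
      by (simp only:) (simp add: algebra_simps)
    moreover have "Im (complex_of_real a * (\<i> * v)) = a * Re v" for a v by simp
    ultimately have "orient z w q = 2 * g * Re (cnj k * q - cnj k * z)"
      unfolding orient_def by (simp only:)
    then show ?thesis unfolding kz by simp
  qed
  ultimately show thesis using that[of z w "2 * g"] g(1) by simp
qed

section \<open>The numerical range as an elliptical disk\<close>

locale S_quintic = quintic_decomposition +
  assumes S: "A \<in> S_class"
begin

lemma pencil_iff:
  assumes "norm z = 1" "norm w = 1" "z \<noteq> w"
  shows "det (pencil A (z + w) (z * w)) = 0 \<longleftrightarrow>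
    X z * X5 z * (Y w * Y5 w) = X w * X5 w * (Y z * Y5 z)"
proof -
  have len: "length [f1, f2, f3, f4, f5] = CARD(5)" by simp
  have "poly (blaschke_num [0, f1, f2, f3, f4, f5]) t = X t * X5 t" for t
    by (simp only: poly_blaschke_Cons blaschke_simps(1) poly_1 cubic_num_def X5_def diff_zero mult_1_left mult_1_right mult_ac)
  moreover have "poly (blaschke_den [0, f1, f2, f3, f4, f5]) t = Y t * Y5 t" for t
    by (simp only: poly_blaschke_Cons blaschke_simps(3) poly_1 cubic_den_def Y5_def complex_cnj_zero
        mult_zero_left diff_zero mult_1_right mult_1_left mult_ac)
  ultimately show ?thesis
    using S_class_pencil_iff[OF S charpoly_A len foci_disk assms] by simp
qed

lemma YY5_nz: "norm t \<le> 1 \<Longrightarrow> Y t * Y5 t \<noteq> 0"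
  unfolding Y5_def using Y_nz reflected_factor_nz disk by simp

lemma same_vertex_iff:
  assumes z: "poly (vertex_poly A lam) z = 0" "norm z = 1" and w: "norm w = 1"
  shows "poly (vertex_poly A lam) w = 0 \<longleftrightarrow> X z * X5 z * (Y w * Y5 w) = X w * X5 w * (Y z * Y5 z)"
proof -
  have 1: "X z * X5 z = cnj lam * (Y z * Y5 z)" using z unfolding vertex_eq by simp
  have "poly (vertex_poly A lam) w = 0 \<longleftrightarrow> X w * X5 w = cnj lam * (Y w * Y5 w)" unfolding vertex_eq by simp
  also have "\<dots> \<longleftrightarrow> X w * X5 w * (Y z * Y5 z) = cnj lam * (Y w * Y5 w) * (Y z * Y5 z)"
    using YY5_nz[of z] z by (metis mult_right_cancel order_refl)
  finally show ?thesis unfolding 1 by (auto simp: mult_ac)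
qed

text \<open>Both conditions say that \<open>z\<close> and \<open>w\<close> have the same image under the Blaschke product.\<close>

lemma vertex_pencil_iff:
  assumes "poly (vertex_poly A lam) z = 0" "norm z = 1" "norm w = 1" "z \<noteq> w"
  shows "det (pencil A (z + w) (z * w)) = 0 \<longleftrightarrow> poly (vertex_poly A lam) w = 0"
  using pencil_iff same_vertex_iff assms by blast

text \<open>The supporting line carries a singular pencil, so it is a chord \<open>z w\<close> of some hexagon. If a vertex \<open>q\<close> were
beyond it, the numerical range would meet the chord \<open>z q\<close> in a point that is inside the open disk, hence
strictly beyond the supporting line. So \<open>z\<close> and \<open>w\<close> are neighbours, \<open>K\<close> vanishes by interlacing, and \<open>f5\<close> is not
on their chord.\<close>

lemma support_equation:
  assumes K: "\<And>z w. K z w = (incidence f5 z w)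
    * ((incidence f1 z w) * (incidence f2 z w) - \<kappa> * (z * w))"
    and k: "norm k = 1"
  obtains h where "\<And>u. u \<in> numerical_range A \<Longrightarrow> Re (cnj k * u) \<le> h"
    "\<exists>u \<in> numerical_range A. Re (cnj k * u) = h"
    "complex_of_real (4 * (h - Re (cnj k * f1)) * (h - Re (cnj k * f2))) = \<kappa>"
proof -
  obtain h x where x: "norm x = 1" "Re (cnj k * cinner x (A *v x)) = h"
    and max: "\<And>u. u \<in> numerical_range A \<Longrightarrow> Re (cnj k * u) \<le> h"
    and ker: "(pencil A (2 * complex_of_real h * k) (k\<^sup>2)) *v x = 0"
    using numerical_range_support_kernel[OF k] by metis
  have xW: "cinner x (A *v x) \<in> numerical_range A" using x unfolding numerical_range_def by blast
  have "\<bar>h\<bar> < 1"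
    using S_class_numerical_range_disk[OF S xW] abs_Re_le_cmod[of "cnj k * cinner x (A *v x)"] x(2) k
    by (simp add: norm_mult)
  then obtain z w l where zw: "norm z = 1" "norm w = 1" "z \<noteq> w" "z + w = 2 * complex_of_real h * k" "z * w = k\<^sup>2"
    and l: "0 < l" "\<And>q. orient z w q = l * (Re (cnj k * q) - h)" and zh: "Re (cnj k * z) = h"
    using chord_at_height[OF k] by metis
  have "x \<noteq> 0" using x by auto
  then have sing: "det (pencil A (z + w) (z * w)) = 0"
    unfolding zw(4,5) det_eq_0_iff_kernel using ker by blast
  obtain lam where lam: "norm lam = 1" "poly (vertex_poly A lam) z = 0" using vertex_parameter[OF zw(1)] .
  have w0: "poly (vertex_poly A lam) w = 0" using vertex_pencil_iff[OF lam(2) zw(1-3)] sing by blast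
  \<comment> \<open>a vertex beyond the supporting line would drag the numerical range beyond it\<close>
  have inner: "Re (cnj k * q) \<le> h" if q: "poly (vertex_poly A lam) q = 0" for q
  proof (rule ccontr)
    assume out: "\<not> Re (cnj k * q) \<le> h"
    then have zq: "z \<noteq> q" using zh by auto
    have uq: "norm q = 1" using vertices_unit[OF lam(1) q] .
    have "det (pencil A (z + q) (z * q)) = 0"
      using vertex_pencil_iff[OF lam(2) zw(1) uq zq] q by blast
    then obtain u where u: "u \<in> numerical_range A" "u + z * q * cnj u = z + q"
      using numerical_range_meets_line by blast
    have "u \<in> affine hull {z, q}" unfolding affine_hull_unit_chord[OF zw(1) uq zq] using u(2) by simp
    then obtain s t where st: "0 < s" "0 < t" "s + t = 1" "u = s *\<^sub>R z + t *\<^sub>R q"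
      using interior_point_of_chord[OF zw(1) uq _ S_class_numerical_range_disk[OF S u(1)]] by blast
    have "Re (cnj k * u) = s * Re (cnj k * z) + t * Re (cnj k * q)"
      unfolding st(4) by (simp add: algebra_simps)
    also have "\<dots> > s * h + t * h" using st(2) out zh by simp
    finally have "Re (cnj k * u) > h" using st(3) by (simp flip: distrib_right)
    then show False using max[OF u(1)] by simp
  qed
  obtain P0 where P0: "vertex_labelling A lam P0" using labelling_exists[OF lam(1)] by blast
  then obtain n where n: "n < 6" "z = P0 n" using lam(2) unfolding vertex_labelling_def by auto
  define P where "P j = P0 ((j + n) mod 6)" for j
  have P: "vertex_labelling A lam P" unfolding P_def by (rule labelling_shift[OF P0])
  have z: "z = P 0" using n by (simp add: P_def)
  obtain i where i: "i < 6" "w = P i" using w0 P unfolding vertex_labelling_def by auto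
  have i0: "i \<noteq> 0" using zw(3) z i(2) by metis
  have i5: "i = 5"
  proof (rule ccontr)
    assume "i \<noteq> 5"
    then have "orient z w (P 5) > 0" using labelling_orient(2)[OF P, of 0 i 5] i i0 z by simp
    then have "Re (cnj k * P 5) > h" using l by (simp add: zero_less_mult_iff)
    then show False using inner[OF vertex_root[OF P, of 5]] by simp
  qed
  have "C z \<noteq> C w" using fibres_interlace[OF lam(1) P i(1)] z i(2) i5 by simp
  then have K0: "K z w = 0" using K_vanishes[OF lam w0] by simp
  have "w \<noteq> \<tau> z" using involution_opposite[OF lam(1) P, of 0 3] labelling_distinct[OF P, of 5 3] z i(2) i5 by simp
  then have "f5 \<notin> affine hull {z, w}" using chord_through_point_iff[OF disk(5) zw(1-3)] by blast
  then have "z + w - f5 - z * w * cnj f5 \<noteq> 0"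
    unfolding affine_hull_unit_chord[OF zw(1-3)] by (auto simp: algebra_simps)
  then have "(incidence f1 z w) * (incidence f2 z w) = \<kappa> * (z * w)"
    using K0 unfolding K by simp
  then have "2 * complex_of_real (h - Re (cnj k * f1)) * k * (2 * complex_of_real (h - Re (cnj k * f2)) * k) = \<kappa> * k\<^sup>2"
    unfolding zw(4,5) pencil_at_point[OF k] .
  then have "k\<^sup>2 * complex_of_real (4 * (h - Re (cnj k * f1)) * (h - Re (cnj k * f2))) = k\<^sup>2 * \<kappa>"
    unfolding of_real_mult of_real_numeral by algebra
  moreover have "k \<noteq> 0" using k by auto
  ultimately have "complex_of_real (4 * (h - Re (cnj k * f1)) * (h - Re (cnj k * f2))) = \<kappa>" by simp
  then show thesis using that[of h] max xW x(2) by blast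
qed

text \<open>The tangents of the inner ellipse are chords of hexagons as well, so they also carry a singular pencil.\<close>

lemma inner_tangent_meets:
  assumes k: "norm k = 1"
    and \<mu>: "4 * (\<mu> - Re (cnj k * f3)) * (\<mu> - Re (cnj k * f4)) = (norm (1 - cnj f3 * f4))\<^sup>2 - (dist f3 f4)\<^sup>2"
  shows "\<exists>u\<in>numerical_range A. Re (cnj k * u) = \<mu>"
proof -
  note ax = inellipse_axis[OF disk(3,4)]
  have ex: "\<exists>!u. u \<in> {u. u + k\<^sup>2 * cnj u = 2 * complex_of_real \<mu> * k} \<inter> ellipse f3 f4 (norm (1 - cnj f3 * f4))"
    using tangent_rotated_line[OF k ax(1)] \<mu> by blast
  then obtain v where v: "v + k\<^sup>2 * cnj v = 2 * complex_of_real \<mu> * k" "v \<in> ellipse f3 f4 (norm (1 - cnj f3 * f4))"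
    by blast
  have "Re (cnj k * v) = \<mu>" using v(1) rotated_line_iff[OF k] by blast
  then have "\<bar>\<mu>\<bar> < 1"
    using inellipse_inside[OF disk(3,4) v(2)] abs_Re_le_cmod[of "cnj k * v"] k by (simp add: norm_mult)
  then obtain z w where zw: "norm z = 1" "norm w = 1" "z \<noteq> w" "z + w = 2 * complex_of_real \<mu> * k" "z * w = k\<^sup>2"
    using chord_at_height[OF k] by metis
  have "\<exists>!u. u \<in> affine hull {z, w} \<inter> ellipse f3 f4 (norm (1 - cnj f3 * f4))"
    using ex unfolding affine_hull_unit_chord[OF zw(1-3)] zw(4,5) .
  then have "C z = C w" using inellipse_tangent_iff[OF disk(3,4) zw(1-3)] C_eq_iff[OF zw(1,2)] by blast
  moreover obtain lam where lam: "norm lam = 1" "poly (vertex_poly A lam) z = 0" using vertex_parameter[OF zw(1)] .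
  ultimately have "poly (vertex_poly A lam) w = 0" using vertex_iff_C zw(1,2) by metis
  then have "det (pencil A (z + w) (z * w)) = 0"
    using vertex_pencil_iff[OF lam(2) zw(1-3)] by blast
  then obtain u where "u \<in> numerical_range A" "u + z * w * cnj u = z + w" using numerical_range_meets_line by blast
  then show ?thesis unfolding zw(4,5) rotated_line_iff[OF k] by blast
qed

text \<open>It remains to see that \<open>\<kappa>\<close> is positive. In the direction in which both foci have the same height \<open>x\<close> the
equation of the supporting line is \<open>4 (h - x)\<^sup>2 = \<kappa>\<close>. If \<open>\<kappa>\<close> were zero, the numerical range would be flat in this
direction; but it meets both parallel tangents of the inner ellipse.\<close>

lemma numerical_range_ellipse:
  obtains r where "dist f1 f2 < r" "numerical_range A = {z. dist z f1 + dist z f2 \<le> r}"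
proof -
  obtain \<kappa> where K: "\<And>z w. K z w = (incidence f5 z w)
    * ((incidence f1 z w) * (incidence f2 z w) - \<kappa> * (z * w))"
    using K_factor by blast
  have eig: "f \<in> numerical_range A" if "f \<in> {f1, f2}" for f
  proof -
    have "poly (charpoly A) f = 0" using that unfolding charpoly_A by (auto simp: poly_blaschke_Cons simp del: blaschke_simps)
    then show ?thesis using eigenvalue_iff_charpoly_root numerical_range_eigenvalue by blast
  qed
  \<comment> \<open>the normal of the line of the foci, so that both foci have the same height\<close>
  obtain k where k: "norm k = 1" "Re (cnj k * f1) = Re (cnj k * f2)"
  proof (cases "f1 = f2")
    case True
    then show ?thesis using that[of 1] by simp
  next
    case False
    define k where "k = \<i> * ((f1 - f2) / complex_of_real (norm (f1 - f2)))"
    have "norm k = 1" using False by (simp add: k_def norm_mult norm_divide)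
    moreover have "cnj k * (f1 - f2) = - \<i> * complex_of_real (norm (f1 - f2))"
    proof -
      have "cnj k * (f1 - f2) = - \<i> * ((f1 - f2) * cnj (f1 - f2)) / complex_of_real (norm (f1 - f2))"
        by (simp add: k_def mult_ac)
      then show ?thesis unfolding mult_cnj_self using False by (simp add: power2_eq_square)
    qed
    then have "Re (cnj k * (f1 - f2)) = 0" by simp
    then have "Re (cnj k * f1) = Re (cnj k * f2)" by (simp add: right_diff_distrib)
    ultimately show ?thesis using that by blast
  qed
  define x where "x = Re (cnj k * f1)"
  obtain h where h: "\<And>u. u \<in> numerical_range A \<Longrightarrow> Re (cnj k * u) \<le> h"
    "complex_of_real (4 * (h - x) * (h - x)) = \<kappa>"
    using support_equation[OF K k(1)] unfolding k(2)[symmetric] x_def by metis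
  obtain h' where h': "\<And>u. u \<in> numerical_range A \<Longrightarrow> Re (cnj (- k) * u) \<le> h'"
    "complex_of_real (4 * (h' + x) * (h' + x)) = \<kappa>"
  proof -
    have nk: "norm (- k) = 1" using k by simp
    have e: "Re (cnj (- k) * f1) = - x" "Re (cnj (- k) * f2) = - x"
      unfolding x_def by (simp, simp only: complex_cnj_minus mult_minus_left uminus_complex.sel k(2))
    obtain h' where h': "\<And>u. u \<in> numerical_range A \<Longrightarrow> Re (cnj (- k) * u) \<le> h'"
      "complex_of_real (4 * (h' - (- x)) * (h' - (- x))) = \<kappa>"
      using support_equation[OF K nk] unfolding e by metis
    show ?thesis by (rule that[OF h'(1)]) (use h'(2) in simp_all)
  qed
  have "h \<noteq> x"
  proof
    assume hx: "h = x"
    then have \<kappa>0: "\<kappa> = 0" using h(2) by simp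
    then have "4 * (h' + x) * (h' + x) = 0" using h'(2) by (simp only: of_real_eq_0_iff)
    then have "h' = - x" by auto
    then have flat: "Re (cnj k * u) = x" if "u \<in> numerical_range A" for u
      proof -
      have "Re (cnj (- k) * u) = - Re (cnj k * u)" by simp
      then show ?thesis using h(1)[OF that] h'(1)[OF that] hx \<open>h' = - x\<close> by linarith
    qed
    define q where "q = (norm (1 - cnj f3 * f4))\<^sup>2 - (dist f3 f4)\<^sup>2"
    have q: "q > 0" using inellipse_axis(1)[OF disk(3,4)] by (simp add: q_def power_strict_mono)
    define y y' where "y = Re (cnj k * f3)" and "y' = Re (cnj k * f4)"
    define d where "d = sqrt ((y - y')\<^sup>2 + q)"
    have d: "d > 0" "d\<^sup>2 = (y - y')\<^sup>2 + q" using q by (auto simp: d_def intro: add_nonneg_pos)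
    have root: "4 * (\<mu> - y) * (\<mu> - y') = q" if "(2 * \<mu> - y - y')\<^sup>2 = d\<^sup>2" for \<mu>
      using that d(2) by (simp add: power2_eq_square algebra_simps)
    have "\<exists>u\<in>numerical_range A. Re (cnj k * u) = (y + y' + e) / 2" if "e\<^sup>2 = d\<^sup>2" for e
    proof (rule inner_tangent_meets[OF k(1)])
      have "2 * ((y + y' + e) / 2) - y - y' = e" by (simp add: field_simps)
      then have "4 * ((y + y' + e) / 2 - y) * ((y + y' + e) / 2 - y') = q" using root that by metis
      then show "4 * ((y + y' + e) / 2 - Re (cnj k * f3)) * ((y + y' + e) / 2 - Re (cnj k * f4))
          = (norm (1 - cnj f3 * f4))\<^sup>2 - (dist f3 f4)\<^sup>2"
        unfolding y_def y'_def q_def .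
    qed
    then have "(y + y' + e) / 2 = x" if "e\<^sup>2 = d\<^sup>2" for e using flat that by metis
    from this[of d] this[of "- d"] have "(y + y' + d) / 2 = (y + y' + - d) / 2" by simp
    then have "y + y' + d = y + y' + - d" by (simp only: divide_cancel_right) simp
    then show False using d(1) by simp
  qed
  define \<rho> where "\<rho> = 4 * (h - x) * (h - x)"
  have \<rho>: "\<rho> > 0" "complex_of_real \<rho> = \<kappa>" using \<open>h \<noteq> x\<close> h(2) unfolding \<rho>_def by (auto simp: zero_less_mult_iff linorder_neq_iff)
  define r where "r = sqrt ((dist f1 f2)\<^sup>2 + \<rho>)"
  have r2: "r\<^sup>2 - (dist f1 f2)\<^sup>2 = \<rho>" using \<rho>(1) by (simp add: r_def)
  have r: "dist f1 f2 < r" unfolding r_def using \<rho>(1) by (intro real_less_rsqrt) simp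
  have "numerical_range A = {z. dist z f1 + dist z f2 \<le> r}"
  proof (rule elliptical_disk_by_support[OF convex_numerical_range _ _ r])
    show "closed (numerical_range A)" using compact_numerical_range compact_imp_closed by blast
    show "numerical_range A \<noteq> {}" using eig by blast
    fix k' :: complex assume k': "norm k' = 1"
    obtain h where h: "\<And>u. u \<in> numerical_range A \<Longrightarrow> Re (cnj k' * u) \<le> h"
      "\<exists>u \<in> numerical_range A. Re (cnj k' * u) = h"
      "complex_of_real (4 * (h - Re (cnj k' * f1)) * (h - Re (cnj k' * f2))) = \<kappa>"
      using support_equation[OF K k'] by metis
    have "4 * (h - Re (cnj k' * f1)) * (h - Re (cnj k' * f2)) = r\<^sup>2 - (dist f1 f2)\<^sup>2"
      unfolding r2 using h(3) unfolding \<rho>(2)[symmetric] of_real_eq_iff .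
    then show "\<exists>h. (\<forall>u\<in>numerical_range A. Re (cnj k' * u) \<le> h) \<and> (\<exists>u\<in>numerical_range A. Re (cnj k' * u) = h)
      \<and> Re (cnj k' * f1) \<le> h \<and> Re (cnj k' * f2) \<le> h
      \<and> 4 * (h - Re (cnj k' * f1)) * (h - Re (cnj k' * f2)) = r\<^sup>2 - (dist f1 f2)\<^sup>2"
      using h(1,2) eig by (intro exI[of _ h]) blast
  qed
  then show thesis using that r by blast
qed

end

section \<open>The characterization\<close>

theorem theorem11:
  fixes A :: "complex^5^5" and f1 f2 f3 f4 f5 :: complex
  assumes "A \<in> S_class"
    and "charpoly A = [:-f1, 1:] * [:-f2, 1:] * [:-f3, 1:] * [:-f4, 1:] * [:-f5, 1:]"
  shows "(elliptical_disk (numerical_range A)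
          \<and> is_ellipse_with_foci (frontier (numerical_range A)) f1 f2
          \<and> pentagram_is_ellipse_with_foci A f3 f4
          \<and> brianchon_is_point A f5)
      \<longleftrightarrow>
         ({f3, f4} = {(f5 - f2) / (1 - f2 * cnj f5), (f5 - f1) / (1 - f1 * cnj f5)}
          \<and> f3 + f4 + f1 * f2 * f5 * cnj f4 * cnj f3 = f1 + f2 + f5
          \<and> f3 * f4 + f1 * f2 * f5 * (cnj f4 + cnj f3) = f1 * f2 + f2 * f5 + f1 * f5)"
proof -
  have cp: "charpoly A = blaschke_num [f1, f2, f3, f4, f5]"
    unfolding assms(2) blaschke_simps mult_1_right by (simp only: mult.assoc)
  have "norm f < 1" if "f \<in> {f1, f2, f3, f4, f5}" for f
  proof -
    have "poly (charpoly A) f = 0"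
      using that unfolding cp by (auto simp: poly_blaschke_Cons simp del: blaschke_simps)
    then show ?thesis using assms(1) eigenvalue_iff_charpoly_root unfolding S_class_def by blast
  qed
  then interpret quintic A f1 f2 f3 f4 f5
    using cp by unfold_locales auto
  show ?thesis
  proof (rule iffI, goal_cases)
    case 1
    then show ?case using forward_foci pentagram_imp_equations by blast
  next
    case 2
    interpret S_quintic A f1 f2 f3 f4 f5
      using 2 assms(1) by unfold_locales auto
    obtain r where r: "dist f1 f2 < r" "numerical_range A = {z. dist z f1 + dist z f2 \<le> r}"
      using numerical_range_ellipse by blast
    have "elliptical_disk (numerical_range A)" unfolding elliptical_disk_def using r by blast
    moreover have "is_ellipse_with_foci (frontier (numerical_range A)) f1 f2"
      unfolding is_ellipse_with_foci_def using r frontier_elliptical_disk[OF r(1)] by auto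
    ultimately show ?case
      using pentagram brianchon by blast
  qed
qed

end
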